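(* There are constants $\alpha>0$ and $\beta>0$ such that for every positive integer $n$ the following holds. Let $m=2n-1$ if $n$ is even and $m=2n$ if $n$ is odd. If $\varphi$ is an $\alpha$-dense $m$-edge precoloring of the complete graph $K_{2n}$, $L$ is a $\beta$-sparse list assignment for $K_{2n}$ from the color set $\{1,\dots,m\}$, and $\varphi(e)\notin L(e)$ for every edge $e\in E(K_{2n})$ that is colored under $\varphi$, then there is a proper $m$-edge coloring $f$ of $K_{2n}$ such that $f(e)=\varphi(e)$ for every edge $e$ colored under $\varphi$, and $f(e)\notin L(e)$ for every edge $e$ of $K_{2n}$.
   Context: An $m$-edge precoloring (partial edge coloring) of a graph $G$ is a proper edge coloring, with colors from $\{1,\dots,m\}$, of some subset $E'\subseteq E(G)$ (adjacent colored edges receive distinct colors). A partial edge coloring of $K_{2n}$ with colors $1,\dots,m$ is $\alpha$-dense if (i) every color appears on at most $\alpha m$ edges, and (ii) for every vertex $v$, at most $\alpha m$ edges incident to $v$ are colored. A list assignment $L$ assigns to each edge $e$ a set $L(e)\subseteq\{1,\dots,m\}$ (of forbidden colors); it is $\beta$-sparse if (i) $|L(e)|\le \beta m$ for every edge $e$, and (ii) for every vertex $v$ and every color $c$, $c$ belongs to $L(e)$ for at most $\beta m$ edges $e$ incident to $v$. *)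

theory Defs
  imports Complex_Main "HOL-Library.Ramsey"
begin

text \<open>
  A simple graph is given by its set \<open>E\<close> of edges, each edge being the two-element set of its
  endpoints, together with its vertex set \<open>V\<close> where that is needed.
\<close>

definition complete_edges :: "'a set \<Rightarrow> 'a set set" where
  "complete_edges V = nsets V 2"

definition adjacent_edges :: "'a set \<Rightarrow> 'a set \<Rightarrow> bool" where
  "adjacent_edges e e' \<longleftrightarrow> e \<noteq> e' \<and> e \<inter> e' \<noteq> {}"

definition proper_edge_coloring :: "'a set set \<Rightarrow> nat \<Rightarrow> ('a set \<Rightarrow> nat) \<Rightarrow> bool" where
  "proper_edge_coloring E m f \<longleftrightarrow>
     (\<forall>e\<in>E. f e \<in> {1..m}) \<and>
     (\<forall>e\<in>E. \<forall>e'\<in>E. adjacent_edges e e' \<longrightarrow> f e \<noteq> f e')"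

text \<open>The colored edges are those in \<open>dom \<phi>\<close>; \<open>\<phi> e = None\<close> means that \<open>e\<close> is uncolored.\<close>

definition edge_precoloring :: "'a set set \<Rightarrow> nat \<Rightarrow> ('a set \<rightharpoonup> nat) \<Rightarrow> bool" where
  "edge_precoloring E m \<phi> \<longleftrightarrow>
     dom \<phi> \<subseteq> E \<and> proper_edge_coloring (dom \<phi>) m (\<lambda>e. the (\<phi> e))"

definition dense_coloring :: "'a set \<Rightarrow> nat \<Rightarrow> real \<Rightarrow> ('a set \<rightharpoonup> nat) \<Rightarrow> bool" where
  "dense_coloring V m \<alpha> \<phi> \<longleftrightarrow>
     (\<forall>c\<in>{1..m}. real (card {e \<in> complete_edges V. \<phi> e = Some c}) \<le> \<alpha> * real m) \<and>
     (\<forall>v\<in>V. real (card {e \<in> complete_edges V. v \<in> e \<and> \<phi> e \<noteq> None}) \<le> \<alpha> * real m)"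

text \<open>\<open>L e\<close> is the set of colors forbidden on the edge \<open>e\<close>.\<close>

definition list_assignment :: "'a set set \<Rightarrow> nat \<Rightarrow> ('a set \<Rightarrow> nat set) \<Rightarrow> bool" where
  "list_assignment E m L \<longleftrightarrow> (\<forall>e\<in>E. L e \<subseteq> {1..m})"

definition sparse_lists :: "'a set \<Rightarrow> nat \<Rightarrow> real \<Rightarrow> ('a set \<Rightarrow> nat set) \<Rightarrow> bool" where
  "sparse_lists V m \<beta> L \<longleftrightarrow>
     (\<forall>e\<in>complete_edges V. real (card (L e)) \<le> \<beta> * real m) \<and>
     (\<forall>v\<in>V. \<forall>c\<in>{1..m}.
        real (card {e \<in> complete_edges V. v \<in> e \<and> c \<in> L e}) \<le> \<beta> * real m)"

end

theory Submission
  imports Defs "HOL-Combinatorics.Permutations"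
begin

text \<open>
  Start from an explicit coloring in which the vertices form four blocks and almost every edge
  between two blocks lies in linearly many 2-colored 4-cycles.  A random permutation of the vertices
  makes the conflicts with the lists and the interference with the precoloring sparse at every
  vertex and in every color; the edges in conflict are then precolored greedily as well.
  The remaining precolored edges are fixed one at a time.  To give \<open>uv\<close>, of color \<open>a\<close>, the color \<open>c\<close>,
  choose generic vertices \<open>w\<close>, \<open>z\<close> and turn \<open>uw\<close>, \<open>vz\<close> into color \<open>c\<close> and \<open>wz\<close> into color \<open>a\<close>; then exchange \<open>a\<close>
  and \<open>c\<close> on the cycle \<open>u v z w\<close>.  Turning a generic edge \<open>pq\<close> into color \<open>b\<close> takes three exchanges: with
  \<open>p1\<close>, \<open>q1\<close> the \<open>b\<close>-neighbors of \<open>p\<close>, \<open>q\<close> and a generic color \<open>d\<close>, structured 4-cycles recolor \<open>pq\<close> and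
  \<open>p1 q1\<close> with \<open>d\<close>, and then \<open>b\<close> and \<open>d\<close> are exchanged on \<open>p q q1 p1\<close>.  Only \<open>p p1\<close> may be arbitrary;
  all other edges involved are untouched, and potentials ensure that no vertex or color is used up.
\<close>

section \<open>Colorings as systems of involutions\<close>

text \<open>Sparseness allows a color to be forbidden on one edge at every vertex, so a fixed
  coloring may have an entire color class in conflict; placing the vertices at random removes this
  obstacle. A forbidden base color is handled as one more precoloring demand, so that a single
  recoloring procedure serves both. Four blocks are exactly enough: the choice of \<open>z\<close>
  rules out up to three of them. The construction needs a multiple of four vertices. For odd
  \<open>n\<close> it is made for \<open>2 * n + 2\<close> vertices and \<open>2 * n + 1\<close>
  colors, and deleting the two ends of an edge costs one color; this accounts for
  \<open>2 * n\<close> colors in that case. The counts live on widely separated scales. With N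
  vertices, the given data are bounded by about N / 10 ^ 30, the interference after the random
  placement by N / 10 ^ 12, the enlarged precoloring by N / 10 ^ 10, and the damage tolerated at a
  vertex or in a color by N / 10 ^ 3. The gaps make every choice a crude count: far fewer candidates
  are excluded than exist.\<close>

text \<open>A color acts as a fixed-point-free involution.  A pair may be covered by two colors: for odd \<open>n\<close>
  there are as many colors as vertices, and the second color of such a pair is a dummy that stands
  for the color missing at both of its ends.\<close>

definition csys :: "'v set \<Rightarrow> 'c set \<Rightarrow> ('c \<Rightarrow> 'v \<Rightarrow> 'v) \<Rightarrow> bool" where
  "csys V C nb \<longleftrightarrow>
     (\<forall>k\<in>C. \<forall>x\<in>V. nb k x \<in> V \<and> nb k x \<noteq> x \<and> nb k (nb k x) = x) \<and>
     (\<forall>x\<in>V. \<forall>y\<in>V. x \<noteq> y \<longrightarrow> (\<exists>k\<in>C. nb k x = y))"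

lemma csysD:
  assumes "csys V C nb" "k \<in> C" "x \<in> V"
  shows "nb k x \<in> V" "nb k x \<noteq> x" "nb k (nb k x) = x"
  using assms unfolding csys_def by auto

lemma csys_cover:
  assumes "csys V C nb" "x \<in> V" "y \<in> V" "x \<noteq> y"
  obtains k where "k \<in> C" "nb k x = y"
  using assms unfolding csys_def by blast

lemma csys_bij:
  assumes "csys V C nb" "k \<in> C"
  shows "bij_betw (nb k) V V"
  by (rule bij_betw_byWitness[where f' = "nb k"]) (use csysD[OF assms] in auto)

lemma csys_eq_iff:
  assumes "csys V C nb" "k \<in> C" "x \<in> V" "y \<in> V"
  shows "nb k x = y \<longleftrightarrow> nb k y = x"
  using csysD[OF assms(1,2)] assms(3,4) by metis

lemma card_vimage_nb_le:
  assumes "csys V C nb" "k \<in> C" "finite V"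
  shows "card {x\<in>V. nb k x \<in> B} \<le> card (B \<inter> V)"
proof (rule card_inj_on_le[where f = "nb k"])
  show "inj_on (nb k) {x\<in>V. nb k x \<in> B}"
    using csys_bij[OF assms(1,2)] by (auto simp: bij_betw_def intro: inj_on_subset)
qed (use csysD[OF assms(1,2)] assms(3) in auto)

text \<open>With at most \<open>card V\<close> colors, at most one vertex is reached twice from \<open>x\<close>.\<close>

lemma card_colors_le:
  assumes cs: "csys V C nb" and fin: "finite V" "finite C" and le: "card C \<le> card V"
    and x: "x \<in> V"
  shows "card {k\<in>C. nb k x \<in> B} \<le> card (B \<inter> V) + 1"
proof -
  let ?D = "V - {x} - B"
  have "?D \<subseteq> (\<lambda>k. nb k x) ` {k\<in>C. nb k x \<notin> B}"
  proof
    fix y assume y: "y \<in> ?D"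
    then obtain k where "k \<in> C" "nb k x = y" using csys_cover[OF cs x, of y] by blast
    then show "y \<in> (\<lambda>k. nb k x) ` {k\<in>C. nb k x \<notin> B}" using y by auto
  qed
  then have 1: "card ?D \<le> card {k\<in>C. nb k x \<notin> B}"
    using fin by (intro surj_card_le) auto
  have "C = {k\<in>C. nb k x \<in> B} \<union> {k\<in>C. nb k x \<notin> B}" by auto
  then have 2: "card C = card {k\<in>C. nb k x \<in> B} + card {k\<in>C. nb k x \<notin> B}"
    using fin by (subst card_Un_disjoint[symmetric]) auto
  have "V \<subseteq> ?D \<union> insert x (B \<inter> V)" by auto
  then have "card V \<le> card (?D \<union> insert x (B \<inter> V))"
    using fin by (intro card_mono) auto
  also have "\<dots> \<le> card ?D + card (insert x (B \<inter> V))" by (rule card_Un_le)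
  also have "\<dots> \<le> card ?D + (card (B \<inter> V) + 1)"
    using fin by (simp add: card_insert_if)
  finally show ?thesis using 1 2 le by linarith
qed

section \<open>Exchanges of two colors on closed vertex sets\<close>

definition kswap :: "'c \<Rightarrow> 'c \<Rightarrow> 'v set \<Rightarrow> ('c \<Rightarrow> 'v \<Rightarrow> 'v) \<Rightarrow> 'c \<Rightarrow> 'v \<Rightarrow> 'v" where
  "kswap a b S nb = (\<lambda>k x. if x \<in> S then nb (if k = a then b else if k = b then a else k) x
                            else nb k x)"

lemma csys_kswap:
  assumes cs: "csys V C nb" and ab: "a \<in> C" "b \<in> C"
    and cl: "nb a ` S \<subseteq> S" "nb b ` S \<subseteq> S"
  shows "csys V C (kswap a b S nb)"
proof -
  have out: "nb k x \<notin> S" if "x \<in> V" "x \<notin> S" "k = a \<or> k = b" for x k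
    using that cl ab csysD(3)[OF cs, of k x] by (auto simp: image_subset_iff)
  have 1: "kswap a b S nb k x \<in> V \<and> kswap a b S nb k x \<noteq> x
      \<and> kswap a b S nb k (kswap a b S nb k x) = x" if "k \<in> C" "x \<in> V" for k x
    using that csysD[OF cs] ab cl out[of x k] unfolding kswap_def
    by (auto simp: image_subset_iff)
  have 2: "\<exists>k\<in>C. kswap a b S nb k x = y" if xy: "x \<in> V" "y \<in> V" "x \<noteq> y" for x y
  proof -
    obtain k where k: "k \<in> C" "nb k x = y" using csys_cover[OF cs xy] by blast
    show ?thesis
    proof (cases "x \<in> S")
      case True
      have "kswap a b S nb (if k = a then b else if k = b then a else k) x = y"
        using k True unfolding kswap_def by auto
      then show ?thesis using k ab by (intro bexI[of _ "if k = a then b else if k = b then a else k"]) auto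
    next
      case False
      then show ?thesis using k unfolding kswap_def by auto
    qed
  qed
  show ?thesis unfolding csys_def using 1 2 by blast
qed

text \<open>\<open>VS\<close> and \<open>CS\<close> limit where exchanges may happen and the index
  counts them. Closure of \<open>S\<close> is asked of the system reached so far, since the 4-cycles
  used later only arise from earlier exchanges.\<close>

inductive swaps :: "'v set \<Rightarrow> 'c set \<Rightarrow> nat \<Rightarrow> ('c \<Rightarrow> 'v \<Rightarrow> 'v) \<Rightarrow> ('c \<Rightarrow> 'v \<Rightarrow> 'v) \<Rightarrow> bool"
  for VS CS where
  swaps_0: "swaps VS CS 0 nb nb"
| swaps_Suc: "swaps VS CS n nb nb' \<Longrightarrow> a \<in> CS \<Longrightarrow> b \<in> CS \<Longrightarrow> S \<subseteq> VS \<Longrightarrow> finite S \<Longrightarrow> card S \<le> 4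
    \<Longrightarrow> nb' a ` S \<subseteq> S \<Longrightarrow> nb' b ` S \<subseteq> S \<Longrightarrow> swaps VS CS (Suc n) nb (kswap a b S nb')"

lemma swaps_trans:
  assumes "swaps VS CS m nb1 nb2" "swaps VS CS n nb nb1"
  shows "swaps VS CS (n + m) nb nb2"
  using assms by (induction rule: swaps.induct) (auto intro: swaps.intros)

lemma swaps_mono:
  assumes "swaps VS CS n nb nb'" "VS \<subseteq> VS'" "CS \<subseteq> CS'"
  shows "swaps VS' CS' n nb nb'"
  using assms by (induction rule: swaps.induct) (auto intro!: swaps.intros)

lemma swaps_csys:
  assumes "swaps VS CS n nb nb'" "CS \<subseteq> C" "csys V C nb"
  shows "csys V C nb'"
  using assms by (induction rule: swaps.induct) (auto intro: csys_kswap)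

lemma swaps_unchanged:
  assumes "swaps VS CS n nb nb'" "x \<notin> VS \<or> k \<notin> CS"
  shows "nb' k x = nb k x"
  using assms by (induction rule: swaps.induct) (auto simp: kswap_def)

text \<open>One exchange affects at most 4 vertices and 2 colors, hence 8 incidences. The three
  counts are proved together because finiteness of the fibres over a vertex or a color comes from
  finiteness of the set of incidences.\<close>

lemma swaps_changed:
  assumes "swaps VS CS n nb nb'"
  shows "finite {(x, k). nb' k x \<noteq> nb k x} \<and> card {(x, k). nb' k x \<noteq> nb k x} \<le> 8 * n
    \<and> card {k. nb' k x \<noteq> nb k x} \<le> 2 * n \<and> card {x. nb' k x \<noteq> nb k x} \<le> 4 * n"
  using assms
proof (induction arbitrary: x k rule: swaps.induct)
  case (swaps_0 nb)
  then show ?case by simp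
next
  case (swaps_Suc n nb nb' a b S)
  let ?nb = "kswap a b S nb'"
  let ?F = "{(x, k). nb' k x \<noteq> nb k x}"
  have fk: "finite {k. nb' k x \<noteq> nb k x}" for x
    by (rule finite_subset[of _ "snd ` ?F"]) (use swaps_Suc.IH in force)+
  have fx: "finite {x. nb' k x \<noteq> nb k x}" for k
    by (rule finite_subset[of _ "fst ` ?F"]) (use swaps_Suc.IH in force)+
  have S: "card (S \<times> {a, b}) \<le> 8"
  proof -
    have "card (S \<times> {a, b}) = card S * card {a, b}" by (rule card_cartesian_product)
    also have "\<dots> \<le> 4 * 2" using swaps_Suc by (intro mult_mono) (auto simp: card_insert_if)
    finally show ?thesis by simp
  qed
  have sub: "{(x, k). ?nb k x \<noteq> nb k x} \<subseteq> ?F \<union> S \<times> {a, b}" by (auto simp: kswap_def split: if_splits)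
  have 1: "card {(x, k). ?nb k x \<noteq> nb k x} \<le> card ?F + 8"
    using card_mono[OF _ sub] card_Un_le[of ?F "S \<times> {a, b}"] S swaps_Suc by auto
  have sub2: "{k. ?nb k x \<noteq> nb k x} \<subseteq> {k. nb' k x \<noteq> nb k x} \<union> {a, b}"
    by (auto simp: kswap_def split: if_splits)
  have c2: "card {a, b} \<le> 2" by (auto simp: card_insert_if)
  have 2: "card {k. ?nb k x \<noteq> nb k x} \<le> card {k. nb' k x \<noteq> nb k x} + 2"
    using card_mono[OF _ sub2] fk card_Un_le[of "{k. nb' k x \<noteq> nb k x}" "{a, b}"] c2
    by (meson finite.simps finite_UnI add_left_mono order_trans)
  have sub3: "{x. ?nb k x \<noteq> nb k x} \<subseteq> {x. nb' k x \<noteq> nb k x} \<union> S"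
    by (auto simp: kswap_def split: if_splits)
  have 3: "card {x. ?nb k x \<noteq> nb k x} \<le> card {x. nb' k x \<noteq> nb k x} + 4"
    using card_mono[OF _ sub3] fx card_Un_le[of "{x. nb' k x \<noteq> nb k x}" S] swaps_Suc.hyps
    by (meson finite_UnI add_left_mono order_trans)
  have "finite {(x, k). ?nb k x \<noteq> nb k x}"
    using finite_subset[OF sub] swaps_Suc by auto
  then show ?case using 1 2 3 swaps_Suc.IH[of x k] by auto
qed

section \<open>Structured base colorings\<close>

text \<open>\<open>Q x\<close> is the block of \<open>x\<close>.  Apart from the exceptional incidences \<open>X\<close>, a color of class \<open>j\<close> joins
  block \<open>i\<close> to block \<open>xor i j\<close>, so the colors of class 0 live inside the blocks.  That colors of
  different nonzero classes commute almost everywhere means that they form 4-cycles.\<close>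

locale sbase =
  fixes V :: "'v set" and C :: "'c set" and nb0 :: "'c \<Rightarrow> 'v \<Rightarrow> 'v"
    and Q :: "'v \<Rightarrow> nat" and cl :: "'c \<Rightarrow> nat" and X :: "('v \<times> 'c) set"
  assumes finV: "finite V" and finC: "finite C" and cardC: "card C \<le> card V"
    and cs0: "csys V C nb0"
    and X_sym: "x \<in> V \<Longrightarrow> k \<in> C \<Longrightarrow> (nb0 k x, k) \<in> X \<longleftrightarrow> (x, k) \<in> X"
    and X_vertex: "x \<in> V \<Longrightarrow> card {k\<in>C. (x, k) \<in> X} \<le> 10"
    and X_color: "k \<in> C \<Longrightarrow> card {x\<in>V. (x, k) \<in> X} \<le> 10"
    and shift: "x \<in> V \<Longrightarrow> k \<in> C \<Longrightarrow> (x, k) \<notin> X \<Longrightarrow> Q (nb0 k x) = xor (cl k) (Q x)"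
    and commute: "x \<in> V \<Longrightarrow> k \<in> C \<Longrightarrow> (x, k) \<notin> X \<Longrightarrow> cl k \<noteq> 0 \<Longrightarrow>
      card {d\<in>C. cl d \<noteq> 0 \<and> cl d \<noteq> cl k \<and> nb0 k (nb0 d x) \<noteq> nb0 d (nb0 k x)} \<le> 10"
    and dup: "k \<in> C \<Longrightarrow> card {x\<in>V. \<exists>k'\<in>C. k' \<noteq> k \<and> nb0 k' x = nb0 k x} \<le> 10"
    and quarter_size: "40 \<le> card V \<Longrightarrow> j < 4 \<Longrightarrow> card V \<le> 5 * card {x\<in>V. Q x = j}"
    and class_size: "40 \<le> card V \<Longrightarrow> j \<in> {1,2,3} \<Longrightarrow> card V \<le> 5 * card {k\<in>C. cl k = j}"

text \<open>Used to delete \<open>p\<close> and \<open>q\<close>: in every color their two neighbors get joined to each other.\<close>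

definition join_out :: "'v \<Rightarrow> 'v \<Rightarrow> ('c \<Rightarrow> 'v \<Rightarrow> 'v) \<Rightarrow> 'c \<Rightarrow> 'v \<Rightarrow> 'v" where
  "join_out p q nb k x = (if nb k x = p then nb k q else if nb k x = q then nb k p else nb k x)"

text \<open>From \<open>x\<close> the colors must reach all \<open>card V - 1\<close> other
  vertices; with fewer colors than vertices no color is left over, so no pair is covered
  twice.\<close>

lemma csys_inj_colors:
  assumes cs: "csys V C nb" and fin: "finite V" "finite C" and le: "card C < card V"
    and x: "x \<in> V" and k: "k \<in> C" "k' \<in> C" "nb k x = nb k' x"
  shows "k = k'"
proof -
  have "(\<lambda>k. nb k x) ` C = V - {x}"
  proof
    show "(\<lambda>k. nb k x) ` C \<subseteq> V - {x}" using csysD[OF cs _ x] by auto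
    show "V - {x} \<subseteq> (\<lambda>k. nb k x) ` C"
    proof
      fix y assume "y \<in> V - {x}"
      then obtain k where "k \<in> C" "nb k x = y" using csys_cover[OF cs x, of y] by blast
      then show "y \<in> (\<lambda>k. nb k x) ` C" by blast
    qed
  qed
  then have "card ((\<lambda>k. nb k x) ` C) = card V - 1" using x fin by simp
  moreover have "card ((\<lambda>k. nb k x) ` C) \<le> card C" using fin by (intro card_image_le)
  ultimately have "card ((\<lambda>k. nb k x) ` C) = card C" using le by linarith
  then have "inj_on (\<lambda>k. nb k x) C" using fin eq_card_imp_inj_on by blast
  then show ?thesis using k by (auto dest: inj_onD)
qed

text \<open>Dropping \<open>c0\<close> uncovers the pairs \<open>{x, nb c0 x}\<close>. By
  \<open>H\<close> some other color joined the two members of such a pair to \<open>p\<close> and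
  \<open>q\<close>, one each, and after the deletion that color joins them to each other.\<close>

lemma csys_join_out:
  assumes cs: "csys V C nb" and c0: "c0 \<in> C" and p: "p \<in> V" and q: "q = nb c0 p"
    and uniq: "\<And>x k k'. x \<in> V \<Longrightarrow> k \<in> C \<Longrightarrow> k' \<in> C \<Longrightarrow> nb k x = nb k' x \<Longrightarrow> k = k'"
    and H: "\<And>x. x \<in> V - {p, q} \<Longrightarrow> \<exists>k\<in>C - {c0}. (nb k x = p \<and> nb k (nb c0 x) = q) \<or>
               (nb k x = q \<and> nb k (nb c0 x) = p)"
  shows "csys (V - {p, q}) (C - {c0}) (join_out p q nb)"
proof -
  note D = csysD[OF cs]
  have q': "q \<in> V" "q \<noteq> p" "nb c0 q = p" using D[OF c0 p] q by auto
  \<comment> \<open>Only \<open>c0\<close> joins \<open>p\<close> to \<open>q\<close>, so in every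
    other color the two neighbors to be joined survive the deletion.\<close>
  have ne: "nb k p \<noteq> q" "nb k q \<noteq> p" if "k \<in> C - {c0}" for k
    using uniq[OF p, of k c0] uniq[OF q'(1), of k c0] that c0 q q' by auto
  have pq: "nb k p \<noteq> nb k q" if "k \<in> C" for k
    using D(3)[OF that p] D(3)[OF that q'(1)] q' by metis
  have 1: "join_out p q nb k x \<in> V - {p, q} \<and> join_out p q nb k x \<noteq> x
      \<and> join_out p q nb k (join_out p q nb k x) = x" if k: "k \<in> C - {c0}" and x: "x \<in> V - {p, q}" for k x
  proof -
    have kC: "k \<in> C" and xV: "x \<in> V" using k x by auto
    have a: "nb k x = p \<longleftrightarrow> x = nb k p" "nb k x = q \<longleftrightarrow> x = nb k q"
      using csys_eq_iff[OF cs kC xV] p q' by metis+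
    show ?thesis
      using D[OF kC xV] D[OF kC p] D[OF kC q'(1)] ne[OF k] pq[OF kC] x a q'
      unfolding join_out_def by auto
  qed
  have 2: "\<exists>k\<in>C - {c0}. join_out p q nb k x = y"
    if x: "x \<in> V - {p, q}" and y: "y \<in> V - {p, q}" and xy: "x \<noteq> y" for x y
  proof -
    obtain k where k: "k \<in> C" "nb k x = y" using csys_cover[OF cs, of x y] x y xy by blast
    show ?thesis
    proof (cases "k = c0")
      case False
      then show ?thesis using k y by (intro bexI[of _ k]) (auto simp: join_out_def)
    next
      case True
      obtain j where j: "j \<in> C - {c0}" "(nb j x = p \<and> nb j y = q) \<or> (nb j x = q \<and> nb j y = p)"
        using H[OF x] True k by auto
      then have "join_out p q nb j x = y"
        using D(3)[of j y] y q' unfolding join_out_def by auto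
      then show ?thesis using j by blast
    qed
  qed
  show ?thesis unfolding csys_def using 1 2 by blast
qed

text \<open>Each remaining vertex and each remaining color has at most two edges leading to
  \<open>p\<close> or \<open>q\<close>. These become exceptional, so the bound 4 grows to 6, within
  the 10 allowed by the locale. \<open>K\<close> limits how often an edge created by joining
  coincides with an old edge of color \<open>k'\<close>, which is the only source of doubly covered
  pairs.\<close>

lemma sbase_join_out:
  assumes base: "sbase V C nb Q cl X" and lt: "card C < card V"
    and c0: "c0 \<in> C" and p: "p \<in> V" and q: "q = nb c0 p"
    and X4: "\<And>x. x \<in> V \<Longrightarrow> card {k\<in>C. (x, k) \<in> X} \<le> 4" "\<And>k. k \<in> C \<Longrightarrow> card {x\<in>V. (x, k) \<in> X} \<le> 4"
    and comm: "\<And>x k d. x \<in> V \<Longrightarrow> k \<in> C \<Longrightarrow> d \<in> C \<Longrightarrow> cl k \<noteq> 0 \<Longrightarrow> cl d \<noteq> 0 \<Longrightarrow> cl d \<noteq> cl k \<Longrightarrow>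
       nb k (nb d x) = nb d (nb k x)"
    and H: "\<And>x. x \<in> V - {p, q} \<Longrightarrow> \<exists>k\<in>C - {c0}. (nb k x = p \<and> nb k (nb c0 x) = q) \<or>
               (nb k x = q \<and> nb k (nb c0 x) = p)"
    and K: "\<And>k'. k' \<in> C - {c0} \<Longrightarrow> card {k\<in>C - {c0}. nb k' (nb k p) = nb k q} \<le> 2"
    and qs: "\<And>j. 40 \<le> card V - 2 \<Longrightarrow> j < 4 \<Longrightarrow> card V - 2 \<le> 5 * (card {x\<in>V. Q x = j} - 1)"
    and cls: "\<And>j. 40 \<le> card V - 2 \<Longrightarrow> j \<in> {1,2,3} \<Longrightarrow> card V - 2 \<le> 5 * (card {k\<in>C. cl k = j} - 1)"
    and Qpq: "Q p \<noteq> Q q"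
  shows "sbase (V - {p, q}) (C - {c0}) (join_out p q nb) Q cl
           (X \<union> {(x, k). nb k x \<in> {p, q}})"
proof -
  interpret sbase V C nb Q cl X by (rule base)
  note D = csysD[OF cs0]
  have q': "q \<in> V" "q \<noteq> p" "nb c0 q = p" using D[OF c0 p] q by auto
  have uniq: "k = k'" if "x \<in> V" "k \<in> C" "k' \<in> C" "nb k x = nb k' x" for x k k'
    using csys_inj_colors[OF cs0 finV finC lt that] .
  have cs': "csys (V - {p, q}) (C - {c0}) (join_out p q nb)"
    by (rule csys_join_out[OF cs0 c0 p q uniq H])
  have card': "card (V - {p, q}) = card V - 2" using p q' finV by (simp add: card_Diff_subset)
  have cardc': "card (C - {c0}) = card C - 1" using c0 finC by simp
  have V0: "card V > 0" using p finV by (auto simp: card_gt_0_iff)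
  have r1: "card {k\<in>C - {c0}. nb k x \<in> {p, q}} \<le> 2" if "x \<in> V" for x
  proof -
    have "card {k\<in>C - {c0}. nb k x \<in> {p, q}} \<le> card {p, q}"
    proof (rule card_inj_on_le[of "\<lambda>k. nb k x"])
      show "inj_on (\<lambda>k. nb k x) {k \<in> C - {c0}. nb k x \<in> {p, q}}"
        by (rule inj_onI) (use uniq[OF that] in auto)
    qed auto
    then show ?thesis using q' by simp
  qed
  have r2: "card {x\<in>V. nb k x \<in> {p, q}} \<le> 2" if "k \<in> C" for k
    using card_vimage_nb_le[OF cs0 that finV, of "{p, q}"] p q' by simp
  show ?thesis
  proof
    show "finite (V - {p, q})" "finite (C - {c0})" using finV finC by auto
    show "card (C - {c0}) \<le> card (V - {p, q})" using card' cardc' lt V0 by linarith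
    show "csys (V - {p, q}) (C - {c0}) (join_out p q nb)" by (rule cs')
  next
    fix x k assume x: "x \<in> V - {p, q}" and k: "k \<in> C - {c0}"
    have xV: "x \<in> V" and kC: "k \<in> C" using x k by auto
    have D': "nb k (nb k p) = p" "nb k (nb k q) = q" "nb k (nb k x) = x"
      using D(3)[OF kC p] D(3)[OF kC q'(1)] D(3)[OF kC xV] .
    show "((join_out p q nb k x, k) \<in> X \<union> {(x, k). nb k x \<in> {p, q}})
        \<longleftrightarrow> ((x, k) \<in> X \<union> {(x, k). nb k x \<in> {p, q}})"
      using D' x X_sym[OF xV kC] unfolding join_out_def by auto
  next
    fix x assume x: "x \<in> V - {p, q}"
    have "{k \<in> C - {c0}. (x, k) \<in> X \<union> {(x, k). nb k x \<in> {p, q}}}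
      \<subseteq> {k\<in>C. (x, k) \<in> X} \<union> {k\<in>C - {c0}. nb k x \<in> {p, q}}" by auto
    from card_mono[OF _ this] finC
    have "card {k \<in> C - {c0}. (x, k) \<in> X \<union> {(x, k). nb k x \<in> {p, q}}}
      \<le> card ({k\<in>C. (x, k) \<in> X} \<union> {k\<in>C - {c0}. nb k x \<in> {p, q}})" by simp
    also have "\<dots> \<le> card {k\<in>C. (x, k) \<in> X} + card {k\<in>C - {c0}. nb k x \<in> {p, q}}"
      by (rule card_Un_le)
    finally show "card {k \<in> C - {c0}. (x, k) \<in> X \<union> {(x, k). nb k x \<in> {p, q}}} \<le> 10"
      using X4(1)[of x] r1[of x] x by auto
  next
    fix k assume k: "k \<in> C - {c0}"
    have "{x \<in> V - {p, q}. (x, k) \<in> X \<union> {(x, k). nb k x \<in> {p, q}}}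
      \<subseteq> {x\<in>V. (x, k) \<in> X} \<union> {x\<in>V. nb k x \<in> {p, q}}" by auto
    from card_mono[OF _ this] finV
    have "card {x \<in> V - {p, q}. (x, k) \<in> X \<union> {(x, k). nb k x \<in> {p, q}}}
      \<le> card ({x\<in>V. (x, k) \<in> X} \<union> {x\<in>V. nb k x \<in> {p, q}})" by simp
    also have "\<dots> \<le> card {x\<in>V. (x, k) \<in> X} + card {x\<in>V. nb k x \<in> {p, q}}"
      by (rule card_Un_le)
    finally show "card {x \<in> V - {p, q}. (x, k) \<in> X \<union> {(x, k). nb k x \<in> {p, q}}} \<le> 10"
      using X4(2)[of k] r2[of k] k by auto
  next
    fix x k assume x: "x \<in> V - {p, q}" and k: "k \<in> C - {c0}"
      and n: "(x, k) \<notin> X \<union> {(x, k). nb k x \<in> {p, q}}"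
    show "Q (join_out p q nb k x) = xor (cl k) (Q x)"
      using shift[of x k] x k n unfolding join_out_def by auto
  next
    fix x k assume x: "x \<in> V - {p, q}" and k: "k \<in> C - {c0}"
      and n: "(x, k) \<notin> X \<union> {(x, k). nb k x \<in> {p, q}}" and nz: "cl k \<noteq> 0"
    have xV: "x \<in> V" and kC: "k \<in> C" using x k by auto
    let ?y = "nb k x"
    have y: "?y \<in> V" "?y \<notin> {p, q}" using n D(1)[OF kC xV] by auto
    let ?B = "\<lambda>x. {d\<in>C - {c0}. nb d x \<in> {p, q}}"
    let ?E = "{d\<in>C - {c0}. nb d x \<in> {nb k p, nb k q}}"
    \<comment> \<open>Commutation survives unless one of the four edges of the cycle led to
      \<open>p\<close> or \<open>q\<close>. The edge of color \<open>k\<close> at \<open>x\<close>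
      is excluded by hypothesis; each of the other three spoils at most two colors
      \<open>d\<close>.\<close>
    have sub: "{d \<in> C - {c0}. cl d \<noteq> 0 \<and> cl d \<noteq> cl k \<and>
        join_out p q nb k (join_out p q nb d x) \<noteq> join_out p q nb d (join_out p q nb k x)}
       \<subseteq> ?B x \<union> ?B ?y \<union> ?E"
    proof (intro subsetI)
      fix d assume "d \<in> {d \<in> C - {c0}. cl d \<noteq> 0 \<and> cl d \<noteq> cl k \<and>
        join_out p q nb k (join_out p q nb d x) \<noteq> join_out p q nb d (join_out p q nb k x)}"
      then have d: "d \<in> C - {c0}" "cl d \<noteq> 0" "cl d \<noteq> cl k"
        "join_out p q nb k (join_out p q nb d x) \<noteq> join_out p q nb d (join_out p q nb k x)" by auto
      show "d \<in> ?B x \<union> ?B ?y \<union> ?E"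
      proof (rule ccontr)
        assume neg: "d \<notin> ?B x \<union> ?B ?y \<union> ?E"
        have dV: "nb d x \<in> V" using D(1)[of d x] d xV by auto
        have "nb k (nb d x) \<notin> {p, q}"
          using neg d csys_eq_iff[OF cs0 kC dV] p q'(1) by auto
        then show False using d neg y comm[OF xV kC, of d] nz unfolding join_out_def by auto
      qed
    qed
    have e: "card ?E \<le> 2"
    proof -
      have "card ?E \<le> card {nb k p, nb k q}"
      proof (rule card_inj_on_le[of "\<lambda>k. nb k x"])
        show "inj_on (\<lambda>k. nb k x) ?E"
          by (rule inj_onI) (use uniq[OF xV] in auto)
      qed auto
      also have "\<dots> \<le> 2" by (simp add: card_insert_if)
      finally show ?thesis .
    qed
    have "card {d \<in> C - {c0}. cl d \<noteq> 0 \<and> cl d \<noteq> cl k \<and>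
        join_out p q nb k (join_out p q nb d x) \<noteq> join_out p q nb d (join_out p q nb k x)}
       \<le> card (?B x \<union> ?B ?y \<union> ?E)" using finC by (intro card_mono[OF _ sub]) auto
    also have "\<dots> \<le> card (?B x) + card (?B ?y) + card ?E"
      using card_Un_le[of "?B x \<union> ?B ?y" ?E] card_Un_le[of "?B x" "?B ?y"] by linarith
    finally show "card {d \<in> C - {c0}. cl d \<noteq> 0 \<and> cl d \<noteq> cl k \<and>
        join_out p q nb k (join_out p q nb d x) \<noteq> join_out p q nb d (join_out p q nb k x)} \<le> 10"
      using r1[OF xV] r1[OF y(1)] e by linarith
  next
    fix k' assume k': "k' \<in> C - {c0}"
    let ?K = "{k\<in>C - {c0}. nb k' (nb k p) = nb k q}"
    \<comment> \<open>Before the deletion no pair was covered twice, so at \<open>x\<close> one of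
      the two colors was redirected. If it was not \<open>k'\<close>, then \<open>k'\<close> joins
      the former neighbors \<open>nb k p\<close> and \<open>nb k q\<close>.\<close>
    have sub: "{x \<in> V - {p, q}. \<exists>k\<in>C - {c0}. k \<noteq> k' \<and> join_out p q nb k x = join_out p q nb k' x}
      \<subseteq> {x\<in>V. nb k' x \<in> {p, q}} \<union> ((\<lambda>k. nb k p) ` ?K \<union> (\<lambda>k. nb k q) ` ?K)"
    proof (intro subsetI)
      fix x assume "x \<in> {x \<in> V - {p, q}. \<exists>k\<in>C - {c0}. k \<noteq> k' \<and> join_out p q nb k x = join_out p q nb k' x}"
      then obtain k where x: "x \<in> V" "x \<notin> {p, q}" and k: "k \<in> C - {c0}" "k \<noteq> k'"
        "join_out p q nb k x = join_out p q nb k' x" by auto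
      show "x \<in> {x\<in>V. nb k' x \<in> {p, q}} \<union> ((\<lambda>k. nb k p) ` ?K \<union> (\<lambda>k. nb k q) ` ?K)"
      proof (cases "nb k' x \<in> {p, q}")
        case True then show ?thesis using x by auto
      next
        case False
        have kC: "k \<in> C" and k'C: "k' \<in> C" using k k' by auto
        have e: "join_out p q nb k x = nb k' x" using k False by (auto simp: join_out_def)
        have "nb k x \<in> {p, q}"
        proof (rule ccontr)
          assume "nb k x \<notin> {p, q}"
          then have "nb k x = nb k' x" using e by (auto simp: join_out_def)
          then show False using uniq[OF x(1) kC k'C] k by simp
        qed
        then consider "nb k x = p" | "nb k x = q" by blast
        then show ?thesis
        proof cases
          case 1
          then have "x = nb k p" using D(3)[OF kC x(1)] by auto
          moreover have "nb k' x = nb k q" using 1 e by (auto simp: join_out_def)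
          ultimately show ?thesis using k by blast
        next
          case 2
          then have xq: "x = nb k q" using D(3)[OF kC x(1)] by auto
          moreover have "nb k' x = nb k p" using 2 e q' by (auto simp: join_out_def)
          then have "nb k' (nb k p) = x" using D(3)[OF k'C x(1)] by simp
          ultimately show ?thesis using k by blast
        qed
      qed
    qed
    have fK: "finite ?K" using finC by auto
    have "card {x \<in> V - {p, q}. \<exists>k\<in>C - {c0}. k \<noteq> k' \<and> join_out p q nb k x = join_out p q nb k' x}
      \<le> card ({x\<in>V. nb k' x \<in> {p, q}} \<union> ((\<lambda>k. nb k p) ` ?K \<union> (\<lambda>k. nb k q) ` ?K))"
      using fK finV by (intro card_mono[OF _ sub]) auto
    also have "\<dots> \<le> card {x\<in>V. nb k' x \<in> {p, q}} + (card ((\<lambda>k. nb k p) ` ?K) + card ((\<lambda>k. nb k q) ` ?K))"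
      using card_Un_le[of "{x\<in>V. nb k' x \<in> {p, q}}" "(\<lambda>k. nb k p) ` ?K \<union> (\<lambda>k. nb k q) ` ?K"]
        card_Un_le[of "(\<lambda>k. nb k p) ` ?K" "(\<lambda>k. nb k q) ` ?K"] by linarith
    finally show "card {x \<in> V - {p, q}. \<exists>k\<in>C - {c0}. k \<noteq> k' \<and> join_out p q nb k x = join_out p q nb k' x} \<le> 10"
      using r2[of k'] K[OF k'] k' card_image_le[OF fK, of "\<lambda>k. nb k p"] card_image_le[OF fK, of "\<lambda>k. nb k q"]
      by auto
  next
    fix j :: nat assume j: "40 \<le> card (V - {p, q})" "j < 4"
    \<comment> \<open>As \<open>p\<close> and \<open>q\<close> lie in different blocks, no block
      loses more than one vertex.\<close>
    have "card {x\<in>V. Q x = j} - 1 \<le> card {x \<in> V - {p, q}. Q x = j}"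
    proof (cases "Q p = j")
      case True
      then have "{x \<in> V - {p, q}. Q x = j} = {x\<in>V. Q x = j} - {p}" using Qpq by auto
      then show ?thesis using p True finV by simp
    next
      case False
      then have "{x \<in> V - {p, q}. Q x = j} = {x\<in>V. Q x = j} - {q}" by auto
      then show ?thesis using finV by (simp add: card_Diff_singleton_if)
    qed
    then show "card (V - {p, q}) \<le> 5 * card {x \<in> V - {p, q}. Q x = j}"
      using qs[of j] j card' by linarith
  next
    fix j :: nat assume j: "40 \<le> card (V - {p, q})" "j \<in> {1, 2, 3}"
    have "{k \<in> C - {c0}. cl k = j} = {k\<in>C. cl k = j} - {c0}" by auto
    then have "card {k\<in>C. cl k = j} - 1 \<le> card {k \<in> C - {c0}. cl k = j}"
      using finC by (simp add: card_Diff_singleton_if)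
    then show "card (V - {p, q}) \<le> 5 * card {k \<in> C - {c0}. cl k = j}"
      using cls[of j] j card' by linarith
  qed
qed

section \<open>Round-robin colorings\<close>

lemma mod_eq0_small:
  fixes x t :: int
  assumes "x mod t = 0" "\<bar>x\<bar> < t"
  shows "x = 0"
proof (rule ccontr)
  assume "x \<noteq> 0"
  moreover have "t dvd x" using assms(1) by (rule mod_0_imp_dvd)
  ultimately have "\<bar>t\<bar> \<le> \<bar>x\<bar>" by (rule dvd_imp_le_int)
  then show False using assms(2) by linarith
qed

text \<open>For even \<open>t\<close> a one-factorization of the complete graph on \<open>t\<close>
  points; for odd \<open>t\<close> a near-one-factorization, in which the point missed by a class is
  encoded as its fixed point.\<close>

definition round_robin :: "int \<Rightarrow> int set \<Rightarrow> (int \<Rightarrow> int \<Rightarrow> int) \<Rightarrow> bool" where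
  "round_robin t A \<iota> \<longleftrightarrow> finite A \<and>
     (\<forall>a\<in>A. \<forall>x\<in>{0..<t}. \<iota> a x \<in> {0..<t} \<and> \<iota> a (\<iota> a x) = x) \<and>
     (\<forall>x\<in>{0..<t}. \<forall>y\<in>{0..<t}. x \<noteq> y \<longrightarrow> (\<exists>a\<in>A. \<iota> a x = y)) \<and>
     (\<forall>x\<in>{0..<t}. \<forall>a\<in>A. \<forall>b\<in>A. \<iota> a x = \<iota> b x \<longrightarrow> a = b) \<and>
     (if odd t then card A = nat t \<and> (\<forall>x\<in>{0..<t}. \<exists>a\<in>A. \<iota> a x = x) \<and>
           (\<forall>a\<in>A. \<forall>x\<in>{0..<t}. \<forall>y\<in>{0..<t}. \<iota> a x = x \<longrightarrow> \<iota> a y = y \<longrightarrow> x = y)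
      else card A = nat t - 1 \<and> (\<forall>a\<in>A. \<forall>x\<in>{0..<t}. \<iota> a x \<noteq> x))"

text \<open>Reflections of the cyclic group work: 2 is invertible modulo an odd \<open>t\<close>, so
  each reflection fixes exactly one point.\<close>

lemma round_robin_exists_odd:
  fixes t :: int assumes t: "t > 0" "odd t"
  shows "\<exists>A \<iota>. round_robin t A \<iota>"
proof (intro exI)
  let ?i = "\<lambda>a x. (a - x) mod t"
  have d2: "x = y" if "x \<in> {0..<t}" "y \<in> {0..<t}" "t dvd 2 * (x - y)" for x y :: int
  proof -
    have "coprime t 2" using t by (simp add: coprime_right_2_iff_odd)
    then have "t dvd x - y" using that(3) coprime_dvd_mult_right_iff by blast
    then have "(x - y) mod t = 0" by (rule dvd_imp_mod_0)
    then show ?thesis using mod_eq0_small[of "x - y" t] that by auto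
  qed
  have invol: "?i a (?i a x) = x" if "x \<in> {0..<t}" for a x :: int
    using that by (simp add: mod_diff_right_eq)
  have hit: "?i ((x + y) mod t) x = y" if "y \<in> {0..<t}" for x y :: int
    using that by (simp add: mod_diff_left_eq)
  have inj: "a = b" if "a \<in> {0..<t}" "b \<in> {0..<t}" "?i a x = ?i b x" for a b x :: int
  proof -
    have "t dvd (a - x) - (b - x)" using that(3) by (simp add: mod_eq_dvd_iff)
    then have "(a - b) mod t = 0" by simp
    then show ?thesis using mod_eq0_small[of "a - b" t] that by auto
  qed
  have fix1: "x = y" if "x \<in> {0..<t}" "y \<in> {0..<t}" "?i a x = x" "?i a y = y" for a x y :: int
  proof (rule d2[OF that(1,2)])
    have "t dvd (a - x) - x" "t dvd (a - y) - y"
      using that by (metis mod_eq_dvd_iff mod_mod_trivial)+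
    then have "t dvd ((a - y) - y) - ((a - x) - x)" by (rule dvd_diff[rotated])
    then show "t dvd 2 * (x - y)" by (simp add: algebra_simps)
  qed
  show "round_robin t {0..<t} ?i"
    unfolding round_robin_def
  proof (intro conjI ballI impI)
    show "\<exists>a\<in>{0..<t}. ?i a x = y" if "x \<in> {0..<t}" "y \<in> {0..<t}" for x y :: int
      using hit[OF that(2), of x] t by (intro bexI[of _ "(x + y) mod t"]) auto
    show "if odd t then card {0..<t} = nat t \<and> (\<forall>x\<in>{0..<t}. \<exists>a\<in>{0..<t}. ?i a x = x) \<and>
           (\<forall>a\<in>{0..<t}. \<forall>x\<in>{0..<t}. \<forall>y\<in>{0..<t}. ?i a x = x \<longrightarrow> ?i a y = y \<longrightarrow> x = y)
      else card {0..<t} = nat t - 1 \<and> (\<forall>a\<in>{0..<t}. \<forall>x\<in>{0..<t}. ?i a x \<noteq> x)"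
    proof -
      have 1: "\<forall>x\<in>{0..<t}. \<exists>a\<in>{0..<t}. ?i a x = x"
      proof
        fix x assume "x \<in> {0..<t}"
        from hit[OF this, of x] show "\<exists>a\<in>{0..<t}. ?i a x = x"
          using t by (intro bexI[of _ "(x + x) mod t"]) auto
      qed
      have 2: "\<forall>a\<in>{0..<t}. \<forall>x\<in>{0..<t}. \<forall>y\<in>{0..<t}. ?i a x = x \<longrightarrow> ?i a y = y \<longrightarrow> x = y"
        by (intro ballI impI) (rule fix1)
      have 3: "card {0..<t} = nat t" by simp
      show ?thesis unfolding if_P[OF t(2)] using 1 2 3 by (intro conjI)
    qed
  next
    fix x a b assume "x \<in> {0..<t}" "a \<in> {0..<t}" "b \<in> {0..<t}" "?i a x = ?i b x"
    from this(2-) show "a = b" by (rule inj)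
  next
    fix a x assume x: "x \<in> {0..<t}"
    show "?i a x \<in> {0..<t}" using t by simp
    show "?i a (?i a x) = x" by (rule invol[OF x])
  qed simp
qed

text \<open>The circle method: reflections modulo the odd number \<open>s = t - 1\<close>, with the
  extra point \<open>s\<close> matched to the fixed point of the reflection. Since
  \<open>2 * h = s + 1\<close>, multiplication by \<open>h\<close> halves modulo \<open>s\<close>,
  and \<open>f a\<close> is that fixed point.\<close>

lemma round_robin_exists_even:
  fixes t :: int assumes t: "t > 0" "even t"
  shows "\<exists>A \<iota>. round_robin t A \<iota>"
proof (intro exI)
  define s where "s = t - 1"
  define h where "h = t div 2"
  have s: "s > 0" "odd s" "2 * h = s + 1" using t by (auto simp: s_def h_def)
  define j where "j = (\<lambda>a x. (a - x) mod s)"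
  define f where "f = (\<lambda>a. (a * h) mod s)"
  define i where "i = (\<lambda>a x. if x < s then (if j a x = x then s else j a x) else f a)"
  have d2: "x = y" if "x \<in> {0..<s}" "y \<in> {0..<s}" "s dvd 2 * (x - y)" for x y :: int
  proof -
    have "coprime s 2" using s by (simp add: coprime_right_2_iff_odd)
    then have "s dvd x - y" using that(3) coprime_dvd_mult_right_iff by blast
    then have "(x - y) mod s = 0" by (rule dvd_imp_mod_0)
    then show ?thesis using mod_eq0_small[of "x - y" s] that by auto
  qed
  have jr: "j a x \<in> {0..<s}" "f a \<in> {0..<s}" for a x using s by (auto simp: j_def f_def)
  have invol: "j a (j a x) = x" if "x \<in> {0..<s}" for a x :: int
    using that by (simp add: j_def mod_diff_right_eq)
  have hit: "j ((x + y) mod s) x = y" if "y \<in> {0..<s}" for x y :: int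
    using that by (simp add: j_def mod_diff_left_eq)
  have inj: "a = b" if "a \<in> {0..<s}" "b \<in> {0..<s}" "j a x = j b x" for a b x :: int
  proof -
    have "s dvd (a - x) - (b - x)" using that(3) by (simp add: j_def mod_eq_dvd_iff)
    then have "(a - b) mod s = 0" by simp
    then show ?thesis using mod_eq0_small[of "a - b" s] that by auto
  qed
  have fix1: "x = y" if "x \<in> {0..<s}" "y \<in> {0..<s}" "j a x = x" "j a y = y" for a x y :: int
  proof (rule d2[OF that(1,2)])
    have "s dvd (a - x) - x" "s dvd (a - y) - y"
      using that unfolding j_def by (metis mod_eq_dvd_iff mod_mod_trivial)+
    then have "s dvd ((a - y) - y) - ((a - x) - x)" by (rule dvd_diff[rotated])
    then show "s dvd 2 * (x - y)" by (simp add: algebra_simps)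
  qed
  have jf: "j a (f a) = f a" for a
  proof -
    have "j a (f a) = (a - a * h) mod s" by (simp add: j_def f_def mod_diff_right_eq)
    also have "a - a * h = a * h + (- a) * s"
    proof -
      have "a * (2 * h) = a * (s + 1)" by (simp only: s(3))
      then show ?thesis by (simp add: algebra_simps)
    qed
    also have "(a * h + (- a) * s) mod s = f a" unfolding f_def by (rule mod_mult_self1)
    finally show ?thesis .
  qed
  have fj: "f a = x" if "x \<in> {0..<s}" "j a x = x" for a x
    using fix1[OF that(1) jr(2)[of a] that(2) jf] by simp
  have iV: "i a x \<in> {0..<t}" if "x \<in> {0..<t}" for a x
    using that jr(1)[of a x] jr(2)[of a] by (auto simp: i_def s_def)
  have tv: "x \<in> {0..<s} \<or> x = s" if "x \<in> {0..<t}" for x using that by (auto simp: s_def)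
  have ii: "i a (i a x) = x" if x: "x \<in> {0..<t}" for a x
  proof (cases "x = s")
    case True
    then show ?thesis using jr(2)[of a] jf[of a] by (auto simp: i_def)
  next
    case False
    then have xs: "x \<in> {0..<s}" using tv[OF x] by auto
    show ?thesis
      using xs jr(1)[of a x] invol[OF xs, of a] fj[OF xs, of a] by (auto simp: i_def)
  qed
  have inofix: "i a x \<noteq> x" if x: "x \<in> {0..<t}" for a x
    using tv[OF x] jr(2)[of a] by (auto simp: i_def)
  have icov: "\<exists>a\<in>{0..<s}. i a x = y" if x: "x \<in> {0..<t}" and y: "y \<in> {0..<t}" and xy: "x \<noteq> y" for x y
  proof -
    consider "x \<in> {0..<s}" "y \<in> {0..<s}" | "x = s" "y \<in> {0..<s}" | "x \<in> {0..<s}" "y = s"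
      using tv[OF x] tv[OF y] xy by auto
    then show ?thesis
    proof cases
      case 1
      then show ?thesis using hit[of y x] xy s by (intro bexI[of _ "(x + y) mod s"]) (auto simp: i_def)
    next
      case 2
      then show ?thesis using hit[of y y] fj[of y "(y + y) mod s"] s
        by (intro bexI[of _ "(y + y) mod s"]) (auto simp: i_def)
    next
      case 3
      then show ?thesis using hit[of x x] s
        by (intro bexI[of _ "(x + x) mod s"]) (auto simp: i_def)
    qed
  qed
  have finj: "a = b" if ab: "a \<in> {0..<s}" "b \<in> {0..<s}" "f a = f b" for a b
  proof -
    have "j a (f a) = j b (f a)" using jf[of a] jf[of b] ab(3) by simp
    then show ?thesis by (rule inj[OF ab(1,2)])
  qed
  have iinj: "a = b" if x: "x \<in> {0..<t}" and ab: "a \<in> {0..<s}" "b \<in> {0..<s}" "i a x = i b x" for a b x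
  proof (cases "x < s")
    case False
    then show ?thesis using finj[OF ab(1,2)] ab(3) by (simp add: i_def)
  next
    case True
    have "j a x = j b x"
      using ab(3) True jr(1)[of a x] jr(1)[of b x] by (auto simp: i_def split: if_splits)
    then show ?thesis by (rule inj[OF ab(1,2)])
  qed
  show "round_robin t {0..<s} i"
    unfolding round_robin_def
  proof (intro conjI ballI impI)
    show "if odd t then card {0..<s} = nat t \<and> (\<forall>x\<in>{0..<t}. \<exists>a\<in>{0..<s}. i a x = x) \<and>
           (\<forall>a\<in>{0..<s}. \<forall>x\<in>{0..<t}. \<forall>y\<in>{0..<t}. i a x = x \<longrightarrow> i a y = y \<longrightarrow> x = y)
      else card {0..<s} = nat t - 1 \<and> (\<forall>a\<in>{0..<s}. \<forall>x\<in>{0..<t}. i a x \<noteq> x)"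
    proof -
      have 1: "card {0..<s} = nat t - 1" using t by (simp add: s_def nat_diff_distrib)
      have 2: "\<forall>a\<in>{0..<s}. \<forall>x\<in>{0..<t}. i a x \<noteq> x" using inofix by blast
      have 3: "\<not> odd t" using t by simp
      show ?thesis unfolding if_not_P[OF 3] using 1 2 by (intro conjI)
    qed
  next
    fix x a b assume "x \<in> {0..<t}" "a \<in> {0..<s}" "b \<in> {0..<s}" "i a x = i b x"
    then show "a = b" by (rule iinj)
  qed (use iV ii icov in blast)+
qed

lemma round_robin_exists: "t > 0 \<Longrightarrow> \<exists>A \<iota>. round_robin t A \<iota>"
  using round_robin_exists_odd round_robin_exists_even by blast

section \<open>Four blocks of equal size\<close>

definition blk_V :: "int \<Rightarrow> (nat \<times> int) set" where
  "blk_V t = {0..<4} \<times> {0..<t}"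

text \<open>For odd \<open>t\<close> the color \<open>(1, 0)\<close> is dropped; its edges are colored by the inner colors
  \<open>(0, a)\<close> at the fixed points of \<open>\<iota> a\<close>.\<close>

definition blk_C :: "int \<Rightarrow> int set \<Rightarrow> (nat \<times> int) set" where
  "blk_C t A = {0} \<times> A \<union> {1} \<times> {(if odd t then 1 else 0)..<t} \<union> {2, 3} \<times> {0..<t}"

text \<open>A block index is read as two bits. Class 1 flips bit 0 and class 2 flips bit 1; each
  translates with a sign given by the bit it flips, which makes it an involution and indifferent to
  the other bit. Class 3 flips both bits and reflects; the reflection reverses translations just as
  the flipped bit reverses their sign. So colors of different nonzero classes commute.\<close>

definition blk_nb :: "int \<Rightarrow> (int \<Rightarrow> int \<Rightarrow> int) \<Rightarrow> nat \<times> int \<Rightarrow> nat \<times> int \<Rightarrow> nat \<times> int" where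
  "blk_nb t \<iota> = (\<lambda>(k, a) (i, x).
     if k = 0 then (if \<iota> a x = x then (xor i 1, x) else (i, \<iota> a x))
     else if k = 1 then (xor i 1, (if even i then x - a else x + a) mod t)
     else if k = 2 then (xor i 2, (if i < 2 then x - a else x + a) mod t)
     else (xor i 3, (a - x) mod t))"

lemma less4_cases: "i < 4 \<Longrightarrow> i = 0 \<or> i = 1 \<or> i = 2 \<or> i = (3::nat)" by linarith

context
  fixes t :: int and A :: "int set" and \<iota> :: "int \<Rightarrow> int \<Rightarrow> int"
  assumes t: "t > 0" and rr: "round_robin t A \<iota>"
begin

lemma
  shows rr_fin: "finite A"
    and rr_range: "a \<in> A \<Longrightarrow> 0 \<le> x \<Longrightarrow> x < t \<Longrightarrow> 0 \<le> \<iota> a x \<and> \<iota> a x < t \<and> \<iota> a (\<iota> a x) = x"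
    and rr_cover: "0 \<le> x \<Longrightarrow> x < t \<Longrightarrow> 0 \<le> y \<Longrightarrow> y < t \<Longrightarrow> x \<noteq> y \<Longrightarrow> \<exists>a\<in>A. \<iota> a x = y"
    and rr_inj: "0 \<le> x \<Longrightarrow> x < t \<Longrightarrow> a \<in> A \<Longrightarrow> b \<in> A \<Longrightarrow> \<iota> a x = \<iota> b x \<Longrightarrow> a = b"
    and rr_fix: "odd t \<Longrightarrow> 0 \<le> x \<Longrightarrow> x < t \<Longrightarrow> \<exists>a\<in>A. \<iota> a x = x"
    and rr_fix1: "odd t \<Longrightarrow> a \<in> A \<Longrightarrow> 0 \<le> x \<Longrightarrow> x < t \<Longrightarrow> 0 \<le> y \<Longrightarrow> y < t \<Longrightarrow> \<iota> a x = x \<Longrightarrow> \<iota> a y = y \<Longrightarrow> x = y"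
    and rr_nofix: "even t \<Longrightarrow> a \<in> A \<Longrightarrow> 0 \<le> x \<Longrightarrow> x < t \<Longrightarrow> \<iota> a x \<noteq> x"
    and rr_card: "card A = (if odd t then nat t else nat t - 1)"
proof -
  note rr' = rr[unfolded round_robin_def]
  show "finite A" using rr' by (elim conjE)
  show "a \<in> A \<Longrightarrow> 0 \<le> x \<Longrightarrow> x < t \<Longrightarrow> 0 \<le> \<iota> a x \<and> \<iota> a x < t \<and> \<iota> a (\<iota> a x) = x"
    using rr'[THEN conjunct2, THEN conjunct1] by simp
  show "0 \<le> x \<Longrightarrow> x < t \<Longrightarrow> 0 \<le> y \<Longrightarrow> y < t \<Longrightarrow> x \<noteq> y \<Longrightarrow> \<exists>a\<in>A. \<iota> a x = y"
    using rr'[THEN conjunct2, THEN conjunct2, THEN conjunct1] by simp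
  show "0 \<le> x \<Longrightarrow> x < t \<Longrightarrow> a \<in> A \<Longrightarrow> b \<in> A \<Longrightarrow> \<iota> a x = \<iota> b x \<Longrightarrow> a = b"
    using rr'[THEN conjunct2, THEN conjunct2, THEN conjunct2, THEN conjunct1] by simp
  note r5 = rr'[THEN conjunct2, THEN conjunct2, THEN conjunct2, THEN conjunct2]
  show "odd t \<Longrightarrow> 0 \<le> x \<Longrightarrow> x < t \<Longrightarrow> \<exists>a\<in>A. \<iota> a x = x" using r5 by simp
  show "odd t \<Longrightarrow> a \<in> A \<Longrightarrow> 0 \<le> x \<Longrightarrow> x < t \<Longrightarrow> 0 \<le> y \<Longrightarrow> y < t \<Longrightarrow> \<iota> a x = x \<Longrightarrow> \<iota> a y = y \<Longrightarrow> x = y"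
    using r5 by simp
  show "even t \<Longrightarrow> a \<in> A \<Longrightarrow> 0 \<le> x \<Longrightarrow> x < t \<Longrightarrow> \<iota> a x \<noteq> x" using r5 by simp
  show "card A = (if odd t then nat t else nat t - 1)" using r5 by simp
qed

lemma blk_colorE:
  assumes "k \<in> blk_C t A"
  obtains a where "k = (0, a)" "a \<in> A"
  | a where "k = (1, a)" "0 \<le> a" "a < t" "odd t \<Longrightarrow> a \<noteq> 0"
  | a where "k = (2, a)" "0 \<le> a" "a < t"
  | a where "k = (3, a)" "0 \<le> a" "a < t"
  using assms unfolding blk_C_def by (auto split: if_splits)

lemma blk_vertexE:
  assumes "v \<in> blk_V t"
  obtains i x where "v = (i, x)" "i = 0 \<or> i = 1 \<or> i = 2 \<or> i = 3" "0 \<le> x" "x < t"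
  using assms less4_cases unfolding blk_V_def by (metis SigmaE atLeastLessThan_iff)

lemma blk_invol:
  assumes "k \<in> blk_C t A" "v \<in> blk_V t"
  shows "blk_nb t \<iota> k v \<in> blk_V t \<and> blk_nb t \<iota> k v \<noteq> v \<and> blk_nb t \<iota> k (blk_nb t \<iota> k v) = v"
proof -
  obtain i x where v: "v = (i, x)" "i = 0 \<or> i = 1 \<or> i = 2 \<or> i = 3" "0 \<le> x" "x < t"
    using assms(2) by (rule blk_vertexE)
  from assms(1) show ?thesis
  proof (cases rule: blk_colorE)
    case (1 a)
    then show ?thesis using v rr_range[of a x] by (auto simp: blk_nb_def blk_V_def)
  next
    case (2 a)
    then show ?thesis using v t by (auto simp: blk_nb_def blk_V_def mod_simps)
  next
    case (3 a)
    then show ?thesis using v t by (auto simp: blk_nb_def blk_V_def mod_simps)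
  next
    case (4 a)
    then show ?thesis using v t by (auto simp: blk_nb_def blk_V_def mod_simps)
  qed
qed

lemma blk_cover:
  assumes "v \<in> blk_V t" "w \<in> blk_V t" "v \<noteq> w"
  shows "\<exists>k\<in>blk_C t A. blk_nb t \<iota> k v = w"
proof -
  obtain i x where v: "v = (i, x)" "i = 0 \<or> i = 1 \<or> i = 2 \<or> i = 3" "0 \<le> x" "x < t"
    using assms(1) by (rule blk_vertexE)
  obtain j y where w: "w = (j, y)" "j = 0 \<or> j = 1 \<or> j = 2 \<or> j = 3" "0 \<le> y" "y < t"
    using assms(2) by (rule blk_vertexE)
  consider "i = j" | "xor i j = 1" | "xor i j = 2" | "xor i j = 3"
    using v(2) w(2) by auto
  then show ?thesis
  proof cases
    case 1
    then obtain a where "a \<in> A" "\<iota> a x = y" using rr_cover[of x y] v w assms(3) by auto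
    then show ?thesis using 1 v w assms(3)
      by (intro bexI[of _ "(0, a)"]) (auto simp: blk_nb_def blk_C_def)
  next
    case 2
    show ?thesis
    proof (cases "odd t \<and> x = y")
      case True
      then obtain a where "a \<in> A" "\<iota> a x = x" using rr_fix[of x] v by auto
      then show ?thesis using 2 v(1,2) w(1,2) True
        by (intro bexI[of _ "(0, a)"]) (auto simp: blk_nb_def blk_C_def)
    next
      case False
      define a where "a = (if even i then x - y else y - x) mod t"
      have a0: "0 \<le> a" "a < t" using t by (auto simp: a_def)
      \<comment> \<open>The difference of two distinct residues is nonzero modulo \<open>t\<close>,
        so the color found is not the dropped \<open>(1, 0)\<close>.\<close>
      have "a \<noteq> 0" if "odd t"
      proof -
        let ?e = "if even i then x - y else y - x"
        have e: "\<bar>?e\<bar> < t" "?e \<noteq> 0" using that False v w by auto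
        show ?thesis
        proof
          assume "a = 0"
          then have "?e mod t = 0" by (simp only: a_def)
          from mod_eq0_small[OF this e(1)] e(2) show False by contradiction
        qed
      qed
      then have "(1, a) \<in> blk_C t A" using a0 by (auto simp: blk_C_def)
      moreover have "blk_nb t \<iota> (1, a) v = w"
        using 2 v w t by (auto simp: blk_nb_def a_def mod_simps)
      ultimately show ?thesis by blast
    qed
  next
    case 3
    define a where "a = (if i < 2 then x - y else y - x) mod t"
    have "(2, a) \<in> blk_C t A" using t by (auto simp: blk_C_def a_def)
    moreover have "blk_nb t \<iota> (2, a) v = w"
      using 3 v w t by (auto simp: blk_nb_def a_def mod_simps)
    ultimately show ?thesis by blast
  next
    case 4
    have "(3, (x + y) mod t) \<in> blk_C t A" using t by (auto simp: blk_C_def)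
    moreover have "blk_nb t \<iota> (3, (x + y) mod t) v = w"
      using 4 v w t by (auto simp: blk_nb_def mod_simps)
    ultimately show ?thesis by blast
  qed
qed

lemma blk_csys: "csys (blk_V t) (blk_C t A) (blk_nb t \<iota>)"
  unfolding csys_def using blk_invol blk_cover by blast

lemma blk_commute:
  assumes "v \<in> blk_V t" "fst k \<noteq> 0" "fst d \<noteq> 0" "fst d \<noteq> fst k"
    "k \<in> blk_C t A" "d \<in> blk_C t A"
  shows "blk_nb t \<iota> k (blk_nb t \<iota> d v) = blk_nb t \<iota> d (blk_nb t \<iota> k v)"
proof -
  obtain i x where v: "v = (i, x)" "i = 0 \<or> i = 1 \<or> i = 2 \<or> i = 3" "0 \<le> x" "x < t"
    using assms(1) by (rule blk_vertexE)
  obtain kk a where k: "k = (kk, a)" "kk = 1 \<or> kk = 2 \<or> kk = 3"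
    using assms(2,5) by (cases k) (auto simp: blk_C_def)
  obtain dd b where d: "d = (dd, b)" "dd = 1 \<or> dd = 2 \<or> dd = 3"
    using assms(3,6) by (cases d) (auto simp: blk_C_def)
  show ?thesis using v(2) k(2) d(2) assms(4) unfolding v(1) k(1) d(1)
    by (elim disjE; simp add: blk_nb_def mod_simps; simp add: algebra_simps)
qed

lemma blk_finV: "finite (blk_V t)" by (simp add: blk_V_def)
lemma blk_finC: "finite (blk_C t A)" using rr_fin by (simp add: blk_C_def)
lemma blk_cardV: "card (blk_V t) = 4 * nat t" by (simp add: blk_V_def card_cartesian_product)

lemma blk_class:
  shows "{k \<in> blk_C t A. fst k = 0} = {0} \<times> A"
    "{k \<in> blk_C t A. fst k = 1} = {1} \<times> {(if odd t then 1 else 0)..<t}"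
    "{k \<in> blk_C t A. fst k = 2} = {2} \<times> {0..<t}"
    "{k \<in> blk_C t A. fst k = 3} = {3} \<times> {0..<t}"
  by (auto simp: blk_C_def)

lemma blk_cardC: "card (blk_C t A) = 4 * nat t - 1"
proof -
  let ?o = "(if odd t then 1 else 0) :: int"
  have d1: "({0::nat} \<times> A \<union> {1} \<times> {?o..<t}) \<inter> ({2, 3} \<times> {0..<t}) = {}"
    and d2: "({0::nat} \<times> A) \<inter> ({1} \<times> {?o..<t}) = {}" by auto
  have "card (blk_C t A) = card ({0::nat} \<times> A \<union> {1} \<times> {?o..<t}) + card ({2, 3::nat} \<times> {0..<t})"
    unfolding blk_C_def using d1 rr_fin by (intro card_Un_disjoint) auto
  also have "card ({0::nat} \<times> A \<union> {1} \<times> {?o..<t}) = card ({0::nat} \<times> A) + card ({1::nat} \<times> {?o..<t})"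
    using d2 rr_fin by (intro card_Un_disjoint) auto
  finally have "card (blk_C t A) = nat t + nat t + (nat t + nat t) - 1"
    using rr_card t by (cases "odd t") (auto simp: card_cartesian_product nat_diff_distrib)
  then show ?thesis by linarith
qed

abbreviation "blk_X \<equiv> {(v :: nat \<times> int, k :: nat \<times> int). fst k = 0 \<and> \<iota> (snd k) (snd v) = snd v}"

lemma blk_X_vertex:
  assumes "v \<in> blk_V t"
  shows "card {k \<in> blk_C t A. (v, k) \<in> blk_X} \<le> 4"
proof -
  obtain i x where v: "v = (i, x)" "i = 0 \<or> i = 1 \<or> i = 2 \<or> i = 3" "0 \<le> x" "x < t"
    using assms(1) by (rule blk_vertexE)
  have "k = k'" if "k \<in> blk_C t A" "k' \<in> blk_C t A" "(v, k) \<in> blk_X" "(v, k') \<in> blk_X" for k k'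
    using that rr_inj[of x "snd k" "snd k'"] v by (auto simp: blk_C_def prod_eq_iff)
  then have "card {k \<in> blk_C t A. (v, k) \<in> blk_X} \<le> 1"
    using blk_finC by (subst card_le_Suc0_iff_eq[unfolded One_nat_def[symmetric]]) auto
  then show ?thesis by simp
qed

text \<open>Within one block an inner color has at most one fixed point if \<open>t\<close> is odd
  and none if it is even; 4 is the number of blocks.\<close>

lemma blk_X_color:
  assumes "k \<in> blk_C t A"
  shows "card {v \<in> blk_V t. (v, k) \<in> blk_X} \<le> 4"
proof -
  have "card {v \<in> blk_V t. (v, k) \<in> blk_X} \<le> card {0..<4::nat}"
  proof (rule card_inj_on_le[of fst])
    show "inj_on fst {v \<in> blk_V t. (v, k) \<in> blk_X}"
    proof (rule inj_onI)
      fix v w assume v: "v \<in> {v \<in> blk_V t. (v, k) \<in> blk_X}" and w: "w \<in> {v \<in> blk_V t. (v, k) \<in> blk_X}"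
        and e: "fst v = fst w"
      have a: "snd k \<in> A" using v assms by (auto simp: blk_C_def)
      have "0 \<le> snd v" "snd v < t" "0 \<le> snd w" "snd w < t"
        using v w by (auto simp: blk_V_def)
      moreover have "\<iota> (snd k) (snd v) = snd v" "\<iota> (snd k) (snd w) = snd w" using v w by auto
      ultimately have "snd v = snd w" using rr_fix1[of "snd k" "snd v" "snd w"] rr_nofix[of "snd k" "snd v"] a
        by blast
      then show "v = w" using e by (simp add: prod_eq_iff)
    qed
  qed (auto simp: blk_V_def)
  then show ?thesis by simp
qed

lemma blk_quarter: "j < 4 \<Longrightarrow> card {v \<in> blk_V t. fst v = j} = nat t"
proof -
  assume "j < 4"
  then have "{v \<in> blk_V t. fst v = j} = {j} \<times> {0..<t}" by (auto simp: blk_V_def)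
  then show ?thesis by (simp add: card_cartesian_product)
qed

lemma blk_class_card: "j \<in> {1, 2, 3} \<Longrightarrow> nat t - 1 \<le> card {k \<in> blk_C t A. fst k = j}"
  using blk_class by (auto simp: card_cartesian_product)

lemma blk_sbase: "sbase (blk_V t) (blk_C t A) (blk_nb t \<iota>) fst fst blk_X"
proof
  show "finite (blk_V t)" "finite (blk_C t A)" by (rule blk_finV blk_finC)+
  show "card (blk_C t A) \<le> card (blk_V t)" by (simp add: blk_cardV blk_cardC)
  show "csys (blk_V t) (blk_C t A) (blk_nb t \<iota>)" by (rule blk_csys)
  show "((blk_nb t \<iota> k v, k) \<in> blk_X) = ((v, k) \<in> blk_X)" if vk: "v \<in> blk_V t" "k \<in> blk_C t A" for v k
  proof -
    obtain i x where v: "v = (i, x)" "i = 0 \<or> i = 1 \<or> i = 2 \<or> i = 3" "0 \<le> x" "x < t"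
      using vk(1) by (rule blk_vertexE)
    show ?thesis using vk(2) rr_range[of "snd k" x] v
      by (cases rule: blk_colorE) (auto simp: blk_nb_def)
  qed
  show "card {k \<in> blk_C t A. (v, k) \<in> blk_X} \<le> 10" if "v \<in> blk_V t" for v
    using blk_X_vertex[OF that] by linarith
  show "card {v \<in> blk_V t. (v, k) \<in> blk_X} \<le> 10" if "k \<in> blk_C t A" for k
    using blk_X_color[OF that] by linarith
  show "fst (blk_nb t \<iota> k v) = xor (fst k) (fst v)"
    if vk: "v \<in> blk_V t" "k \<in> blk_C t A" "(v, k) \<notin> blk_X" for v k
  proof -
    obtain i x where v: "v = (i, x)" "i = 0 \<or> i = 1 \<or> i = 2 \<or> i = 3" "0 \<le> x" "x < t"
      using vk(1) by (rule blk_vertexE)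
    show ?thesis using vk(2,3) v
      by (cases rule: blk_colorE) (auto simp: blk_nb_def)
  qed
  show "card {d \<in> blk_C t A. fst d \<noteq> 0 \<and> fst d \<noteq> fst k \<and>
      blk_nb t \<iota> k (blk_nb t \<iota> d v) \<noteq> blk_nb t \<iota> d (blk_nb t \<iota> k v)} \<le> 10"
    if "v \<in> blk_V t" "k \<in> blk_C t A" "(v, k) \<notin> blk_X" "fst k \<noteq> 0" for v k
  proof -
    have "{d \<in> blk_C t A. fst d \<noteq> 0 \<and> fst d \<noteq> fst k \<and>
      blk_nb t \<iota> k (blk_nb t \<iota> d v) \<noteq> blk_nb t \<iota> d (blk_nb t \<iota> k v)} = {}"
      using blk_commute[OF that(1,4)] that(2) by blast
    then show ?thesis by (metis card.empty zero_le)
  qed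
  show "card {v \<in> blk_V t. \<exists>k'\<in>blk_C t A. k' \<noteq> k \<and> blk_nb t \<iota> k' v = blk_nb t \<iota> k v} \<le> 10"
    if "k \<in> blk_C t A" for k
  proof -
    have "card (blk_C t A) < card (blk_V t)" using t by (simp add: blk_cardV blk_cardC)
    from csys_inj_colors[OF blk_csys blk_finV blk_finC this]
    have "{v \<in> blk_V t. \<exists>k'\<in>blk_C t A. k' \<noteq> k \<and> blk_nb t \<iota> k' v = blk_nb t \<iota> k v} = {}"
      using that by blast
    then show ?thesis by (metis card.empty zero_le)
  qed
  show "card (blk_V t) \<le> 5 * card {v \<in> blk_V t. fst v = j}" if "40 \<le> card (blk_V t)" "j < 4" for j
    using blk_quarter[OF that(2)] by (simp add: blk_cardV)
  show "card (blk_V t) \<le> 5 * card {k \<in> blk_C t A. fst k = j}" if "40 \<le> card (blk_V t)" "j \<in> {1,2,3}" for j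
    using blk_class_card[OF that(2)] that(1) by (simp add: blk_cardV)
qed

text \<open>The color \<open>(2, 0)\<close> maps \<open>(i, x)\<close> to
  \<open>(xor i 2, x)\<close>. Inner colors act alike on the blocks \<open>i\<close> and
  \<open>xor i 2\<close>, and so do colors of class 1; hence a color of these kinds that joins
  \<open>v\<close> to one deleted vertex joins the \<open>(2, 0)\<close>-neighbor of
  \<open>v\<close> to the other, as \<open>csys_join_out\<close> requires.\<close>

lemma blk_sbase2:
  "sbase (blk_V t - {(0, 0), (2, 0)}) (blk_C t A - {(2, 0)})
     (join_out (0, 0) (2, 0) (blk_nb t \<iota>)) fst fst
     (blk_X \<union> {(v, k). blk_nb t \<iota> k v \<in> {(0, 0), (2, 0)}})"
proof (rule sbase_join_out[OF blk_sbase])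
  let ?nb = "blk_nb t \<iota>"
  show lt: "card (blk_C t A) < card (blk_V t)" using t by (simp add: blk_cardV blk_cardC)
  note uniq = csys_inj_colors[OF blk_csys blk_finV blk_finC lt]
  show c0: "(2, 0) \<in> blk_C t A" using t by (simp add: blk_C_def)
  show p: "(0, 0) \<in> blk_V t" using t by (simp add: blk_V_def)
  show "(2, 0) = ?nb (2, 0) (0, 0)" by (simp add: blk_nb_def)
  show "card {k \<in> blk_C t A. (v, k) \<in> blk_X} \<le> 4" if "v \<in> blk_V t" for v
    by (rule blk_X_vertex[OF that])
  show "card {v \<in> blk_V t. (v, k) \<in> blk_X} \<le> 4" if "k \<in> blk_C t A" for k
    by (rule blk_X_color[OF that])
  show "?nb k (?nb d v) = ?nb d (?nb k v)"
    if "v \<in> blk_V t" "k \<in> blk_C t A" "d \<in> blk_C t A" "fst k \<noteq> 0" "fst d \<noteq> 0" "fst d \<noteq> fst k" for v k d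
    using blk_commute that by blast
  show "\<exists>k\<in>blk_C t A - {(2, 0)}. ?nb k v = (0, 0) \<and> ?nb k (?nb (2, 0) v) = (2, 0) \<or>
        ?nb k v = (2, 0) \<and> ?nb k (?nb (2, 0) v) = (0, 0)"
    if vV: "v \<in> blk_V t - {(0, 0), (2, 0)}" for v
  proof -
    obtain i x where v: "v = (i, x)" "i = 0 \<or> i = 1 \<or> i = 2 \<or> i = 3" "0 \<le> x" "x < t"
      using vV blk_vertexE[of v] by blast
    \<comment> \<open>Inside blocks 0 and 2 an inner color leads to position 0. From blocks 1 and 3
      the class 1 color \<open>(- x) mod t\<close> does so; where this would be the dropped color,
      the inner color fixing 0 replaces it.\<close>
    consider "i = 0 \<or> i = 2" "x \<noteq> 0" | "i = 1 \<or> i = 3" "odd t" "x = 0" | "i = 1 \<or> i = 3" "\<not> (odd t \<and> x = 0)"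
      using v vV by auto
    then show ?thesis
    proof cases
      case 1
      then obtain a where "a \<in> A" "\<iota> a x = 0" using rr_cover[of x 0] v t by auto
      then show ?thesis using 1 v
        by (intro bexI[of _ "(0, a)"]) (auto simp: blk_nb_def blk_C_def)
    next
      case 2
      then obtain a where "a \<in> A" "\<iota> a 0 = 0" using rr_fix[of 0] t by auto
      then show ?thesis using 2 v
        by (intro bexI[of _ "(0, a)"]) (auto simp: blk_nb_def blk_C_def)
    next
      case 3
      have "(- x) mod t \<noteq> 0" if "odd t"
      proof -
        have e: "\<bar>- x\<bar> < t" "- x \<noteq> 0" using that 3 v by auto
        show ?thesis
        proof
          assume "(- x) mod t = 0"
          from mod_eq0_small[OF this e(1)] e(2) show False by contradiction
        qed
      qed
      then have "(1, (- x) mod t) \<in> blk_C t A - {(2, 0)}" 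
        using t pos_mod_bound[of t "- x"] pos_mod_sign[of t "- x"] by (auto simp: blk_C_def simp del: pos_mod_sign)
      moreover have "?nb (1, (- x) mod t) (1, x) = (0, 0)" "?nb (1, (- x) mod t) (3, x) = (2, 0)"
        using v by (auto simp: blk_nb_def mod_simps)
      moreover have "?nb (2, 0) (1, x) = (3, x)" "?nb (2, 0) (3, x) = (1, x)"
        using v by (auto simp: blk_nb_def)
      ultimately show ?thesis using 3(1) v(1) by (intro bexI[of _ "(1, (- x) mod t)"]) auto
    qed
  qed
  show "card {k \<in> blk_C t A - {(2, 0)}. ?nb k' (?nb k (0, 0)) = ?nb k (2, 0)} \<le> 2"
    if k': "k' \<in> blk_C t A - {(2, 0)}" for k'
  proof -
    \<comment> \<open>If \<open>k\<close> is not of class 2, the \<open>k\<close>-neighbors of the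
      two deleted vertices are joined by the color \<open>(2, 0)\<close> and therefore by no other
      \<open>k'\<close>. For \<open>k = (2, b)\<close> they are \<open>(2, - b)\<close> and
      \<open>(0, b)\<close>, so \<open>k'\<close> is also of class 2 and its translation is
      \<open>2 * b\<close> modulo \<open>t\<close>.\<close>
    have only: "fst k' = 2 \<and> fst k = 2 \<and> 0 \<le> snd k \<and> snd k < t \<and> (2 * snd k) mod t = snd k'"
      if k: "k \<in> blk_C t A - {(2, 0)}" and e: "?nb k' (?nb k (0, 0)) = ?nb k (2, 0)" for k
    proof -
      have kC: "k \<in> blk_C t A" and k'C: "k' \<in> blk_C t A" using k k' by auto
      have pV: "?nb k (0, 0) \<in> blk_V t" using csysD(1)[OF blk_csys kC p] .
      have ne: "?nb (2, 0) (?nb k (0, 0)) \<noteq> ?nb k (2, 0)"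
        using uniq[OF pV k'C c0] e k' by auto
      from kC have k2: "fst k = 2 \<and> 0 \<le> snd k \<and> snd k < t"
      proof (cases rule: blk_colorE)
        case (1 a)
        then show ?thesis using ne rr_range[of a 0] t by (auto simp: blk_nb_def split: if_splits)
      next
        case (2 a)
        then show ?thesis using ne by (auto simp: blk_nb_def)
      next
        case (3 a)
        then show ?thesis by simp
      next
        case (4 a)
        then show ?thesis using ne by (auto simp: blk_nb_def)
      qed
      define b where "b = snd k"
      have kb: "k = (2, b)" "0 \<le> b" "b < t" using k2 by (auto simp: b_def prod_eq_iff)
      have e': "?nb k' (2, (- b) mod t) = (0, b)" using e kb by (simp add: blk_nb_def)
      from k'C have "fst k' = 2 \<and> (2 * b) mod t = snd k'"
      proof (cases rule: blk_colorE)
        case (1 a)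
        then show ?thesis using e' by (auto simp: blk_nb_def split: if_splits)
      next
        case (2 a)
        then show ?thesis using e' by (auto simp: blk_nb_def)
      next
        case (3 a)
        then have "((- b) mod t + a) mod t = b" using e' by (simp add: blk_nb_def)
        then have "(a - b) mod t = b" by (simp add: mod_simps)
        then have "(a - b + b) mod t = (b + b) mod t" by (metis mod_add_left_eq)
        then show ?thesis using 3 by simp
      next
        case (4 a)
        then show ?thesis using e' by (auto simp: blk_nb_def)
      qed
      then show ?thesis using k2 by (simp add: b_def)
    qed
    define s where "s = snd k'"
    \<comment> \<open>For \<open>0 \<le> b < t\<close> the congruence \<open>2 * b = s\<close>
      modulo \<open>t\<close> has at most these two solutions.\<close>
    have "{k \<in> blk_C t A - {(2, 0)}. ?nb k' (?nb k (0, 0)) = ?nb k (2, 0)}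
       \<subseteq> {(2, s div 2), (2, (s + t) div 2)}"
    proof
      fix k assume "k \<in> {k \<in> blk_C t A - {(2, 0)}. ?nb k' (?nb k (0, 0)) = ?nb k (2, 0)}"
      then have k: "fst k = 2" "0 \<le> snd k" "snd k < t" "(2 * snd k) mod t = s"
        using only[of k] by (auto simp: s_def)
      have "2 * snd k = s \<or> 2 * snd k = s + t"
      proof (cases "2 * snd k < t")
        case True
        then show ?thesis using k by simp
      next
        case False
        then have "(2 * snd k - t) mod t = 2 * snd k - t" using k by (intro mod_pos_pos_trivial) auto
        then show ?thesis using k(4) by simp
      qed
      then have "snd k = s div 2 \<or> snd k = (s + t) div 2" by linarith
      then show "k \<in> {(2, s div 2), (2, (s + t) div 2)}" using k(1) by (cases k) auto
    qed
    from card_mono[OF _ this]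
    have "card {k \<in> blk_C t A - {(2, 0)}. ?nb k' (?nb k (0, 0)) = ?nb k (2, 0)}
      \<le> card {(2::nat, s div 2), (2, (s + t) div 2)}" by simp
    also have "\<dots> \<le> 2" by (simp add: card_insert_if)
    finally show ?thesis .
  qed
  show "card (blk_V t) - 2 \<le> 5 * (card {v \<in> blk_V t. fst v = j} - 1)"
    if "40 \<le> card (blk_V t) - 2" "j < 4" for j
    using that(1) blk_quarter[OF that(2)] by (simp add: blk_cardV)
  show "card (blk_V t) - 2 \<le> 5 * (card {k \<in> blk_C t A. fst k = j} - 1)"
    if "40 \<le> card (blk_V t) - 2" "j \<in> {1,2,3}" for j
    using that(1) blk_class_card[OF that(2)] by (simp add: blk_cardV)
  show "fst (0::nat, 0::int) \<noteq> fst (2::nat, 0::int)" by simp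
qed

end

section \<open>Transport along bijections and existence for every order\<close>

lemma card_inv_into:
  assumes "bij_betw g C C'"
  shows "card {k\<in>C'. P (inv_into C g k)} = card {k\<in>C. P k}"
proof (rule bij_betw_same_card[symmetric])
  show "bij_betw g {k\<in>C. P k} {k\<in>C'. P (inv_into C g k)}"
  proof (rule bij_betw_imageI)
    show "inj_on g {k\<in>C. P k}" using assms by (auto simp: bij_betw_def inj_on_def)
    show "g ` {k\<in>C. P k} = {k\<in>C'. P (inv_into C g k)}"
      using assms bij_betw_inv_into_left[OF assms] bij_betw_inv_into_right[OF assms]
        bij_betwE[OF assms] bij_betwE[OF bij_betw_inv_into[OF assms]]
      by (auto simp: image_iff) metis
  qed
qed

definition relabel :: "('v \<Rightarrow> 'w) \<Rightarrow> ('w \<Rightarrow> 'v) \<Rightarrow> ('d \<Rightarrow> 'c) \<Rightarrow> ('c \<Rightarrow> 'v \<Rightarrow> 'v) \<Rightarrow> 'd \<Rightarrow> 'w \<Rightarrow> 'w" where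
  "relabel f f' g' nb k x = f (nb (g' k) (f' x))"

text \<open>Serves twice: to replace pairs by numbers, and to move the base coloring by a random
  permutation of the vertices.\<close>

lemma sbase_relabel:
  assumes base: "sbase V C nb Q cl X" and f: "bij_betw f V V'" and g: "bij_betw g C C'"
  shows "sbase V' C' (relabel f (inv_into V f) (inv_into C g) nb) (Q \<circ> inv_into V f) (cl \<circ> inv_into C g)
     {(x, k). (inv_into V f x, inv_into C g k) \<in> X}"
proof -
  interpret sbase V C nb Q cl X by (rule base)
  define f' where "f' = inv_into V f"
  define g' where "g' = inv_into C g"
  have ff: "f' (f x) = x" if "x \<in> V" for x using bij_betw_inv_into_left[OF f that] by (simp add: f'_def)
  have ff': "f (f' x) = x" if "x \<in> V'" for x using bij_betw_inv_into_right[OF f that] by (simp add: f'_def)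
  have fV: "f x \<in> V'" if "x \<in> V" for x using bij_betwE[OF f] that by blast
  have fV': "f' x \<in> V" if "x \<in> V'" for x
    using bij_betwE[OF bij_betw_inv_into[OF f]] that by (auto simp: f'_def)
  have gg: "g' (g k) = k" if "k \<in> C" for k using bij_betw_inv_into_left[OF g that] by (simp add: g'_def)
  have gC: "g k \<in> C'" if "k \<in> C" for k using bij_betwE[OF g] that by blast
  have gC': "g' k \<in> C" if "k \<in> C'" for k
    using bij_betwE[OF bij_betw_inv_into[OF g]] that by (auto simp: g'_def)
  have g_inj: "g' k = g' l \<longleftrightarrow> k = l" if "k \<in> C'" "l \<in> C'" for k l
    using that bij_betw_inv_into_right[OF g] unfolding g'_def by metis
  have f_inj: "f x = f y \<longleftrightarrow> x = y" if "x \<in> V" "y \<in> V" for x y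
    using that ff by metis
  note D = csysD[OF cs0]
  let ?nb = "relabel f f' g' nb"
  have nb1: "?nb k x \<in> V'" "f' (?nb k x) = nb (g' k) (f' x)" if "k \<in> C'" "x \<in> V'" for k x
    using D[OF gC'[OF that(1)] fV'[OF that(2)]] fV ff by (auto simp: relabel_def)
  have cov: "\<exists>k\<in>C'. ?nb k x = y" if xy: "x \<in> V'" "y \<in> V'" "x \<noteq> y" for x y
  proof -
    have "f' x \<noteq> f' y" using ff'[OF xy(1)] ff'[OF xy(2)] xy(3) by metis
    then obtain k where "k \<in> C" "nb k (f' x) = f' y"
      using csys_cover[OF cs0 fV'[OF xy(1)] fV'[OF xy(2)]] by blast
    then show ?thesis using gC gg ff'[OF xy(2)] by (intro bexI[of _ "g k"]) (auto simp: relabel_def)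
  qed
  have cV: "card V' = card V" using bij_betw_same_card[OF f] by simp
  have cC: "card C' = card C" using bij_betw_same_card[OF g] by simp
  have "sbase V' C' ?nb (Q \<circ> f') (cl \<circ> g') {(x, k). (f' x, g' k) \<in> X}"
  proof
    show "finite V'" using bij_betw_finite[OF f] finV by simp
    show "finite C'" using bij_betw_finite[OF g] finC by simp
    show "card C' \<le> card V'" using cV cC cardC by simp
    show "csys V' C' ?nb"
      unfolding csys_def
    proof (intro conjI ballI impI)
      fix k x assume k: "k \<in> C'" and x: "x \<in> V'"
      note d = D[OF gC'[OF k] fV'[OF x]]
      show "?nb k x \<in> V'" by (rule nb1(1)[OF k x])
      show "?nb k x \<noteq> x" using nb1(2)[OF k x] d(2) by metis
      show "?nb k (?nb k x) = x"
        unfolding relabel_def[of f f' g' nb k "?nb k x"] using nb1(2)[OF k x] d(3) ff'[OF x] by simp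
    next
      fix x y assume "x \<in> V'" "y \<in> V'" "x \<noteq> y"
      then show "\<exists>k\<in>C'. ?nb k x = y" by (rule cov)
    qed
    show "((?nb k x, k) \<in> {(x, k). (f' x, g' k) \<in> X}) = ((x, k) \<in> {(x, k). (f' x, g' k) \<in> X})"
      if "x \<in> V'" "k \<in> C'" for x k
      using X_sym[OF fV'[OF that(1)] gC'[OF that(2)]] nb1(2)[OF that(2,1)] by simp
    show "card {k \<in> C'. (x, k) \<in> {(x, k). (f' x, g' k) \<in> X}} \<le> 10" if "x \<in> V'" for x
      using X_vertex[OF fV'[OF that]] card_inv_into[OF g, of "\<lambda>k. (f' x, k) \<in> X"] by (simp add: g'_def)
    show "card {x \<in> V'. (x, k) \<in> {(x, k). (f' x, g' k) \<in> X}} \<le> 10" if "k \<in> C'" for k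
      using X_color[OF gC'[OF that]] card_inv_into[OF f, of "\<lambda>x. (x, g' k) \<in> X"] by (simp add: f'_def)
    show "(Q \<circ> f') (?nb k x) = xor ((cl \<circ> g') k) ((Q \<circ> f') x)"
      if "x \<in> V'" "k \<in> C'" "(x, k) \<notin> {(x, k). (f' x, g' k) \<in> X}" for x k
      using shift[OF fV'[OF that(1)] gC'[OF that(2)]] that(3) nb1(2)[OF that(2,1)] by simp
    show "card {d \<in> C'. (cl \<circ> g') d \<noteq> 0 \<and> (cl \<circ> g') d \<noteq> (cl \<circ> g') k \<and> ?nb k (?nb d x) \<noteq> ?nb d (?nb k x)} \<le> 10"
      if x: "x \<in> V'" and k: "k \<in> C'" and nX: "(x, k) \<notin> {(x, k). (f' x, g' k) \<in> X}" and c: "(cl \<circ> g') k \<noteq> 0" for x k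
    proof -
      have eq: "?nb k (?nb d x) \<noteq> ?nb d (?nb k x) \<longleftrightarrow> nb (g' k) (nb (g' d) (f' x)) \<noteq> nb (g' d) (nb (g' k) (f' x))"
        if d: "d \<in> C'" for d
      proof -
        have "?nb k (?nb d x) = f (nb (g' k) (nb (g' d) (f' x)))"
          "?nb d (?nb k x) = f (nb (g' d) (nb (g' k) (f' x)))"
          using nb1(2)[OF d x] nb1(2)[OF k x]
          unfolding relabel_def[of f f' g' nb k "?nb d x"] relabel_def[of f f' g' nb d "?nb k x"] by simp_all
        then show ?thesis
          using f_inj[OF D(1)[OF gC'[OF k] D(1)[OF gC'[OF d] fV'[OF x]]]
                         D(1)[OF gC'[OF d] D(1)[OF gC'[OF k] fV'[OF x]]]] by simp
      qed
      have "{d \<in> C'. (cl \<circ> g') d \<noteq> 0 \<and> (cl \<circ> g') d \<noteq> (cl \<circ> g') k \<and> ?nb k (?nb d x) \<noteq> ?nb d (?nb k x)}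
        = {d \<in> C'. cl (g' d) \<noteq> 0 \<and> cl (g' d) \<noteq> cl (g' k) \<and> nb (g' k) (nb (g' d) (f' x)) \<noteq> nb (g' d) (nb (g' k) (f' x))}"
        using eq by auto
      then show ?thesis
        using commute[OF fV'[OF x] gC'[OF k]] nX c
          card_inv_into[OF g, of "\<lambda>d. cl d \<noteq> 0 \<and> cl d \<noteq> cl (g' k) \<and> nb (g' k) (nb d (f' x)) \<noteq> nb d (nb (g' k) (f' x))"]
        by (simp add: g'_def)
    qed
    show "card {x \<in> V'. \<exists>k'\<in>C'. k' \<noteq> k \<and> ?nb k' x = ?nb k x} \<le> 10" if k: "k \<in> C'" for k
    proof -
      have "(\<exists>k'\<in>C'. k' \<noteq> k \<and> ?nb k' x = ?nb k x) \<longleftrightarrow> (\<exists>l\<in>C. l \<noteq> g' k \<and> nb l (f' x) = nb (g' k) (f' x))"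
        if x: "x \<in> V'" for x
      proof
        assume "\<exists>k'\<in>C'. k' \<noteq> k \<and> ?nb k' x = ?nb k x"
        then obtain k' where k': "k' \<in> C'" "k' \<noteq> k" "?nb k' x = ?nb k x" by blast
        then have "nb (g' k') (f' x) = nb (g' k) (f' x)" using nb1(2)[OF k x] nb1(2)[OF k'(1) x] by simp
        then show "\<exists>l\<in>C. l \<noteq> g' k \<and> nb l (f' x) = nb (g' k) (f' x)"
          using gC'[OF k'(1)] g_inj[OF k'(1) k] k'(2) by blast
      next
        assume "\<exists>l\<in>C. l \<noteq> g' k \<and> nb l (f' x) = nb (g' k) (f' x)"
        then obtain l where l: "l \<in> C" "l \<noteq> g' k" "nb l (f' x) = nb (g' k) (f' x)" by blast
        then show "\<exists>k'\<in>C'. k' \<noteq> k \<and> ?nb k' x = ?nb k x"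
          using gC[OF l(1)] gg[OF l(1)] by (intro bexI[of _ "g l"]) (auto simp: relabel_def)
      qed
      then have "{x \<in> V'. \<exists>k'\<in>C'. k' \<noteq> k \<and> ?nb k' x = ?nb k x}
          = {x \<in> V'. \<exists>l\<in>C. l \<noteq> g' k \<and> nb l (f' x) = nb (g' k) (f' x)}" by blast
      then show ?thesis
        using dup[OF gC'[OF k]] card_inv_into[OF f, of "\<lambda>x. \<exists>l\<in>C. l \<noteq> g' k \<and> nb l x = nb (g' k) x"]
        by (simp add: f'_def)
    qed
    show "card V' \<le> 5 * card {x \<in> V'. (Q \<circ> f') x = j}" if "40 \<le> card V'" "j < 4" for j
      using quarter_size[of j] that card_inv_into[OF f, of "\<lambda>x. Q x = j"] cV by (simp add: f'_def)
    show "card V' \<le> 5 * card {k \<in> C'. (cl \<circ> g') k = j}" if "40 \<le> card V'" "j \<in> {1,2,3}" for j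
      using class_size[of j] that card_inv_into[OF g, of "\<lambda>k. cl k = j"] cV by (simp add: g'_def)
  qed
  then show ?thesis by (simp add: f'_def g'_def)
qed

text \<open>Four blocks of size \<open>n / 2\<close> suffice for even \<open>n\<close>. For odd
  \<open>n\<close> the blocks have size \<open>(n + 1) / 2\<close>, and two vertices and one color
  are removed from \<open>2 * n + 2\<close> vertices and \<open>2 * n + 1\<close> colors.\<close>

lemma sbase_exists_blk:
  fixes n m :: nat
  assumes n: "n \<ge> 1" and m: "m = (if even n then 2 * n - 1 else 2 * n)"
  shows "\<exists>(V :: (nat \<times> int) set) (C :: (nat \<times> int) set) nb Q cl X.
    sbase V C nb Q cl X \<and> card V = 2 * n \<and> card C = m"
proof (cases "even n")
  case True
  define t where "t = int (n div 2)"
  have t: "t > 0" "4 * nat t = 2 * n" using True n by (auto simp: t_def)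
  obtain A \<iota> where rr: "round_robin t A \<iota>" using round_robin_exists[OF t(1)] by blast
  show ?thesis
  proof (intro exI conjI)
    show "sbase (blk_V t) (blk_C t A) (blk_nb t \<iota>) fst fst
        {(v, k). fst k = 0 \<and> \<iota> (snd k) (snd v) = snd v}"
      by (rule blk_sbase[OF t(1) rr])
    show "card (blk_V t) = 2 * n" "card (blk_C t A) = m"
      using blk_cardV[OF t(1) rr] blk_cardC[OF t(1) rr] t(2) m True by simp_all
  qed
next
  case False
  define t where "t = int ((n + 1) div 2)"
  have t: "t > 0" "4 * nat t = 2 * n + 2" using False n by (auto simp: t_def elim: oddE)
  obtain A \<iota> where rr: "round_robin t A \<iota>" using round_robin_exists[OF t(1)] by blast
  have "{(0, 0), (2, 0)} \<subseteq> blk_V t" using t(1) by (auto simp: blk_V_def)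
  then have V: "card (blk_V t - {(0, 0), (2, 0)}) = 2 * n"
    using t(2) by (simp add: card_Diff_subset blk_cardV[OF t(1) rr])
  have "(2, 0) \<in> blk_C t A" using t(1) by (auto simp: blk_C_def)
  then have C: "card (blk_C t A - {(2, 0)}) = m"
    using t(2) False m blk_finC[OF t(1) rr] blk_cardC[OF t(1) rr] by simp
  show ?thesis by (intro exI conjI) (rule blk_sbase2[OF t(1) rr], rule V, rule C)
qed

lemma sbase_exists:
  fixes n m :: nat
  assumes n: "n \<ge> 1" and m: "m = (if even n then 2 * n - 1 else 2 * n)"
  shows "\<exists>nb Q cl X. sbase {1..2 * n} {1..m} nb Q cl X"
proof -
  obtain V :: "(nat \<times> int) set" and C :: "(nat \<times> int) set" and nb Q cl X where
    b: "sbase V C nb Q cl X" and c: "card V = 2 * n" "card C = m"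
    using sbase_exists_blk[OF assms] by blast
  have "finite V" "finite C" using b by (auto simp: sbase_def)
  then obtain f g where "bij_betw f V {1..2 * n}" "bij_betw g C {1..m}"
    using c finite_same_card_bij[of V "{1..2 * n}"] finite_same_card_bij[of C "{1..m}"] by auto
  from sbase_relabel[OF b this] show ?thesis by blast
qed

section \<open>Switching in a base coloring\<close>

lemma card_Un_real:
  assumes "real (card A) \<le> a" "real (card B) \<le> b"
  shows "real (card (A \<union> B)) \<le> a + b"
  using card_Un_le[of A B] assms by linarith

lemma card_subset_real:
  assumes "A \<subseteq> B" "finite B" "real (card B) \<le> b"
  shows "real (card A) \<le> b"
  using card_mono[OF assms(2,1)] assms(3) by linarith

text \<open>\<open>dP\<close> contains the precolored edges, \<open>pd x k\<close> says that a pending edge at \<open>x\<close> has to get color \<open>k\<close>,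
  and \<open>UV\<close>, \<open>UC\<close> are the vertices and colors that may still be touched freely.\<close>

locale switching = sbase V C nb0 Q cl X
  for V :: "'v set" and C :: "'c set" and nb0 Q cl X +
  fixes L :: "'v set \<Rightarrow> 'c set" and dP :: "'v set set" and pd :: "'v \<Rightarrow> 'c \<Rightarrow> bool"
    and UV :: "'v set" and UC :: "'c set" and r :: real
  assumes r: "real (card V) = 1000 * r" and r_big: "r \<ge> 10 ^ 6"
    and L_edge: "x \<in> V \<Longrightarrow> y \<in> V \<Longrightarrow> x \<noteq> y \<Longrightarrow> real (card {k\<in>C. k \<in> L {x, y}}) \<le> r"
    and L_vertex: "x \<in> V \<Longrightarrow> k \<in> C \<Longrightarrow> real (card {y\<in>V. y \<noteq> x \<and> k \<in> L {x, y}}) \<le> r"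
    and L_few: "x \<in> V \<Longrightarrow>
      real (card {y\<in>V. y \<noteq> x \<and> \<not> real (card {d\<in>C. d \<in> L {nb0 d x, nb0 d y}}) \<le> r}) \<le> r"
    and pd_vertex: "x \<in> V \<Longrightarrow> real (card {k\<in>C. pd x k}) \<le> r"
    and pd_color: "k \<in> C \<Longrightarrow> real (card {x\<in>V. pd x k}) \<le> r"
    and UV_sub: "UV \<subseteq> V" and UV_card: "real (card (V - UV)) \<le> 2 * r"
    and UC_sub: "UC \<subseteq> C" and UC_card: "real (card (C - UC)) \<le> r"
begin

definition bad :: "('c \<Rightarrow> 'v \<Rightarrow> 'v) \<Rightarrow> 'v \<Rightarrow> 'c \<Rightarrow> bool" where
  "bad nb x k \<longleftrightarrow> (x, k) \<in> X \<or> {x, nb0 k x} \<in> dP \<or> nb k x \<noteq> nb0 k x"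

text \<open>When \<open>d\<close> is the intermediate color moved onto \<open>{x, y}\<close>, the
  edge between the \<open>d\<close>-neighbors of \<open>x\<close> and \<open>y\<close> ends up with
  color \<open>d\<close>. The bound says that few choices of \<open>d\<close> are ruled out by the
  list of that edge.\<close>

definition few :: "'v \<Rightarrow> 'v \<Rightarrow> bool" where
  "few x y \<longleftrightarrow> real (card {d\<in>C. d \<in> L {nb0 d x, nb0 d y}}) \<le> r"

definition tame :: "('c \<Rightarrow> 'v \<Rightarrow> 'v) \<Rightarrow> bool" where
  "tame nb \<longleftrightarrow> csys V C nb \<and> (\<forall>x\<in>V. real (card {k\<in>C. bad nb x k}) \<le> 2 * r)
     \<and> (\<forall>k\<in>C. real (card {x\<in>V. bad nb x k}) \<le> 2 * r)"

text \<open>Everything asked of a partner \<open>q\<close> for which \<open>{p, q}\<close> can be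
  given color \<open>b\<close>. The requirements on blocks force the colors of \<open>{p, q}\<close>
  and of the edge between the \<open>b\<close>-neighbors to have nonzero class; only such colors lie
  in many 4-cycles.\<close>

definition good :: "('c \<Rightarrow> 'v \<Rightarrow> 'v) \<Rightarrow> 'v \<Rightarrow> 'c \<Rightarrow> 'v \<Rightarrow> bool" where
  "good nb p b q \<longleftrightarrow> q \<in> UV \<and> nb0 b q \<in> UV \<and> q \<noteq> p \<and> q \<noteq> nb b p \<and>
     Q q \<noteq> Q p \<and> Q (nb0 b q) \<noteq> Q (nb b p) \<and> \<not> bad nb q b \<and>
     (\<exists>c\<in>UC. nb0 c p = q \<and> \<not> bad nb p c) \<and>
     (\<exists>c\<in>UC. nb0 c (nb b p) = nb0 b q \<and> \<not> bad nb (nb b p) c) \<and>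
     b \<notin> L {p, q} \<and> b \<notin> L {nb b p, nb0 b q} \<and> \<not> pd q b \<and> \<not> pd (nb0 b q) b \<and>
     few p q \<and> few (nb b p) (nb0 b q)"

lemma bad_sym:
  assumes "csys V C nb" "x \<in> V" "k \<in> C" "\<not> bad nb x k"
  shows "\<not> bad nb (nb0 k x) k"
proof -
  have "nb0 k (nb0 k x) = x" using csysD(3)[OF cs0 assms(3,2)] .
  moreover have "nb k (nb0 k x) = x"
    using csysD(3)[OF assms(1,3,2)] assms(4) by (simp add: bad_def)
  ultimately show ?thesis
    using assms(4) X_sym[OF assms(2,3)] by (simp add: bad_def insert_commute)
qed

lemma few_bound:
  assumes "x \<in> V"
  shows "real (card {y\<in>V. y \<noteq> x \<and> \<not> few x y}) \<le> r"
  using L_few[OF assms] by (simp add: few_def)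

lemma vertices_via:
  assumes "b \<in> C" "real (card {y\<in>V. P y}) \<le> a"
  shows "real (card {q\<in>V. P (nb0 b q)}) \<le> a"
proof -
  have "{q\<in>V. P (nb0 b q)} = {q\<in>V. nb0 b q \<in> {y\<in>V. P y}}"
    using csysD(1)[OF cs0 assms(1)] by auto
  then show ?thesis
    using card_vimage_nb_le[OF cs0 assms(1) finV, of "{y\<in>V. P y}"] assms(2)
    by (simp add: Int_absorb2)
qed

text \<open>The additional 1 stands for the one vertex that two colors may join to
  \<open>p\<close>.\<close>

lemma colors_via:
  assumes "p \<in> V" "real (card {y\<in>V. P y}) \<le> a"
  shows "real (card {k\<in>C. P (nb0 k p)}) \<le> a + 1"
proof -
  have "{k\<in>C. P (nb0 k p)} = {k\<in>C. nb0 k p \<in> {y\<in>V. P y}}"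
    using csysD(1)[OF cs0 _ assms(1)] by auto
  then show ?thesis
    using card_colors_le[OF cs0 finV finC cardC assms(1), of "{y\<in>V. P y}"] assms(2)
    by (simp add: Int_absorb2)
qed

lemma vertices_of_colors:
  assumes "real (card {k\<in>C. P k}) \<le> a"
  shows "real (card {q\<in>V. \<exists>k\<in>C. nb0 k p = q \<and> P k}) \<le> a"
proof -
  have "{q\<in>V. \<exists>k\<in>C. nb0 k p = q \<and> P k} \<subseteq> (\<lambda>k. nb0 k p) ` {k\<in>C. P k}" by auto
  then have "card {q\<in>V. \<exists>k\<in>C. nb0 k p = q \<and> P k} \<le> card {k\<in>C. P k}"
    using finC by (intro surj_card_le) auto
  then show ?thesis using assms by linarith
qed

text \<open>The block requirements cost nothing: if the edge of color \<open>b\<close> at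
  \<open>q\<close> is not bad, its other end lies in block \<open>xor (cl b) j\<close>, which
  \<open>j\<close> was chosen to allow for. The remaining requirements exclude about 18 r vertices,
  rounded up to 30 r.\<close>

lemma good_bound:
  assumes tame: "tame nb" and p: "p \<in> V" and b: "b \<in> C"
    and j: "j \<noteq> Q p" "xor (cl b) j \<noteq> Q (nb b p)"
  shows "real (card {q\<in>V. Q q = j \<and> \<not> good nb p b q}) \<le> 30 * r"
proof -
  have cs: "csys V C nb" using tame by (simp add: tame_def)
  define p1 where "p1 = nb b p"
  have p1: "p1 \<in> V" "p1 \<noteq> p" "nb b p1 = p" using csysD[OF cs b p] by (auto simp: p1_def)
  define B1 where "B1 = {q\<in>V. q \<notin> UV}"
  define B2 where "B2 = {q\<in>V. nb0 b q \<notin> UV}"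
  define B3 where "B3 = {p, p1}"
  define B4 where "B4 = {q\<in>V. bad nb q b}"
  define B5 where "B5 = {q\<in>V. \<exists>k\<in>C. nb0 k p = q \<and> bad nb p k}"
  define B6 where "B6 = {q\<in>V. \<exists>k\<in>C. nb0 k p = q \<and> k \<notin> UC}"
  define B7 where "B7 = {q\<in>V. nb0 b q \<in> {y\<in>V. \<exists>k\<in>C. nb0 k p1 = y \<and> bad nb p1 k}}"
  define B8 where "B8 = {q\<in>V. nb0 b q \<in> {y\<in>V. \<exists>k\<in>C. nb0 k p1 = y \<and> k \<notin> UC}}"
  define B9 where "B9 = {q\<in>V. q \<noteq> p \<and> b \<in> L {p, q}}"
  define B10 where "B10 = {q\<in>V. nb0 b q \<noteq> p1 \<and> b \<in> L {p1, nb0 b q}}"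
  define B11 where "B11 = {q\<in>V. pd q b}"
  define B12 where "B12 = {q\<in>V. pd (nb0 b q) b}"
  define B13 where "B13 = {q\<in>V. q \<noteq> p \<and> \<not> few p q}"
  define B14 where "B14 = {q\<in>V. nb0 b q \<noteq> p1 \<and> \<not> few p1 (nb0 b q)}"
  have eqUV: "{q\<in>V. q \<notin> UV} = V - UV" and eqUC: "{k\<in>C. k \<notin> UC} = C - UC" by auto
  have bv: "real (card {k\<in>C. bad nb x k}) \<le> 2 * r" if "x \<in> V" for x
    using tame that by (simp add: tame_def)
  have bc: "real (card {x\<in>V. bad nb x k}) \<le> 2 * r" if "k \<in> C" for k
    using tame that by (simp add: tame_def)
  have c1: "real (card B1) \<le> 2 * r" using UV_card eqUV by (simp add: B1_def)
  have c2: "real (card B2) \<le> 2 * r" unfolding B2_def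
    by (rule vertices_via[OF b]) (use UV_card eqUV in simp)
  have c3: "real (card B3) \<le> 2" by (simp add: B3_def card_insert_if)
  have c4: "real (card B4) \<le> 2 * r" unfolding B4_def by (rule bc[OF b])
  have c5: "real (card B5) \<le> 2 * r" unfolding B5_def by (rule vertices_of_colors[OF bv[OF p]])
  have c6: "real (card B6) \<le> r" unfolding B6_def
    by (rule vertices_of_colors) (use UC_card eqUC in simp)
  have c7: "real (card B7) \<le> 2 * r" unfolding B7_def
    by (rule vertices_via[OF b]) (use vertices_of_colors[OF bv[OF p1(1)], of p1] in simp)
  have c8: "real (card B8) \<le> r" unfolding B8_def
    by (rule vertices_via[OF b])
       (use vertices_of_colors[of "\<lambda>k. k \<notin> UC" r p1] UC_card eqUC in simp)
  have c9: "real (card B9) \<le> r" unfolding B9_def by (rule L_vertex[OF p b])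
  have c10: "real (card B10) \<le> r" unfolding B10_def
    by (rule vertices_via[OF b L_vertex[OF p1(1) b]])
  have c11: "real (card B11) \<le> r" unfolding B11_def by (rule pd_color[OF b])
  have c12: "real (card B12) \<le> r" unfolding B12_def by (rule vertices_via[OF b pd_color[OF b]])
  have c13: "real (card B13) \<le> r" unfolding B13_def by (rule few_bound[OF p])
  have c14: "real (card B14) \<le> r" unfolding B14_def
    by (rule vertices_via[OF b few_bound[OF p1(1)]])
  let ?U = "B1 \<union> B2 \<union> B3 \<union> B4 \<union> B5 \<union> B6 \<union> B7 \<union> B8 \<union> B9 \<union> B10 \<union> B11 \<union> B12 \<union> B13 \<union> B14"
  have sub: "{q\<in>V. Q q = j \<and> \<not> good nb p b q} \<subseteq> ?U"
  proof
    fix q assume q: "q \<in> {q\<in>V. Q q = j \<and> \<not> good nb p b q}"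
    show "q \<in> ?U"
    proof (rule ccontr)
      assume n: "q \<notin> ?U"
      have qV: "q \<in> V" and Qq: "Q q = j" using q by auto
      have n1: "q \<in> UV" "nb0 b q \<in> UV" "q \<noteq> p" "q \<noteq> p1" "\<not> bad nb q b" "\<not> pd q b" "\<not> pd (nb0 b q) b"
        using n qV by (auto simp: B1_def B2_def B3_def B4_def B11_def B12_def)
      have q1: "nb0 b q \<in> V" "nb0 b q = nb b q" using csysD(1)[OF cs0 b qV] n1(5) by (auto simp: bad_def)
      have q1p: "nb0 b q \<noteq> p1"
        using csysD(3)[OF cs b qV] csysD(3)[OF cs b p] q1(2) n1(3) by (metis p1_def)
      have n2: "b \<notin> L {p, q}" "b \<notin> L {p1, nb0 b q}" "few p q" "few p1 (nb0 b q)"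
        using n qV n1(3) q1p by (auto simp: B9_def B10_def B13_def B14_def)
      obtain c0 where c0: "c0 \<in> C" "nb0 c0 p = q" using csys_cover[OF cs0 p qV] n1(3) by blast
      obtain c1 where c1: "c1 \<in> C" "nb0 c1 p1 = nb0 b q" using csys_cover[OF cs0 p1(1) q1(1)] q1p by metis
      have "c0 \<in> UC" "\<not> bad nb p c0" using n qV c0 by (auto simp: B5_def B6_def)
      moreover have "c1 \<in> UC" "\<not> bad nb p1 c1" using n qV q1(1) c1 by (auto simp: B7_def B8_def)
      moreover have "Q q \<noteq> Q p" using Qq j by simp
      moreover have "Q (nb0 b q) \<noteq> Q p1"
        using shift[OF qV b] n1(5) Qq j by (simp add: bad_def p1_def)
      ultimately have "good nb p b q"
        unfolding good_def p1_def[symmetric] using n1 n2 c0 c1 by blast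
      then show False using q by simp
    qed
  qed
  have fin: "finite ?U"
    using finV by (simp add: B1_def B2_def B3_def B4_def B5_def B6_def B7_def B8_def B9_def B10_def
        B11_def B12_def B13_def B14_def)
  have "real (card ?U) \<le> 2*r + 2*r + 2 + 2*r + 2*r + r + 2*r + r + r + r + r + r + r + r"
    by (intro card_Un_real c1 c2 c3 c4 c5 c6 c7 c8 c9 c10 c11 c12 c13 c14)
  also have "\<dots> \<le> 30 * r" using r_big by simp
  finally show ?thesis by (rule card_subset_real[OF sub fin])
qed

text \<open>A partner chosen early has to stay usable after other exchanges. The vertex
  \<open>q\<close> itself may be touched meanwhile; that its \<open>b\<close>-edge is not bad is
  read off from the other end of that edge.\<close>

lemma good_cong:
  assumes "csys V C nb" "csys V C nb'" "p \<in> V" "b \<in> C" "good nb p b q"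
    and eq: "\<And>x k. x \<in> {p, nb b p, nb0 b q} \<Longrightarrow> nb' k x = nb k x"
  shows "good nb' p b q"
proof -
  have qV: "q \<in> V" using assms(5) UV_sub by (auto simp: good_def)
  have nbq: "\<not> bad nb q b" using assms(5) by (simp add: good_def)
  have "\<not> bad nb (nb0 b q) b" by (rule bad_sym[OF assms(1) qV assms(4) nbq])
  then have "\<not> bad nb' (nb0 b q) b" using eq[of "nb0 b q" b] by (simp add: bad_def)
  then have "\<not> bad nb' q b"
    using bad_sym[OF assms(2) csysD(1)[OF cs0 assms(4) qV] assms(4)] csysD(3)[OF cs0 assms(4) qV] by simp
  moreover have "nb' b p = nb b p" using eq by simp
  moreover have "bad nb' p c = bad nb p c" "bad nb' (nb b p) c = bad nb (nb b p) c" for c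
    using eq by (auto simp: bad_def)
  ultimately show ?thesis using assms(5) unfolding good_def by simp
qed

end

section \<open>Giving a prescribed color to a generic edge\<close>

context switching
begin

text \<open>The properties of a changed incidence that the invariant of the whole process will need.
  The condition on \<open>pd\<close> keeps the load of \<open>p\<close> and \<open>p1\<close> from
  growing, and the last one ensures that only colors with room to spare are moved onto precolored
  edges.\<close>

definition clean :: "('c \<Rightarrow> 'v \<Rightarrow> 'v) \<Rightarrow> ('c \<Rightarrow> 'v \<Rightarrow> 'v) \<Rightarrow> 'v \<Rightarrow> 'v \<Rightarrow> 'c \<Rightarrow> 'v \<Rightarrow> 'c \<Rightarrow> bool" where
  "clean nb nb' p p1 b x k \<longleftrightarrow>
     (\<not> bad nb x k \<or> k = b \<and> x \<in> {p, p1}) \<and> k \<notin> L {x, nb' k x} \<and>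
     (x \<in> {p, p1} \<longrightarrow> \<not> pd (nb' k x) k) \<and> ({x, nb' k x} \<notin> dP \<or> k \<in> UC)"

text \<open>There are three nonzero classes, so one differs from those of both \<open>c0\<close> and
  \<open>c1\<close>. It contains at least 200 r colors, more than all requirements together exclude.
  \<open>avV\<close> and \<open>avC\<close> protect vertices and colors that other exchanges of the
  same recoloring rely on.\<close>

lemma exists_middle_color:
  assumes tame: "tame nb" and p: "p \<in> V" and b: "b \<in> C" and g: "good nb p b q"
    and av: "finite avV" "card avV \<le> 20" "finite avC" "card avC \<le> 20"
    and p1: "p1 = nb b p" and q1: "q1 = nb0 b q"
    and c0: "c0 \<in> UC" "nb0 c0 p = q" "\<not> bad nb p c0"
    and c1: "c1 \<in> UC" "nb0 c1 p1 = q1" "\<not> bad nb p1 c1"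
  obtains d where "d \<in> UC" "cl d \<noteq> cl c0" "cl d \<noteq> cl c1" "d \<noteq> b" "d \<notin> avC"
    "\<And>x. x \<in> {p, q, p1, q1} \<Longrightarrow> \<not> bad nb x d \<and> nb0 d x \<in> UV \<and> nb0 d x \<notin> avV \<union> {p, q, p1, q1}"
    "nb0 c0 (nb0 d p) = nb0 d q" "nb0 c1 (nb0 d p1) = nb0 d q1"
    "\<not> bad nb (nb0 d p) c0" "\<not> bad nb (nb0 d p1) c1"
    "d \<notin> L {p, p1}" "d \<notin> L {q, q1}"
    "c0 \<notin> L {p, nb0 d p}" "c0 \<notin> L {q, nb0 d q}" "c1 \<notin> L {p1, nb0 d p1}" "c1 \<notin> L {q1, nb0 d q1}"
    "d \<notin> L {nb0 d p, nb0 d q}" "d \<notin> L {nb0 d p1, nb0 d q1}"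
    "\<not> pd p d" "\<not> pd p1 d" "\<not> pd (nb0 d p) c0" "\<not> pd (nb0 d p1) c1"
proof -
  have cs: "csys V C nb" using tame by (simp add: tame_def)
  have p1V: "p1 \<in> V" "p1 \<noteq> p" using csysD[OF cs b p] by (auto simp: p1)
  have qV: "q \<in> V" using g UV_sub by (auto simp: good_def)
  have q1V: "q1 \<in> V" using g UV_sub by (auto simp: good_def q1)
  have c0C: "c0 \<in> C" and c1C: "c1 \<in> C" using c0 c1 UC_sub by auto
  have gf: "few p q" "few p1 q1" "Q q \<noteq> Q p" "Q q1 \<noteq> Q p1" using g by (auto simp: good_def p1 q1)
  have q1q: "q1 \<noteq> q" using csysD(2)[OF cs0 b qV] by (simp add: q1)
  have "Q q = xor (cl c0) (Q p)" "Q q1 = xor (cl c1) (Q p1)"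
    using shift[OF p c0C] shift[OF p1V(1) c1C] c0 c1 by (auto simp: bad_def)
  then have clc: "cl c0 \<noteq> 0" "cl c1 \<noteq> 0"
    using gf(3,4) by (metis xor.left_neutral)+
  have bv: "real (card {k\<in>C. bad nb x k}) \<le> 2 * r" if "x \<in> V" for x
    using tame that by (simp add: tame_def)
  have bc: "real (card {x\<in>V. bad nb x k}) \<le> 2 * r" if "k \<in> C" for k
    using tame that by (simp add: tame_def)
  have "\<exists>j\<in>{1, 2, 3::nat}. j \<noteq> cl c0 \<and> j \<noteq> cl c1" by auto
  then obtain j where j: "j \<in> {1, 2, 3::nat}" "j \<noteq> cl c0" "j \<noteq> cl c1" by blast
  have j0: "j \<noteq> 0" using j(1) by auto
  define W where "W = avV \<union> {p, q, p1, q1}"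
  have Wc: "finite W" "card W \<le> 24"
  proof -
    show "finite W" using av by (simp add: W_def)
    have "card {p, q, p1, q1} \<le> 4" by (simp add: card_insert_if)
    then show "card W \<le> 24" using card_Un_le[of avV "{p, q, p1, q1}"] av by (simp add: W_def)
  qed
  have eqUV: "{q\<in>V. q \<notin> UV} = V - UV" and eqUC: "{k\<in>C. k \<notin> UC} = C - UC" by auto
  have W': "real (card {y\<in>V. y \<notin> UV \<or> y \<in> W}) \<le> 2 * r + 24"
  proof (rule card_subset_real[of _ "(V - UV) \<union> W"])
    show "real (card ((V - UV) \<union> W)) \<le> 2 * r + 24"
      by (rule card_Un_real[OF UV_card]) (use Wc in simp)
  qed (use finV Wc in auto)
  define E1 where "E1 = (\<lambda>x. {d\<in>C. bad nb x d})"
  define E2 where "E2 = (\<lambda>x c. {d\<in>C. cl d \<noteq> 0 \<and> cl d \<noteq> cl c \<and> nb0 c (nb0 d x) \<noteq> nb0 d (nb0 c x)})"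
  define E3 where "E3 = (\<lambda>x c. {d\<in>C. bad nb (nb0 d x) c})"
  define E4 where "E4 = {d\<in>C. d \<notin> UC}"
  define E5 where "E5 = insert b avC"
  define E6 where "E6 = (\<lambda>x. {d\<in>C. nb0 d x \<notin> UV \<or> nb0 d x \<in> W})"
  define E7 where "E7 = (\<lambda>x y. {d\<in>C. d \<in> L {x, y}})"
  define E8 where "E8 = (\<lambda>x c. {d\<in>C. nb0 d x \<noteq> x \<and> c \<in> L {x, nb0 d x}})"
  define E9 where "E9 = (\<lambda>x y. {d\<in>C. d \<in> L {nb0 d x, nb0 d y}})"
  define E10 where "E10 = (\<lambda>x. {d\<in>C. pd x d})"
  define E11 where "E11 = (\<lambda>x c. {d\<in>C. pd (nb0 d x) c})"
  have e1: "real (card (E1 x)) \<le> 2 * r" if "x \<in> V" for x unfolding E1_def by (rule bv[OF that])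
  have e2: "real (card (E2 x c)) \<le> 10" if "x \<in> V" "c \<in> C" "\<not> bad nb x c" "cl c \<noteq> 0" for x c
    using commute[OF that(1,2)] that(3,4) unfolding E2_def bad_def by simp
  have e3: "real (card (E3 x c)) \<le> 2 * r + 1" if "x \<in> V" "c \<in> C" for x c
    unfolding E3_def by (rule colors_via[OF that(1) bc[OF that(2)]])
  have e4: "real (card E4) \<le> r" using UC_card eqUC by (simp add: E4_def)
  have e5: "real (card E5) \<le> 21" using av by (simp add: E5_def card_insert_if)
  have e6: "real (card (E6 x)) \<le> 2 * r + 24 + 1" if "x \<in> V" for x
    unfolding E6_def by (rule colors_via[OF that W'])
  have e7: "real (card (E7 x y)) \<le> r" if "x \<in> V" "y \<in> V" "x \<noteq> y" for x y
    unfolding E7_def by (rule L_edge[OF that])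
  have e8: "real (card (E8 x c)) \<le> r + 1" if "x \<in> V" "c \<in> C" for x c
    unfolding E8_def by (rule colors_via[OF that(1) L_vertex[OF that]])
  have e9: "real (card (E9 x y)) \<le> r" if "few x y" for x y
    using that unfolding E9_def few_def .
  have e10: "real (card (E10 x)) \<le> r" if "x \<in> V" for x
    unfolding E10_def by (rule pd_vertex[OF that])
  have e11: "real (card (E11 x c)) \<le> r + 1" if "x \<in> V" "c \<in> C" for x c
    unfolding E11_def by (rule colors_via[OF that(1) pd_color[OF that(2)]])
  let ?U = "E1 p \<union> E1 q \<union> E1 p1 \<union> E1 q1 \<union> E2 p c0 \<union> E2 p1 c1 \<union> E3 p c0 \<union> E3 p1 c1 \<union> E4 \<union> E5
    \<union> E6 p \<union> E6 q \<union> E6 p1 \<union> E6 q1 \<union> E7 p p1 \<union> E7 q q1 \<union> E8 p c0 \<union> E8 q c0 \<union> E8 p1 c1 \<union> E8 q1 c1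
    \<union> E9 p q \<union> E9 p1 q1 \<union> E10 p \<union> E10 p1 \<union> E11 p c0 \<union> E11 p1 c1"
  have "real (card ?U) \<le> 2*r + 2*r + 2*r + 2*r + 10 + 10 + (2*r+1) + (2*r+1) + r + 21
    + (2*r+24+1) + (2*r+24+1) + (2*r+24+1) + (2*r+24+1) + r + r + (r+1) + (r+1) + (r+1) + (r+1)
    + r + r + r + r + (r+1) + (r+1)"
    by (intro card_Un_real e1 e2 e3 e4 e5 e6 e7 e8 e9 e10 e11 p qV p1V(1) q1V c0C c1C c0(3) c1(3) clc
        p1V(2)[symmetric] q1q[symmetric] gf(1,2))
  also have "\<dots> < 200 * r" using r_big by simp
  finally have U: "real (card ?U) < 200 * r" .
  have "real (card V) \<le> 5 * real (card {k\<in>C. cl k = j})"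
  proof -
    have "40 \<le> real (card V)" using r r_big by simp
    then have "40 \<le> card V" by linarith
    from class_size[OF this j(1)] show ?thesis by linarith
  qed
  then have "card ?U < card {k\<in>C. cl k = j}" using U r by linarith
  moreover have "finite ?U"
    using finC av by (simp add: E1_def E2_def E3_def E4_def E5_def E6_def E7_def E8_def E9_def E10_def E11_def)
  ultimately have "\<not> {k\<in>C. cl k = j} \<subseteq> ?U" using card_mono[of ?U "{k\<in>C. cl k = j}"] by linarith
  then obtain d where d: "d \<in> C" "cl d = j" "d \<notin> ?U" by blast
  have clean: "d \<in> UC" "d \<noteq> b" "d \<notin> avC" using d by (auto simp: E4_def E5_def)
  have x: "\<not> bad nb x d \<and> nb0 d x \<in> UV \<and> nb0 d x \<notin> avV \<union> {p, q, p1, q1}"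
    if "x \<in> {p, q, p1, q1}" for x
    using that d(1,3) unfolding W_def[symmetric] by (auto simp: E1_def E6_def)
  have y: "nb0 c0 (nb0 d p) = nb0 d q" "nb0 c1 (nb0 d p1) = nb0 d q1"
    using d j j0 c0(2) c1(2) by (auto simp: E2_def)
  have ne: "nb0 d x \<noteq> x" if "x \<in> V" for x using csysD(2)[OF cs0 d(1) that] .
  show ?thesis
    by (rule that[of d]) (use clean x y d j ne[OF p] ne[OF qV] ne[OF p1V(1)] ne[OF q1V] in
        \<open>auto simp: E3_def E7_def E8_def E9_def E10_def E11_def\<close>)
qed

text \<open>Since \<open>d\<close> commutes with \<open>c0\<close> at \<open>p\<close> and with
  \<open>c1\<close> at \<open>p1\<close>, the cycles \<open>p q q2 p2\<close> and
  \<open>p1 q1 q3 p3\<close> close. Exchanging on them turns \<open>p q q1 p1\<close> into a cycle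
  alternating between \<open>d\<close> and \<open>b\<close>, whatever the history of the edge
  \<open>p p1\<close>.\<close>

lemma make_color:
  assumes tame: "tame nb" and p: "p \<in> V" and b: "b \<in> C" and g: "good nb p b q"
    and av: "finite avV" "card avV \<le> 20" "finite avC" "card avC \<le> 20"
  obtains nb' where "swaps ({p, nb b p} \<union> UV) (UC \<union> {b}) 3 nb nb'" "nb' b p = q"
    "\<And>x k. nb' k x \<noteq> nb k x \<Longrightarrow> clean nb nb' p (nb b p) b x k"
    "\<And>x k. x \<in> avV \<Longrightarrow> x \<notin> {p, nb b p, q, nb0 b q} \<Longrightarrow> nb' k x = nb k x"
    "\<And>k. k \<in> avC \<Longrightarrow> k \<noteq> b \<Longrightarrow> nb k p \<noteq> q \<Longrightarrow> nb' k p = nb k p"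
    "\<And>k. k \<in> avC \<Longrightarrow> k \<noteq> b \<Longrightarrow> nb k q \<noteq> p \<Longrightarrow> nb' k q = nb k q"
proof -
  have cs: "csys V C nb" using tame by (simp add: tame_def)
  define p1 where "p1 = nb b p"
  define q1 where "q1 = nb0 b q"
  obtain c0 where c0: "c0 \<in> UC" "nb0 c0 p = q" "\<not> bad nb p c0" using g by (auto simp: good_def)
  obtain c1 where c1: "c1 \<in> UC" "nb0 c1 p1 = q1" "\<not> bad nb p1 c1"
    using g by (auto simp: good_def p1_def q1_def)
  obtain d where d: "d \<in> UC" "cl d \<noteq> cl c0" "cl d \<noteq> cl c1" "d \<noteq> b" "d \<notin> avC"
    and dx: "\<And>x. x \<in> {p, q, p1, q1} \<Longrightarrow> \<not> bad nb x d \<and> nb0 d x \<in> UV \<and> nb0 d x \<notin> avV \<union> {p, q, p1, q1}"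
    and dc: "nb0 c0 (nb0 d p) = nb0 d q" "nb0 c1 (nb0 d p1) = nb0 d q1"
    "\<not> bad nb (nb0 d p) c0" "\<not> bad nb (nb0 d p1) c1"
    and dL: "d \<notin> L {p, p1}" "d \<notin> L {q, q1}"
    "c0 \<notin> L {p, nb0 d p}" "c0 \<notin> L {q, nb0 d q}" "c1 \<notin> L {p1, nb0 d p1}" "c1 \<notin> L {q1, nb0 d q1}"
    "d \<notin> L {nb0 d p, nb0 d q}" "d \<notin> L {nb0 d p1, nb0 d q1}"
    and dp: "\<not> pd p d" "\<not> pd p1 d" "\<not> pd (nb0 d p) c0" "\<not> pd (nb0 d p1) c1"
    using exists_middle_color[OF tame p b g av p1_def q1_def c0 c1] by metis
  define p2 where "p2 = nb0 d p"
  define q2 where "q2 = nb0 d q"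
  define p3 where "p3 = nb0 d p1"
  define q3 where "q3 = nb0 d q1"
  have C: "c0 \<in> C" "c1 \<in> C" "d \<in> C" using c0 c1 d UC_sub by auto
  have gUV: "q \<in> UV" "q1 \<in> UV" using g by (auto simp: good_def q1_def)
  have qV: "q \<in> V" "q1 \<in> V" using gUV UV_sub by auto
  have p1V: "p1 \<in> V" "p1 \<noteq> p" "nb b p1 = p" using csysD[OF cs b p] by (auto simp: p1_def)
  have gb: "\<not> bad nb q b" "b \<notin> L {p, q}" "b \<notin> L {p1, q1}" "\<not> pd q b" "\<not> pd q1 b" "q \<noteq> p" "q \<noteq> p1"
    using g by (auto simp: good_def p1_def q1_def)
  have UV23: "p2 \<in> UV" "q2 \<in> UV" "p3 \<in> UV" "q3 \<in> UV"
    using dx by (auto simp: p2_def q2_def p3_def q3_def)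
  have V23: "p2 \<in> V" "q2 \<in> V" "p3 \<in> V" "q3 \<in> V" using UV23 UV_sub by auto
  have nbB: "nb b p = p1" "nb b p1 = p" "nb b q = q1" "nb b q1 = q"
    using p1V gb(1) csysD(3)[OF cs b qV(1)] by (auto simp: p1_def q1_def bad_def)
  have nbD: "nb d p = p2" "nb d q = q2" "nb d p1 = p3" "nb d q1 = q3"
    using dx by (auto simp: p2_def q2_def p3_def q3_def bad_def)
  have nbD': "nb d p2 = p" "nb d q2 = q" "nb d p3 = p1" "nb d q3 = q1"
    using csysD(3)[OF cs C(3)] p qV p1V(1) nbD by auto
  have nbc0: "nb c0 p = q" "nb c0 p2 = q2" using c0 dc by (auto simp: bad_def p2_def q2_def)
  have nbc0': "nb c0 q = p" "nb c0 q2 = p2" using csysD(3)[OF cs C(1)] p V23(1) nbc0 by auto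
  have nbc1: "nb c1 p1 = q1" "nb c1 p3 = q3" using c1 dc by (auto simp: bad_def p3_def q3_def)
  have nbc1': "nb c1 q1 = p1" "nb c1 q3 = p3" using csysD(3)[OF cs C(2)] p1V(1) V23(3) nbc1 by auto
  have ncol: "d \<noteq> c0" "d \<noteq> c1" using d by auto
  have ncol2: "b \<noteq> c0" using nbB nbc0 gb(7) by auto
  have q1n: "q1 \<noteq> p" "q1 \<noteq> p1" "q1 \<noteq> q"
    using nbB gb csysD(2)[OF cs b qV(1)] p1V by auto
  have ncol3: "b \<noteq> c1" using nbB nbc1 q1n by auto
  have ds: "p \<noteq> q" "p \<noteq> p1" "p \<noteq> q1" "q \<noteq> p1" "q \<noteq> q1" "p1 \<noteq> q1"
    using gb p1V q1n by auto
  have ds2: "{p2, q2, p3, q3} \<inter> {p, q, p1, q1} = {}" "{p2, q2, p3, q3} \<inter> avV = {}"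
    using dx by (auto simp: p2_def q2_def p3_def q3_def)
  have ds3: "p2 \<noteq> q2" "p2 \<noteq> p3" "p2 \<noteq> q3" "q2 \<noteq> p3" "q2 \<noteq> q3" "p3 \<noteq> q3"
    using nbD' ds by auto
  define nb1 where "nb1 = kswap c0 d {p, q, p2, q2} nb"
  define nb2 where "nb2 = kswap c1 d {p1, q1, p3, q3} nb1"
  define nb3 where "nb3 = kswap b d {p, q, p1, q1} nb2"
  note distinct = ds ds[symmetric] ds2 ds3 ds3[symmetric] ncol ncol[symmetric] ncol2 ncol2[symmetric]
    ncol3 ncol3[symmetric] d(4) d(4)[symmetric]
  note vals = nbB nbD nbD' nbc0 nbc0' nbc1 nbc1'
  have nb1: "nb1 c0 p = p2" "nb1 c0 q = q2" "nb1 c0 p2 = p" "nb1 c0 q2 = q"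
      "nb1 d p = q" "nb1 d q = p" "nb1 d p2 = q2" "nb1 d q2 = p2"
    using distinct vals by (auto simp: nb1_def kswap_def)
  have nb1o: "nb1 k x = nb k x" if "x \<notin> {p, q, p2, q2} \<or> k \<notin> {c0, d}" for k x
    using that by (auto simp: nb1_def kswap_def)
  have o12: "p1 \<notin> {p, q, p2, q2}" "q1 \<notin> {p, q, p2, q2}" "p3 \<notin> {p, q, p2, q2}" "q3 \<notin> {p, q, p2, q2}"
    and o21: "p \<notin> {p1, q1, p3, q3}" "q \<notin> {p1, q1, p3, q3}" "p2 \<notin> {p1, q1, p3, q3}" "q2 \<notin> {p1, q1, p3, q3}"
    using distinct by auto
  have nb2o: "nb2 k x = nb1 k x" if "x \<notin> {p1, q1, p3, q3} \<or> k \<notin> {c1, d}" for k x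
    using that by (auto simp: nb2_def kswap_def)
  have nb2: "nb2 c1 p1 = p3" "nb2 c1 q1 = q3" "nb2 c1 p3 = p1" "nb2 c1 q3 = q1"
      "nb2 d p1 = q1" "nb2 d q1 = p1" "nb2 d p3 = q3" "nb2 d q3 = p3"
    using o12 ncol nb1o vals by (auto simp: nb2_def kswap_def)
  have nb2b: "nb2 b x = nb b x" for x using nb1o[of x b] nb2o[of x b] ncol2 ncol3 d(4) by auto
  have nb3o: "nb3 k x = nb2 k x" if "x \<notin> {p, q, p1, q1} \<or> k \<notin> {b, d}" for k x
    using that by (auto simp: nb3_def kswap_def)
  have nb3bd: "nb3 b x = nb2 d x" "nb3 d x = nb2 b x" if "x \<in> {p, q, p1, q1}" for x
    using that d(4) by (auto simp: nb3_def kswap_def)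
  have v1: "nb3 b p = q" "nb3 b q = p" "nb3 b p1 = q1" "nb3 b q1 = p1"
    using nb3bd nb2 nb2o o21 nb1 by auto
  have v2: "nb3 d p = p1" "nb3 d q = q1" "nb3 d p1 = p" "nb3 d q1 = q"
    using nb3bd nb2b nbB by auto
  have v3: "nb3 c0 p = p2" "nb3 c0 q = q2" "nb3 c0 p2 = p" "nb3 c0 q2 = q"
    using nb3o nb2o o21 nb1 ncol ncol2 by auto
  have v4: "nb3 c1 p1 = p3" "nb3 c1 q1 = q3" "nb3 c1 p3 = p1" "nb3 c1 q3 = q1"
    using nb3o nb2 ncol ncol3 by auto
  have in2: "p2 \<notin> {p, q, p1, q1}" "q2 \<notin> {p, q, p1, q1}" "p3 \<notin> {p, q, p1, q1}" "q3 \<notin> {p, q, p1, q1}"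
    using ds2(1) by auto
  have v5: "nb3 d p2 = q2" "nb3 d q2 = p2" "nb3 d p3 = q3" "nb3 d q3 = p3"
    using nb3o in2 nb2 nb2o o21 nb1 by auto
  \<comment> \<open>At most 20 incidences: the third exchange meets the first two in color
    \<open>d\<close> at \<open>p\<close>, \<open>q\<close>, \<open>p1\<close>, \<open>q1\<close>, so
    these vertices change in three colors each and the outer four in two.\<close>
  have changed: "(x, k) \<in> {p, q} \<times> {b, d, c0} \<union> {p1, q1} \<times> {b, d, c1} \<union> {p2, q2} \<times> {c0, d} \<union> {p3, q3} \<times> {c1, d}"
    if ch: "nb3 k x \<noteq> nb k x" for x k
  proof -
    have "x \<in> {p, q, p2, q2} \<and> k \<in> {c0, d} \<or> x \<in> {p1, q1, p3, q3} \<and> k \<in> {c1, d} \<or> x \<in> {p, q, p1, q1} \<and> k \<in> {b, d}"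
      using ch nb1o[of x k] nb2o[of x k] nb3o[of x k] by metis
    then show ?thesis by auto
  qed
  have nbad: "\<not> bad nb q b" "\<not> bad nb q1 b" "\<not> bad nb p c0" "\<not> bad nb q c0" "\<not> bad nb p1 c1" "\<not> bad nb q1 c1"
    "\<not> bad nb p d" "\<not> bad nb q d" "\<not> bad nb p1 d" "\<not> bad nb q1 d"
    "\<not> bad nb p2 d" "\<not> bad nb q2 d" "\<not> bad nb p3 d" "\<not> bad nb q3 d"
    "\<not> bad nb p2 c0" "\<not> bad nb q2 c0" "\<not> bad nb p3 c1" "\<not> bad nb q3 c1"
  proof -
    note s = bad_sym[OF cs]
    show "\<not> bad nb q b" "\<not> bad nb p c0" "\<not> bad nb p1 c1" by fact+
    show "\<not> bad nb q1 b" using s[OF qV(1) b gb(1)] by (simp add: q1_def)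
    show "\<not> bad nb q c0" using s[OF p C(1) c0(3)] c0(2) by simp
    show "\<not> bad nb q1 c1" using s[OF p1V(1) C(2) c1(3)] c1(2) by simp
    show D: "\<not> bad nb p d" "\<not> bad nb q d" "\<not> bad nb p1 d" "\<not> bad nb q1 d" using dx by auto
    show "\<not> bad nb p2 d" using s[OF p C(3) D(1)] by (simp add: p2_def)
    show "\<not> bad nb q2 d" using s[OF qV(1) C(3) D(2)] by (simp add: q2_def)
    show "\<not> bad nb p3 d" using s[OF p1V(1) C(3) D(3)] by (simp add: p3_def)
    show "\<not> bad nb q3 d" using s[OF qV(2) C(3) D(4)] by (simp add: q3_def)
    show E: "\<not> bad nb p2 c0" "\<not> bad nb p3 c1" using dc by (auto simp: p2_def p3_def)
    show "\<not> bad nb q2 c0" using s[OF V23(1) C(1) E(1)] dc by (simp add: p2_def q2_def)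
    show "\<not> bad nb q3 c1" using s[OF V23(3) C(2) E(2)] dc by (simp add: p3_def q3_def)
  qed
  have dP: "{p, q} \<notin> dP" "{p1, q1} \<notin> dP"
    using c0 c1 by (auto simp: bad_def)
  note L = gb(2,3) dL[folded p2_def q2_def p3_def q3_def]
  have L': "b \<notin> L {q, p}" "b \<notin> L {q1, p1}" "d \<notin> L {p1, p}" "d \<notin> L {q1, q}" "c0 \<notin> L {p2, p}"
    "c0 \<notin> L {q2, q}" "c1 \<notin> L {p3, p1}" "c1 \<notin> L {q3, q1}" "d \<notin> L {q2, p2}" "d \<notin> L {q3, p3}"
    and dP': "{q, p} \<notin> dP" "{q1, p1} \<notin> dP"
    using L dP by (simp_all add: insert_commute)
  note pdv = gb(4,5) dp[folded p2_def p3_def]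
  have out: "q \<notin> {p, p1}" "q1 \<notin> {p, p1}" "p2 \<notin> {p, p1}" "q2 \<notin> {p, p1}" "p3 \<notin> {p, p1}" "q3 \<notin> {p, p1}"
    using distinct by auto
  have cln: "clean nb nb3 p p1 b x k" if "nb3 k x \<noteq> nb k x" for x k
  proof -
    note u = c0(1) c1(1) d(1)
    have "clean nb nb3 p p1 b p b" "clean nb nb3 p p1 b q b" "clean nb nb3 p p1 b p1 b" "clean nb nb3 p p1 b q1 b"
      "clean nb nb3 p p1 b p d" "clean nb nb3 p p1 b q d" "clean nb nb3 p p1 b p1 d" "clean nb nb3 p p1 b q1 d"
      "clean nb nb3 p p1 b p c0" "clean nb nb3 p p1 b q c0" "clean nb nb3 p p1 b p2 c0" "clean nb nb3 p p1 b q2 c0"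
      "clean nb nb3 p p1 b p1 c1" "clean nb nb3 p p1 b q1 c1" "clean nb nb3 p p1 b p3 c1" "clean nb nb3 p p1 b q3 c1"
      "clean nb nb3 p p1 b p2 d" "clean nb nb3 p p1 b q2 d" "clean nb nb3 p p1 b p3 d" "clean nb nb3 p p1 b q3 d"
      unfolding clean_def v1 v2 v3 v4 v5
      using nbad L L' dP dP' pdv out u by blast+
    then show ?thesis using changed[OF that] by blast
  qed
  have sw: "swaps ({p, p1} \<union> UV) (UC \<union> {b}) 3 nb nb3"
  proof -
    have c4: "card {x, y, z, w} \<le> 4" for x y z w :: 'v by (simp add: card_insert_if)
    have "swaps ({p, p1} \<union> UV) (UC \<union> {b}) (Suc 0) nb nb1"
      unfolding nb1_def by (rule swaps.intros(2)[OF swaps.intros(1)]) (use vals gUV UV23 c0 d c4 in auto)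
    then have "swaps ({p, p1} \<union> UV) (UC \<union> {b}) (Suc (Suc 0)) nb nb2"
      unfolding nb2_def by (rule swaps.intros(2)) (use o12 nb1o vals gUV UV23 c1 d c4 in auto)
    then have "swaps ({p, p1} \<union> UV) (UC \<union> {b}) (Suc (Suc (Suc 0))) nb nb3"
      unfolding nb3_def by (rule swaps.intros(2)) (use o21 nb1 nb2 nb2b nb2o vals gUV d c4 in auto)
    then show ?thesis by (simp add: numeral_3_eq_3)
  qed
  show ?thesis
  proof (rule that[of nb3])
    show "swaps ({p, nb b p} \<union> UV) (UC \<union> {b}) 3 nb nb3" using sw by (simp add: p1_def)
    show "nb3 b p = q" by (rule v1(1))
    show "clean nb nb3 p (nb b p) b x k" if "nb3 k x \<noteq> nb k x" for x k
      using cln[OF that] by (simp add: p1_def)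
    show "nb3 k x = nb k x" if "x \<in> avV" "x \<notin> {p, nb b p, q, nb0 b q}" for x k
      using changed[of k x] that ds2(2) by (auto simp: p1_def[symmetric] q1_def[symmetric])
    show "nb3 k p = nb k p" if "k \<in> avC" "k \<noteq> b" "nb k p \<noteq> q" for k
    proof (rule ccontr)
      assume "nb3 k p \<noteq> nb k p"
      from changed[OF this] show False using distinct that d(5) nbc0 by auto
    qed
    show "nb3 k q = nb k q" if "k \<in> avC" "k \<noteq> b" "nb k q \<noteq> p" for k
    proof (rule ccontr)
      assume "nb3 k q \<noteq> nb k q"
      from changed[OF this] show False using distinct that d(5) nbc0' by auto
    qed
  qed
qed

end

section \<open>Recoloring one edge\<close>

lemma ex_less4_notin:
  assumes "card F \<le> 3" "finite F"
  shows "\<exists>j<4::nat. j \<notin> F"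
proof (rule ccontr)
  assume "\<not> ?thesis"
  then have "{..<4} \<subseteq> F" by auto
  from card_mono[OF assms(2) this] show False using assms(1) by simp
qed

lemma xor_cancel: "xor (a::nat) b = c \<Longrightarrow> b = xor a c"
  by (metis xor.assoc xor_self_eq xor.left_neutral)

context switching
begin

definition calm :: "('c \<Rightarrow> 'v \<Rightarrow> 'v) \<Rightarrow> bool" where
  "calm nb \<longleftrightarrow> csys V C nb \<and> (\<forall>x\<in>V. real (card {k\<in>C. bad nb x k}) \<le> r)
     \<and> (\<forall>k\<in>C. real (card {x\<in>V. bad nb x k}) \<le> r)"

text \<open>Ten exchanges change at most 20 colors at a vertex and 40 vertices in a color, far less
  than the gap of \<open>r\<close> between \<open>calm\<close> and \<open>tame\<close>. So the
  counting lemmas stay available throughout one recoloring.\<close>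

lemma tame_swaps:
  assumes calm: "calm nb" and sw: "swaps VS CS n nb nb'" and n: "n \<le> 10" and CS: "CS \<subseteq> C"
  shows "tame nb'"
  unfolding tame_def
proof (intro conjI ballI)
  note ch = swaps_changed[OF sw]
  have fin1: "finite {k. nb' k x \<noteq> nb k x}" for x
    by (rule finite_subset[of _ "snd ` {(x, k). nb' k x \<noteq> nb k x}"]) (use ch in force)+
  have fin2: "finite {x. nb' k x \<noteq> nb k x}" for k
    by (rule finite_subset[of _ "fst ` {(x, k). nb' k x \<noteq> nb k x}"]) (use ch in force)+
  show "csys V C nb'" using swaps_csys[OF sw CS] calm by (simp add: calm_def)
  show "real (card {k\<in>C. bad nb' x k}) \<le> 2 * r" if "x \<in> V" for x
  proof (rule card_subset_real[of _ "{k\<in>C. bad nb x k} \<union> {k. nb' k x \<noteq> nb k x}"])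
    have "card {k. nb' k x \<noteq> nb k x} \<le> 2 * n" using ch by blast
    then have "real (card {k. nb' k x \<noteq> nb k x}) \<le> 20" using n by linarith
    then have "real (card ({k\<in>C. bad nb x k} \<union> {k. nb' k x \<noteq> nb k x})) \<le> r + 20"
      using calm that by (intro card_Un_real) (auto simp: calm_def)
    then show "real (card ({k\<in>C. bad nb x k} \<union> {k. nb' k x \<noteq> nb k x})) \<le> 2 * r" using r_big by simp
  qed (use finC fin1 in \<open>auto simp: bad_def\<close>)
  show "real (card {x\<in>V. bad nb' x k}) \<le> 2 * r" if "k \<in> C" for k
  proof (rule card_subset_real[of _ "{x\<in>V. bad nb x k} \<union> {x. nb' k x \<noteq> nb k x}"])
    have "card {x. nb' k x \<noteq> nb k x} \<le> 4 * n" using ch by blast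
    then have "real (card {x. nb' k x \<noteq> nb k x}) \<le> 40" using n by linarith
    then have "real (card ({x\<in>V. bad nb x k} \<union> {x. nb' k x \<noteq> nb k x})) \<le> r + 40"
      using calm that by (intro card_Un_real) (auto simp: calm_def)
    then show "real (card ({x\<in>V. bad nb x k} \<union> {x. nb' k x \<noteq> nb k x})) \<le> 2 * r" using r_big by simp
  qed (use finV fin2 in \<open>auto simp: bad_def\<close>)
qed

lemma quarter_pick:
  assumes j: "j < 4" and B: "{q\<in>V. Q q = j \<and> \<not> P q} \<subseteq> B" "finite B" "real (card B) \<le> 100 * r"
  obtains q where "q \<in> V" "Q q = j" "P q"
proof -
  have "40 \<le> real (card V)" using r r_big by simp
  then have "40 \<le> card V" by linarith
  from quarter_size[OF this j] have "real (card V) \<le> 5 * real (card {x\<in>V. Q x = j})" by linarith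
  moreover have "r > 0" using r_big by simp
  ultimately have "card B < card {x\<in>V. Q x = j}" using B(3) r by linarith
  then have "\<not> {x\<in>V. Q x = j} \<subseteq> B" using card_mono[OF B(2), of "{x\<in>V. Q x = j}"] by linarith
  then show ?thesis using that B(1) by blast
qed

lemma pick_first:
  assumes tame: "tame nb" and uv: "u \<in> V" "a \<in> C" "c \<in> C"
  obtains w where "good nb u c w" "\<not> bad nb w a" "nb0 a w \<in> UV" "a \<notin> L {u, w}" "\<not> pd w a"
proof -
  have cs: "csys V C nb" using tame by (simp add: tame_def)
  define u1 where "u1 = nb c u"
  have "card {Q u, xor (cl c) (Q u1)} \<le> 3" by (simp add: card_insert_if)
  then obtain j where j: "j < 4" "j \<noteq> Q u" "j \<noteq> xor (cl c) (Q u1)"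
    using ex_less4_notin[of "{Q u, xor (cl c) (Q u1)}"] by auto
  then have j': "xor (cl c) j \<noteq> Q u1" using xor_cancel by blast
  have eqUV: "{q\<in>V. q \<notin> UV} = V - UV" by auto
  have bc: "real (card {x\<in>V. bad nb x a}) \<le> 2 * r"
    using tame uv by (simp add: tame_def)
  have c5: "real (card {q\<in>V. nb0 a q \<notin> UV}) \<le> 2 * r"
    by (rule vertices_via[OF uv(2)]) (use UV_card eqUV in simp)
  let ?B = "{q\<in>V. Q q = j \<and> \<not> good nb u c q} \<union> {x\<in>V. bad nb x a} \<union> {q\<in>V. nb0 a q \<notin> UV}
    \<union> {y\<in>V. y \<noteq> u \<and> a \<in> L {u, y}} \<union> {x\<in>V. pd x a}"
  have "real (card ?B) \<le> 30 * r + 2 * r + 2 * r + r + r"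
    by (intro card_Un_real good_bound[OF tame uv(1,3) j(2) j'[unfolded u1_def]] bc c5
        L_vertex[OF uv(1,2)] pd_color[OF uv(2)])
  then have card: "real (card ?B) \<le> 100 * r" using r_big by simp
  have sub: "{q\<in>V. Q q = j \<and> \<not> (good nb u c q \<and> \<not> bad nb q a \<and> nb0 a q \<in> UV \<and> a \<notin> L {u, q} \<and> \<not> pd q a)} \<subseteq> ?B"
    using j(2) by auto
  obtain w where "good nb u c w \<and> \<not> bad nb w a \<and> nb0 a w \<in> UV \<and> a \<notin> L {u, w} \<and> \<not> pd w a"
    by (rule quarter_pick[OF j(1) sub _ card]) (use finV in auto)
  then show ?thesis using that by blast
qed

text \<open>Two instances of \<open>good\<close> impose four conditions on the block of
  \<open>z\<close>, one too many for four blocks. But the edge of color \<open>a\<close> at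
  \<open>w\<close> is not bad and shifts blocks by \<open>cl a\<close>, so both conditions from
  \<open>w\<close> amount to \<open>j \<noteq> Q w\<close>. Three forbidden blocks leave
  one.\<close>

lemma pick_second:
  assumes tame: "tame nb" and uv: "v \<in> V" "w \<in> V" "a \<in> C" "c \<in> C" "a \<noteq> c"
    and wa: "\<not> bad nb w a"
  obtains z where "good nb v c z" "good nb w a z" "\<not> pd z a" "a \<notin> L {v, z}" "c \<notin> L {w, z}"
    "nb0 c z \<noteq> w" "nb0 c z \<noteq> nb0 a w" "nb0 a z \<noteq> nb0 c z"
proof -
  have cs: "csys V C nb" using tame by (simp add: tame_def)
  define v1 where "v1 = nb c v"
  have w': "nb a w = nb0 a w" "Q (nb a w) = xor (cl a) (Q w)"
    using wa shift[OF uv(2,3)] by (auto simp: bad_def)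
  have w'V: "nb0 a w \<in> V" using csysD(1)[OF cs0 uv(3,2)] .
  let ?F = "{Q v, xor (cl c) (Q v1), Q w}"
  have "card ?F \<le> 3" by (simp add: card_insert_if)
  then obtain j where j: "j < 4" "j \<noteq> Q v" "j \<noteq> xor (cl c) (Q v1)" "j \<noteq> Q w"
    using ex_less4_notin[of ?F] by auto
  then have j': "xor (cl c) j \<noteq> Q v1" using xor_cancel by blast
  have j'': "xor (cl a) j \<noteq> Q (nb a w)"
  proof
    assume "xor (cl a) j = Q (nb a w)"
    then have "j = xor (cl a) (xor (cl a) (Q w))" using xor_cancel w'(2) by metis
    also have "\<dots> = Q w" using xor_cancel[of "cl a" "Q w"] by metis
    finally show False using j by simp
  qed
  \<comment> \<open>Excluding the vertices whose edge of color \<open>c\<close> is doubly covered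
    gives \<open>nb0 a z \<noteq> nb0 c z\<close>: the exchanges for \<open>v\<close> touch
    \<open>nb0 c z\<close> and must spare \<open>nb0 a z\<close>.\<close>
  let ?D = "{x\<in>V. \<exists>k'\<in>C. k' \<noteq> c \<and> nb0 k' x = nb0 c x}"
  have d1: "real (card ?D) \<le> 10" using dup[OF uv(4)] by linarith
  have d2: "real (card {q\<in>V. nb0 c q \<in> {w, nb0 a w}}) \<le> 2"
  proof -
    have "card ({w, nb0 a w} \<inter> V) \<le> 2"
      by (rule order_trans[OF card_mono[of "{w, nb0 a w}"]]) (auto simp: card_insert_if)
    then show ?thesis using card_vimage_nb_le[OF cs0 uv(4) finV, of "{w, nb0 a w}"] by linarith
  qed
  let ?B = "{q\<in>V. Q q = j \<and> \<not> good nb v c q} \<union> {q\<in>V. Q q = j \<and> \<not> good nb w a q} \<union> {x\<in>V. pd x a}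
    \<union> {y\<in>V. y \<noteq> v \<and> a \<in> L {v, y}} \<union> {y\<in>V. y \<noteq> w \<and> c \<in> L {w, y}} \<union> {q\<in>V. nb0 c q \<in> {w, nb0 a w}} \<union> ?D"
  have "real (card ?B) \<le> 30 * r + 30 * r + r + r + r + 2 + 10"
    by (intro card_Un_real good_bound[OF tame uv(1,4) j(2) j'[unfolded v1_def]]
        good_bound[OF tame uv(2,3) j(4) j''] L_vertex uv pd_color d1 d2)
  then have card: "real (card ?B) \<le> 100 * r" using r_big by simp
  have sub: "{q\<in>V. Q q = j \<and> \<not> (good nb v c q \<and> good nb w a q \<and> \<not> pd q a \<and> a \<notin> L {v, q} \<and> c \<notin> L {w, q}
     \<and> nb0 c q \<noteq> w \<and> nb0 c q \<noteq> nb0 a w \<and> nb0 a q \<noteq> nb0 c q)} \<subseteq> ?B"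
    using j(2,4) uv(3,5) by auto
  obtain z where "good nb v c z \<and> good nb w a z \<and> \<not> pd z a \<and> a \<notin> L {v, z} \<and> c \<notin> L {w, z}
     \<and> nb0 c z \<noteq> w \<and> nb0 c z \<noteq> nb0 a w \<and> nb0 a z \<noteq> nb0 c z"
    by (rule quarter_pick[OF j(1) sub _ card]) (use finV in auto)
  then show ?thesis using that by blast
qed

lemma good_notin_dP:
  assumes "good nb p b q"
  shows "{p, q} \<notin> dP"
  using assms by (auto simp: good_def bad_def)

text \<open>Three calls of \<open>make_color\<close> and one final exchange make 10. The difficulty
  is that each stage must preserve what the others rely on. At \<open>u\<close> and \<open>v\<close>
  the edges of color \<open>c\<close> are arbitrary; the third call starts at \<open>w\<close>,
  whose edge of color \<open>a\<close> is untouched, so it stays within \<open>UV\<close> and leaves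
  \<open>u\<close> and \<open>v\<close> alone.\<close>

lemma recolor_edge:
  assumes calm: "calm nb" and uv: "u \<in> V" "v \<in> V" "u \<noteq> v" and ac: "a \<in> C" "c \<in> C" "a \<noteq> c"
    and au: "nb a u = v" and cu: "nb c u \<noteq> v"
    and UVn: "UV \<inter> {u, v, nb c u, nb c v} = {}"
  obtains nb' where "swaps ({u, v, nb c u, nb c v} \<union> UV) (UC \<union> {a, c}) 10 nb nb'" "nb' c u = v"
    "\<And>x k. nb' k x \<noteq> nb k x \<Longrightarrow> {x, nb' k x} = {u, v} \<and> k = c \<or>
       k \<notin> L {x, nb' k x} \<and> (x \<in> {u, v, nb c u, nb c v} \<longrightarrow> \<not> pd (nb' k x) k) \<and> ({x, nb' k x} \<notin> dP \<or> k \<in> UC)"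
    "\<And>x k. nb' k x \<noteq> nb k x \<Longrightarrow> \<not> bad nb x k \<or> k = c \<and> x \<in> {u, v, nb c u, nb c v} \<or> k = a \<and> x \<in> {u, v}"
proof -
  have cs: "csys V C nb" using calm by (simp add: calm_def)
  define u1 where "u1 = nb c u"
  define v1 where "v1 = nb c v"
  have uV: "u1 \<in> V" "v1 \<in> V" "nb c u1 = u" "nb c v1 = v" "u1 \<noteq> u" "v1 \<noteq> v" "nb a v = u"
    using csysD[OF cs ac(2) uv(1)] csysD[OF cs ac(2) uv(2)] csysD[OF cs ac(1) uv(1)] au
    by (auto simp: u1_def v1_def)
  have u1n: "u1 \<noteq> v" "v1 \<noteq> u" "u1 \<noteq> v1" using cu uV uv(3) by (auto simp: u1_def v1_def)
  have nUV: "u \<notin> UV" "v \<notin> UV" "u1 \<notin> UV" "v1 \<notin> UV" using UVn by (auto simp: u1_def v1_def)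
  have CS: "UC \<union> {a} \<subseteq> C" "UC \<union> {c} \<subseteq> C" "UC \<union> {a, c} \<subseteq> C" using UC_sub ac by auto
  have tame: "tame nb" using tame_swaps[OF calm swaps.intros(1), of C] by simp
  obtain w where w: "good nb u c w" "\<not> bad nb w a" "nb0 a w \<in> UV" "a \<notin> L {u, w}" "\<not> pd w a"
    using pick_first[OF tame uv(1) ac(1,2)] by blast
  have wUV: "w \<in> UV" using w(1) by (simp add: good_def)
  have wV: "w \<in> V" using wUV UV_sub by auto
  have wn: "w \<noteq> u" "w \<noteq> v" "w \<noteq> u1" "w \<noteq> v1" using wUV nUV by auto
  define w' where "w' = nb0 a w"
  have w'UV: "w' \<in> UV" using w(3) by (simp add: w'_def)
  have nbaw: "nb a w = w'" using w(2) by (simp add: bad_def w'_def)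
  have w'bad: "\<not> bad nb w' a" using bad_sym[OF cs wV ac(1) w(2)] by (simp add: w'_def)
  \<comment> \<open>The color \<open>a\<close> is avoided so that \<open>u v\<close> and
    \<open>w w'\<close> keep it.\<close>
  obtain nbA where A: "swaps ({u, u1} \<union> UV) (UC \<union> {c}) 3 nb nbA" "nbA c u = w"
    and Acl: "\<And>x k. nbA k x \<noteq> nb k x \<Longrightarrow> clean nb nbA u u1 c x k"
    and Aa: "\<And>k. k \<in> {a} \<Longrightarrow> k \<noteq> c \<Longrightarrow> nb k u \<noteq> w \<Longrightarrow> nbA k u = nb k u"
    "\<And>k. k \<in> {a} \<Longrightarrow> k \<noteq> c \<Longrightarrow> nb k w \<noteq> u \<Longrightarrow> nbA k w = nb k w"
    using make_color[OF tame uv(1) ac(2) w(1), of "{}" "{a}"] unfolding u1_def by (metis finite.emptyI finite.insertI card.empty card_1_singleton_iff One_nat_def one_le_numeral zero_le)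
  have csA: "csys V C nbA" by (rule swaps_csys[OF A(1) CS(2) cs])
  have tameA: "tame nbA" by (rule tame_swaps[OF calm A(1) _ CS(2)]) simp
  have Av: "nbA k v = nb k v" "nbA k v1 = nb k v1" for k
    using swaps_unchanged[OF A(1)] u1n nUV uv(3) uV by auto
  have Aau: "nbA a u = v" using Aa(1)[of a] ac au wn by auto
  have Aaw: "nbA a w = w'"
  proof -
    have "nb a w \<noteq> u" using csys_eq_iff[OF cs ac(1) wV uv(1)] au wn by auto
    then show ?thesis using Aa(2)[of a] ac nbaw by auto
  qed
  have wbadA: "\<not> bad nbA w a" using w(2) Aaw nbaw by (simp add: bad_def)
  obtain z where z: "good nbA v c z" "good nbA w a z" "\<not> pd z a" "a \<notin> L {v, z}" "c \<notin> L {w, z}"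
    "nb0 c z \<noteq> w" "nb0 c z \<noteq> w'" "nb0 a z \<noteq> nb0 c z"
    using pick_second[OF tameA uv(2) wV ac(1,2,3) wbadA] unfolding w'_def by metis
  have zUV: "z \<in> UV" "nb0 a z \<in> UV" "z \<noteq> w" "z \<noteq> w'" using z(2) Aaw by (auto simp: good_def)
  have zV: "z \<in> V" using zUV UV_sub by auto
  have zn: "z \<noteq> u" "z \<noteq> v" "z \<noteq> u1" "z \<noteq> v1" using zUV nUV by auto
  have z'z: "nb0 a z \<noteq> z" using csysD(2)[OF cs0 ac(1) zV] .
  have Acv: "nbA c v = v1" using Av by (simp add: v1_def)
  have av3: "finite {w, w', nb0 a z}" "card {w, w', nb0 a z} \<le> 20"
    "finite {a}" "card {a} \<le> 20" by (auto simp: card_insert_if)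
  \<comment> \<open>The protected vertices are \<open>w\<close> and those on which the suitability
    of \<open>z\<close> for \<open>w\<close> depends.\<close>
  obtain nbB where B: "swaps ({v, v1} \<union> UV) (UC \<union> {c}) 3 nbA nbB" "nbB c v = z"
    and Bcl: "\<And>x k. nbB k x \<noteq> nbA k x \<Longrightarrow> clean nbA nbB v v1 c x k"
    and Bav: "\<And>x k. x \<in> {w, w', nb0 a z} \<Longrightarrow> x \<notin> {v, v1, z, nb0 c z} \<Longrightarrow> nbB k x = nbA k x"
    using make_color[OF tameA uv(2) ac(2) z(1) av3] unfolding Acv by metis
  have csB: "csys V C nbB" by (rule swaps_csys[OF B(1) CS(2) csA])
  have AB: "swaps ({u, v, u1, v1} \<union> UV) (UC \<union> {a, c}) 6 nb nbB"
    using swaps_trans[OF swaps_mono[OF B(1), of "{u, v, u1, v1} \<union> UV" "UC \<union> {a, c}"]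
        swaps_mono[OF A(1), of "{u, v, u1, v1} \<union> UV" "UC \<union> {a, c}"]] by auto
  have tameB: "tame nbB" by (rule tame_swaps[OF calm AB _ CS(3)]) simp
  have Bw: "nbB k x = nbA k x" if "x \<in> {w, w', nb0 a z}" for x k
  proof (rule Bav[OF that])
    show "x \<notin> {v, v1, z, nb0 c z}"
      using that wn zUV z(6,7,8) w'UV nUV z'z by auto
  qed
  have Bu: "nbB k u = nbA k u" for k
    using swaps_unchanged[OF B(1)] u1n nUV uv(3) by auto
  have gB: "good nbB w a z"
    by (rule good_cong[OF csA csB wV ac(1) z(2)]) (use Bw Aaw in auto)
  have Baw: "nbB a w = w'" using Bw Aaw by auto
  have av0: "finite ({}::'v set)" "card ({}::'v set) \<le> 20" "finite ({}::'c set)" "card ({}::'c set) \<le> 20"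
    by auto
  obtain nbC where CC: "swaps ({w, w'} \<union> UV) (UC \<union> {a}) 3 nbB nbC" "nbC a w = z"
    and Ccl: "\<And>x k. nbC k x \<noteq> nbB k x \<Longrightarrow> clean nbB nbC w w' a x k"
    using make_color[OF tameB wV ac(1) gB av0] unfolding Baw by metis
  have CC': "swaps UV (UC \<union> {a}) 3 nbB nbC"
    using CC(1) wUV w'UV by (simp add: insert_absorb)
  have csC: "csys V C nbC" by (rule swaps_csys[OF CC(1) CS(1) csB])
  have Cuv: "nbC k u = nbB k u" "nbC k v = nbB k v" for k
    using swaps_unchanged[OF CC'] nUV by auto
  have nC: "nbC a u = v" "nbC c u = w" "nbC c v = z" "nbC a w = z"
    using Cuv Bu Aau A(2) B(2) CC(2) by auto
  have nC': "nbC a v = u" "nbC c w = u" "nbC c z = v" "nbC a z = w"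
    using csysD(3)[OF csC ac(1) uv(1)] csysD(3)[OF csC ac(2) uv(1)] csysD(3)[OF csC ac(2) uv(2)]
      csysD(3)[OF csC ac(1) wV] nC by auto
  define S where "S = {u, v, z, w}"
  define nb' where "nb' = kswap a c S nbC"
  have nb': "nb' c u = v" "nb' a u = w" "nb' c v = u" "nb' a v = z" "nb' c w = z" "nb' a w = u"
    "nb' c z = w" "nb' a z = v"
    using nC nC' ac(3) by (auto simp: nb'_def kswap_def S_def)
  have nb'o: "x \<in> S \<and> k \<in> {a, c}" if "nb' k x \<noteq> nbC k x" for x k
    using that by (auto simp: nb'_def kswap_def split: if_splits)
  have sw: "swaps ({u, v, u1, v1} \<union> UV) (UC \<union> {a, c}) 10 nb nb'"
  proof -
    have "swaps ({u, v, u1, v1} \<union> UV) (UC \<union> {a, c}) 9 nb nbC"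
      using swaps_trans[OF swaps_mono[OF CC', of "{u, v, u1, v1} \<union> UV" "UC \<union> {a, c}"] AB] by auto
    then have "swaps ({u, v, u1, v1} \<union> UV) (UC \<union> {a, c}) (Suc 9) nb nb'"
      unfolding nb'_def
      by (rule swaps.intros(2)) (use nC nC' wUV zUV in \<open>auto simp: S_def card_insert_if\<close>)
    then show ?thesis by simp
  qed
  have nd: "{u, w} \<notin> dP" "{v, z} \<notin> dP" "{w, z} \<notin> dP"
    using good_notin_dP[OF w(1)] good_notin_dP[OF z(1)] good_notin_dP[OF z(2)] .
  \<comment> \<open>A statement about final edges, so the case distinction is by the last stage that
    changed the incidence.\<close>
  have R: "{x, nb' k x} = {u, v} \<and> k = c \<or>
       k \<notin> L {x, nb' k x} \<and> (x \<in> {u, v, u1, v1} \<longrightarrow> \<not> pd (nb' k x) k) \<and> ({x, nb' k x} \<notin> dP \<or> k \<in> UC)"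
    if ch: "nb' k x \<noteq> nb k x" for x k
  proof (cases "nb' k x = nbC k x")
    case False
    have "w \<notin> {u, v, u1, v1}" "z \<notin> {u, v, u1, v1}" using wn zn by auto
    then show ?thesis using nb'o[OF False] nb' w(4,5) z(3,4,5) nd unfolding S_def
      by (auto simp: insert_commute)
  next
    case True
    consider "nbC k x \<noteq> nbB k x" | "nbC k x = nbB k x" "nbB k x \<noteq> nbA k x"
      | "nbC k x = nbA k x" "nbA k x \<noteq> nb k x" using ch True by metis
    then show ?thesis
    proof cases
      case 1
      then have "x \<notin> {u, v, u1, v1}" using swaps_unchanged[OF CC', of x k] nUV by auto
      then show ?thesis using Ccl[OF 1] True unfolding clean_def by metis
    next
      case 2
      then have "x \<in> {v, v1} \<union> UV" using swaps_unchanged[OF B(1), of x k] by auto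
      then have "x \<in> {u, v, u1, v1} \<longrightarrow> x \<in> {v, v1}" using nUV by auto
      then show ?thesis using Bcl[OF 2(2)] True 2(1) unfolding clean_def by metis
    next
      case 3
      then have "x \<in> {u, u1} \<union> UV" using swaps_unchanged[OF A(1), of x k] by auto
      then have "x \<in> {u, v, u1, v1} \<longrightarrow> x \<in> {u, u1}" using nUV by auto
      then show ?thesis using Acl[OF 3(2)] True 3(1) unfolding clean_def by metis
    qed
  qed
  \<comment> \<open>A statement about original edges, so the case distinction is by the first stage
    that changed the incidence. One changed by the final exchange alone must be at \<open>u\<close>
    or \<open>v\<close>, because the incidences at \<open>w\<close> and \<open>z\<close> in that
    cycle were created by the preceding stages.\<close>
  have Bd: "\<not> bad nb x k \<or> k = c \<and> x \<in> {u, v, u1, v1} \<or> k = a \<and> x \<in> {u, v}"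
    if ch: "nb' k x \<noteq> nb k x" for x k
  proof -
    consider "nbA k x \<noteq> nb k x" | "nbA k x = nb k x" "nbB k x \<noteq> nbA k x"
      | "nbA k x = nb k x" "nbB k x = nb k x" "nbC k x \<noteq> nbB k x"
      | "nbC k x = nb k x" "nb' k x \<noteq> nbC k x" using ch by metis
    then show ?thesis
    proof cases
      case 1
      then show ?thesis using Acl[OF 1] unfolding clean_def by blast
    next
      case 2
      then have "bad nbA x k = bad nb x k" by (simp add: bad_def)
      then show ?thesis using Bcl[OF 2(2)] unfolding clean_def by blast
    next
      case 3
      then have "bad nbB x k = bad nb x k" by (simp add: bad_def)
      then show ?thesis using Ccl[OF 3(3)] w(2) w'bad unfolding clean_def by blast
    next
      case 4
      have e: "nb k x = nbC k x" using 4 by simp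
      have x: "x \<in> {u, v, z, w}" "k \<in> {a, c}" using nb'o[OF 4(2)] by (auto simp: S_def)
      have "\<not> (x = w \<and> k = c)" using e nC' csys_eq_iff[OF cs ac(2) wV uv(1)] wn by (auto simp: u1_def)
      moreover have "\<not> (x = w \<and> k = a)" using e nC nbaw zUV by auto
      moreover have "\<not> (x = z \<and> k = a)" using e nC' csys_eq_iff[OF cs ac(1) zV wV] nbaw zUV by auto
      moreover have "\<not> (x = z \<and> k = c)" using e nC' csys_eq_iff[OF cs ac(2) zV uv(2)] zn by (auto simp: v1_def)
      ultimately show ?thesis using x by auto
    qed
  qed
  show ?thesis
    using that[of nb'] sw nb'(1) R Bd unfolding u1_def v1_def by blast
qed

end

section \<open>Completing a precoloring\<close>

lemma double_count:
  assumes "finite A" "finite B"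
  shows "(\<Sum>x\<in>A. card {y\<in>B. R x y}) = (\<Sum>y\<in>B. card {x\<in>A. R x y})"
proof -
  have 1: "card {y\<in>B. R x y} = (\<Sum>y\<in>B. if R x y then 1 else 0)" for x
    by (subst sum.inter_filter[OF assms(2), symmetric]) simp
  have 2: "card {x\<in>A. R x y} = (\<Sum>x\<in>A. if R x y then 1 else 0)" for y
    by (subst sum.inter_filter[OF assms(1), symmetric]) simp
  show ?thesis unfolding 1 2 by (rule sum.swap)
qed

text \<open>Markov's inequality in counting form.\<close>

lemma card_large_le:
  fixes f :: "'a \<Rightarrow> real"
  assumes "finite A" "\<And>x. x \<in> A \<Longrightarrow> 0 \<le> f x" "sum f A \<le> M" "t > 0"
  shows "real (card {x\<in>A. f x > t}) \<le> M / t"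
proof -
  have "real (card {x\<in>A. f x > t}) * t = (\<Sum>x\<in>{x\<in>A. f x > t}. t)" by simp
  also have "\<dots> \<le> (\<Sum>x\<in>{x\<in>A. f x > t}. f x)" by (rule sum_mono) auto
  also have "\<dots> \<le> sum f A" using assms(1,2) by (intro sum_mono2) auto
  finally show ?thesis using assms(3,4) by (simp add: pos_le_divide_eq)
qed

text \<open>\<open>r\<close> is the damage tolerated at a vertex or in a color, \<open>s\<close> the
  much smaller amount present at the start. \<open>P_load\<close> concerns vertices that are not
  ends of a precolored edge but neighbors, in its prescribed color, of such an end: fixing that edge
  changes them too. \<open>P_conflict\<close> says that every base edge with a forbidden color is
  already precolored.\<close>

locale precolored = sbase V C nb0 Q cl X
  for V :: "'v set" and C :: "'c set" and nb0 Q cl X +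
  fixes L :: "'v set \<Rightarrow> 'c set" and P :: "'v set \<rightharpoonup> 'c" and r s :: real
  assumes r: "real (card V) = 1000 * r" and r_big: "r \<ge> 10 ^ 6"
    and s: "s = r / 10 ^ 7" and s_big: "s \<ge> 11"
    and P_dom: "e \<in> dom P \<Longrightarrow> \<exists>x\<in>V. \<exists>y\<in>V. x \<noteq> y \<and> e = {x, y}"
    and P_C: "P e = Some c \<Longrightarrow> c \<in> C"
    and P_proper: "P e = Some c \<Longrightarrow> P e' = Some c \<Longrightarrow> x \<in> e \<Longrightarrow> x \<in> e' \<Longrightarrow> e = e'"
    and P_L: "P e = Some c \<Longrightarrow> c \<notin> L e"
    and L_edge_s: "x \<in> V \<Longrightarrow> y \<in> V \<Longrightarrow> x \<noteq> y \<Longrightarrow> real (card {k\<in>C. k \<in> L {x, y}}) \<le> s"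
    and L_vertex_s: "x \<in> V \<Longrightarrow> k \<in> C \<Longrightarrow> real (card {y\<in>V. y \<noteq> x \<and> k \<in> L {x, y}}) \<le> s"
    and P_vertex: "x \<in> V \<Longrightarrow> real (card {e\<in>dom P. x \<in> e}) \<le> s"
    and P_color: "k \<in> C \<Longrightarrow> real (card {e\<in>dom P. P e = Some k}) \<le> s"
    and P_load: "y \<in> V \<Longrightarrow> real (card {k\<in>C. \<exists>e\<in>dom P. nb0 k y \<in> e \<and> P e = Some k}) \<le> s"
    and P_class: "k \<in> C \<Longrightarrow> real (card {x\<in>V. {x, nb0 k x} \<in> dom P}) \<le> s"
    and P_conflict: "x \<in> V \<Longrightarrow> k \<in> C \<Longrightarrow> k \<in> L {x, nb0 k x} \<Longrightarrow> {x, nb0 k x} \<in> dom P"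
begin

definition pd :: "'v set set \<Rightarrow> 'v \<Rightarrow> 'c \<Rightarrow> bool" where
  "pd E x k \<longleftrightarrow> (\<exists>e\<in>E. x \<in> e \<and> P e = Some k)"

definition wrong :: "('c \<Rightarrow> 'v \<Rightarrow> 'v) \<Rightarrow> 'v \<Rightarrow> 'c \<Rightarrow> bool" where
  "wrong nb x k \<longleftrightarrow> (x, k) \<in> X \<or> {x, nb0 k x} \<in> dom P \<or> nb k x \<noteq> nb0 k x"

text \<open>The four counters correspond to the roles in one recoloring from \<open>a\<close> to
  \<open>c\<close>: an end of the edge (\<open>own\<close>), a \<open>c\<close>-neighbor of an end
  (\<open>load\<close>), the new color \<open>c\<close> (\<open>target\<close>) and the old color
  \<open>a\<close> (\<open>current\<close>, counted at both ends).\<close>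

definition own :: "'v set set \<Rightarrow> 'v \<Rightarrow> nat" where
  "own E x = card {e\<in>E. x \<in> e}"
definition load :: "'v set set \<Rightarrow> ('c \<Rightarrow> 'v \<Rightarrow> 'v) \<Rightarrow> 'v \<Rightarrow> nat" where
  "load E nb y = card {k\<in>C. pd E (nb k y) k}"
definition target :: "'v set set \<Rightarrow> 'c \<Rightarrow> nat" where
  "target E k = card {e\<in>E. P e = Some k}"
definition current :: "'v set set \<Rightarrow> ('c \<Rightarrow> 'v \<Rightarrow> 'v) \<Rightarrow> 'c \<Rightarrow> nat" where
  "current E nb k = card {x\<in>V. {x, nb k x} \<in> E}"

text \<open>The potentials bound how often a vertex or a color can be touched in the remaining
  process: every pending edge that forces a change at \<open>x\<close> has already been paid for.\<close>

definition pot_v :: "'v set set \<Rightarrow> ('c \<Rightarrow> 'v \<Rightarrow> 'v) \<Rightarrow> 'v \<Rightarrow> real" where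
  "pot_v E nb x = real (card {k\<in>C. wrong nb x k} + 40 * (own E x + load E nb x))"

definition pot_c :: "'v set set \<Rightarrow> ('c \<Rightarrow> 'v \<Rightarrow> 'v) \<Rightarrow> 'c \<Rightarrow> real" where
  "pot_c E nb k = real (card {x\<in>V. wrong nb x k} + 80 * (target E k + current E nb k))"

text \<open>Precolored edges are exempt from the clause on lists, since a pending edge may still
  carry a forbidden color. The last clause is a global budget: a recoloring damages at most
  \<open>8 * 10\<close> incidences, which is the weight 80 of the edge it settles. Its bound is the
  initial value, at most 2000 r s of damage plus 80 times 1000 r s for the edges.\<close>

definition state_ok :: "'v set set \<Rightarrow> ('c \<Rightarrow> 'v \<Rightarrow> 'v) \<Rightarrow> bool" where
  "state_ok E nb \<longleftrightarrow> csys V C nb \<and> E \<subseteq> dom P \<and>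
     (\<forall>x\<in>V. \<forall>y\<in>V. {x, y} \<in> dom P - E \<longrightarrow> nb (the (P {x, y})) x = y) \<and>
     (\<forall>x\<in>V. \<forall>k\<in>C. {x, nb k x} \<notin> dom P \<longrightarrow> k \<notin> L {x, nb k x}) \<and>
     (\<forall>x\<in>V. pot_v E nb x \<le> r) \<and> (\<forall>k\<in>C. pot_c E nb k \<le> r) \<and>
     real ((\<Sum>x\<in>V. card {k\<in>C. wrong nb x k}) + 80 * card E) \<le> 82000 * r * s"

lemma rs_pos: "r > 0" "s > 0" using r_big s_big by simp_all

lemma dom_fin: "finite (dom P)"
proof (rule finite_subset)
  show "dom P \<subseteq> Pow V" using P_dom by blast
qed (use finV in simp)

text \<open>For fixed \<open>d\<close>, the color \<open>d\<close> is forbidden on at most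
  \<open>s\<close> edges at \<open>nb0 d x\<close>. Summing over \<open>d\<close> bounds the total
  over \<open>y\<close> by 1000 r s, and Markov's inequality leaves at most 1000 s exceptional
  \<open>y\<close>.\<close>

lemma few_bound:
  assumes x: "x \<in> V"
  shows "real (card {y\<in>V. y \<noteq> x \<and> \<not> real (card {d\<in>C. d \<in> L {nb0 d x, nb0 d y}}) \<le> r}) \<le> r"
proof -
  let ?f = "\<lambda>y. real (card {d\<in>C. d \<in> L {nb0 d x, nb0 d y}})"
  have "(\<Sum>y\<in>V - {x}. card {d\<in>C. d \<in> L {nb0 d x, nb0 d y}})
      = (\<Sum>d\<in>C. card {y\<in>V - {x}. d \<in> L {nb0 d x, nb0 d y}})"
    by (rule double_count) (use finV finC in auto)
  then have "(\<Sum>y\<in>V - {x}. ?f y) = (\<Sum>d\<in>C. real (card {y\<in>V - {x}. d \<in> L {nb0 d x, nb0 d y}}))"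
    by (simp flip: of_nat_sum)
  also have "\<dots> \<le> (\<Sum>d\<in>C. s)"
  proof (rule sum_mono)
    fix d assume d: "d \<in> C"
    have "{y\<in>V - {x}. d \<in> L {nb0 d x, nb0 d y}}
      \<subseteq> {y\<in>V. nb0 d y \<in> {z\<in>V. z \<noteq> nb0 d x \<and> d \<in> L {nb0 d x, z}}}"
      using csysD[OF cs0 d] x by (auto; metis)
    then have "card {y\<in>V - {x}. d \<in> L {nb0 d x, nb0 d y}}
      \<le> card {y\<in>V. nb0 d y \<in> {z\<in>V. z \<noteq> nb0 d x \<and> d \<in> L {nb0 d x, z}}}"
      using finV by (intro card_mono) auto
    also have "\<dots> \<le> card ({z\<in>V. z \<noteq> nb0 d x \<and> d \<in> L {nb0 d x, z}} \<inter> V)"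
      by (rule card_vimage_nb_le[OF cs0 d finV])
    also have "{z\<in>V. z \<noteq> nb0 d x \<and> d \<in> L {nb0 d x, z}} \<inter> V = {z\<in>V. z \<noteq> nb0 d x \<and> d \<in> L {nb0 d x, z}}"
      by auto
    finally show "real (card {y\<in>V - {x}. d \<in> L {nb0 d x, nb0 d y}}) \<le> s"
      using L_vertex_s[OF csysD(1)[OF cs0 d x] d] by linarith
  qed
  also have "\<dots> = real (card C) * s" by simp
  also have "\<dots> \<le> 1000 * r * s" using cardC r rs_pos by (intro mult_right_mono) auto
  finally have "real (card {y\<in>V - {x}. ?f y > r}) \<le> 1000 * r * s / r"
    using finV rs_pos by (intro card_large_le) auto
  moreover have "{y\<in>V - {x}. ?f y > r} = {y\<in>V. y \<noteq> x \<and> \<not> ?f y \<le> r}" by auto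
  moreover have "1000 * r * s / r \<le> r" using rs_pos s by simp
  ultimately show ?thesis by simp
qed

lemma card_pd_le:
  assumes "finite E" "E \<subseteq> dom P"
  shows "card {k\<in>C. pd E x k} \<le> own E x"
proof -
  have "{k\<in>C. pd E x k} \<subseteq> (\<lambda>e. the (P e)) ` {e\<in>E. x \<in> e}" by (force simp: pd_def)
  then show ?thesis unfolding own_def using assms(1) by (intro surj_card_le) auto
qed

lemma card_edge: "e \<in> dom P \<Longrightarrow> card {x\<in>V. x \<in> e} \<le> 2"
proof -
  assume "e \<in> dom P"
  then obtain x y where "e = {x, y}" using P_dom by blast
  then have "card {x\<in>V. x \<in> e} \<le> card {x, y}" by (intro card_mono) auto
  also have "\<dots> \<le> 2" by (simp add: card_insert_if)
  finally show ?thesis .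
qed

lemma sum_own:
  assumes "E \<subseteq> dom P"
  shows "(\<Sum>x\<in>V. own E x) \<le> 2 * card E"
proof -
  have fE: "finite E" using assms dom_fin by (rule finite_subset)
  have "(\<Sum>x\<in>V. own E x) = (\<Sum>e\<in>E. card {x\<in>V. x \<in> e})"
    unfolding own_def by (rule double_count[OF finV fE])
  also have "\<dots> \<le> (\<Sum>e\<in>E. 2)" using assms card_edge by (intro sum_mono) auto
  finally show ?thesis by simp
qed

lemma sum_load:
  assumes "E \<subseteq> dom P" "csys V C nb"
  shows "(\<Sum>y\<in>V. load E nb y) \<le> 2 * card E"
proof -
  have fE: "finite E" using assms(1) dom_fin by (rule finite_subset)
  have "(\<Sum>y\<in>V. load E nb y) = (\<Sum>k\<in>C. card {y\<in>V. pd E (nb k y) k})"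
    unfolding load_def by (rule double_count[OF finV finC])
  also have "\<dots> \<le> (\<Sum>k\<in>C. card {x\<in>V. pd E x k})"
  proof (rule sum_mono)
    fix k assume k: "k \<in> C"
    have "{y\<in>V. pd E (nb k y) k} = {y\<in>V. nb k y \<in> {x\<in>V. pd E x k}}"
      using csysD(1)[OF assms(2) k] by auto
    then show "card {y\<in>V. pd E (nb k y) k} \<le> card {x\<in>V. pd E x k}"
      using card_vimage_nb_le[OF assms(2) k finV, of "{x\<in>V. pd E x k}"] by (simp add: Int_absorb2)
  qed
  also have "\<dots> = (\<Sum>x\<in>V. card {k\<in>C. pd E x k})" by (rule double_count[OF finC finV])
  also have "\<dots> \<le> (\<Sum>x\<in>V. own E x)" using card_pd_le[OF fE assms(1)] by (intro sum_mono) auto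
  finally show ?thesis using sum_own[OF assms(1)] by linarith
qed

lemma sum_target:
  assumes "E \<subseteq> dom P"
  shows "(\<Sum>k\<in>C. target E k) \<le> card E"
proof -
  have fE: "finite E" using assms dom_fin by (rule finite_subset)
  have "(\<Sum>k\<in>C. target E k) = (\<Sum>e\<in>E. card {k\<in>C. P e = Some k})"
    unfolding target_def by (rule double_count[OF finC fE])
  also have "\<dots> \<le> (\<Sum>e\<in>E. 1)"
  proof (rule sum_mono)
    fix e
    have "card {k\<in>C. P e = Some k} \<le> card {the (P e)}" by (intro card_mono) auto
    then show "card {k\<in>C. P e = Some k} \<le> 1" by simp
  qed
  finally show ?thesis by simp
qed

text \<open>One factor 2 comes from the two ends of an edge, the other from pairs covered by two
  colors.\<close>

lemma sum_current:
  assumes "E \<subseteq> dom P" "csys V C nb"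
  shows "(\<Sum>k\<in>C. current E nb k) \<le> 4 * card E"
proof -
  have fE: "finite E" using assms(1) dom_fin by (rule finite_subset)
  have "(\<Sum>k\<in>C. current E nb k) = (\<Sum>x\<in>V. card {k\<in>C. {x, nb k x} \<in> E})"
    unfolding current_def by (rule double_count[OF finC finV])
  also have "\<dots> \<le> (\<Sum>x\<in>V. 2 * own E x)"
  proof (rule sum_mono)
    fix x assume x: "x \<in> V"
    let ?B = "{y\<in>V. {x, y} \<in> E}"
    have eq: "{k\<in>C. {x, nb k x} \<in> E} = {k\<in>C. nb k x \<in> ?B}"
      using csysD(1)[OF assms(2) _ x] by auto
    have B: "card ?B \<le> own E x"
      unfolding own_def by (rule card_inj_on_le[of "\<lambda>y. {x, y}"]) (use fE in \<open>auto simp: inj_on_def doubleton_eq_iff\<close>)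
    show "card {k\<in>C. {x, nb k x} \<in> E} \<le> 2 * own E x"
    \<comment> \<open>The additive error 1 from a doubly covered pair is absorbed by doubling only
      when the set is nonempty.\<close>
    proof (cases "?B = {}")
      case True
      then have "{k\<in>C. nb k x \<in> ?B} = {}" by blast
      then show ?thesis unfolding eq by (metis card.empty zero_le)
    next
      case False
      then have "card ?B \<ge> 1" using finV by (simp add: Suc_le_eq card_gt_0_iff)
      moreover have "card {k\<in>C. nb k x \<in> ?B} \<le> card (?B \<inter> V) + 1"
        by (rule card_colors_le[OF assms(2) finV finC cardC x])
      moreover have "?B \<inter> V = ?B" by auto
      ultimately show ?thesis unfolding eq using B by simp
    qed
  qed
  also have "\<dots> = 2 * (\<Sum>x\<in>V. own E x)" by (simp add: sum_distrib_left)
  finally show ?thesis using sum_own[OF assms(1)] by linarith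
qed

text \<open>The global budget bounds the sums of both kinds of potential by a constant times r s. As
  \<open>s\<close> is tiny compared with \<open>r\<close>, Markov's inequality leaves few vertices
  and colors near the limit. The margins 1000 and 4000 exceed what one recoloring can add.\<close>

lemma card_heavy:
  assumes state_ok: "state_ok E nb"
  shows "real (card {x\<in>V. pot_v E nb x > r - 1000}) \<le> r"
    "real (card {k\<in>C. pot_c E nb k > r - 4000}) \<le> r"
proof -
  have cs: "csys V C nb" and E: "E \<subseteq> dom P"
    and tot: "real ((\<Sum>x\<in>V. card {k\<in>C. wrong nb x k}) + 80 * card E) \<le> 82000 * r * s"
    using state_ok by (auto simp: state_ok_def)
  define M where "M = 82000 * r * s"
  define W where "W = (\<Sum>x\<in>V. card {k\<in>C. wrong nb x k})"
  have M: "real W + 80 * real (card E) \<le> M" using tot unfolding M_def W_def by simp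
  have sv: "(\<Sum>x\<in>V. pot_v E nb x) = real ((\<Sum>x\<in>V. card {k\<in>C. wrong nb x k})
      + 40 * ((\<Sum>x\<in>V. own E x) + (\<Sum>x\<in>V. load E nb x)))"
    unfolding pot_v_def by (simp add: sum.distrib sum_distrib_left)
  have "(\<Sum>x\<in>V. own E x) + (\<Sum>x\<in>V. load E nb x) \<le> 4 * card E"
    using sum_own[OF E] sum_load[OF E cs] by linarith
  then have "(\<Sum>x\<in>V. pot_v E nb x) \<le> real (W + 40 * (4 * card E))"
    unfolding sv W_def[symmetric] by (intro of_nat_mono add_left_mono mult_le_mono2)
  then have le1: "(\<Sum>x\<in>V. pot_v E nb x) \<le> 3 * M" using M by simp
  have sc: "(\<Sum>k\<in>C. pot_c E nb k) = real ((\<Sum>k\<in>C. card {x\<in>V. wrong nb x k})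
      + 80 * ((\<Sum>k\<in>C. target E k) + (\<Sum>k\<in>C. current E nb k)))"
    unfolding pot_c_def by (simp add: sum.distrib sum_distrib_left)
  have "(\<Sum>k\<in>C. target E k) + (\<Sum>k\<in>C. current E nb k) \<le> 5 * card E"
    using sum_target[OF E] sum_current[OF E cs] by linarith
  then have "(\<Sum>k\<in>C. pot_c E nb k) \<le> real (W + 80 * (5 * card E))"
    unfolding sc double_count[OF finC finV, of "\<lambda>k x. wrong nb x k"] W_def[symmetric]
    by (intro of_nat_mono add_left_mono mult_le_mono2)
  then have le2: "(\<Sum>k\<in>C. pot_c E nb k) \<le> 6 * M" using M by simp
  have q: "6 * M / (r - 4000) \<le> r" "3 * M / (r - 1000) \<le> r"
  proof -
    have "6 * M = r * (6 * 82000 * s)" by (simp add: M_def)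
    also have "\<dots> \<le> r * (r - 4000)" using r_big s by (intro mult_left_mono) auto
    finally show "6 * M / (r - 4000) \<le> r" using r_big by (simp add: pos_divide_le_eq)
    have "3 * M = r * (3 * 82000 * s)" by (simp add: M_def)
    also have "\<dots> \<le> r * (r - 1000)" using r_big s by (intro mult_left_mono) auto
    finally show "3 * M / (r - 1000) \<le> r" using r_big by (simp add: pos_divide_le_eq)
  qed
  have "real (card {x\<in>V. pot_v E nb x > r - 1000}) \<le> 3 * M / (r - 1000)"
    by (rule card_large_le[OF finV _ le1]) (use r_big in \<open>auto simp: pot_v_def\<close>)
  then show "real (card {x\<in>V. pot_v E nb x > r - 1000}) \<le> r" using q by linarith
  have "real (card {k\<in>C. pot_c E nb k > r - 4000}) \<le> 6 * M / (r - 4000)"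
    by (rule card_large_le[OF finC _ le2]) (use r_big in \<open>auto simp: pot_c_def\<close>)
  then show "real (card {k\<in>C. pot_c E nb k > r - 4000}) \<le> r" using q by linarith
qed

text \<open>Covers a pending edge that already carries its color, from the base coloring or as a
  by-product of earlier exchanges.\<close>

lemma state_ok_drop:
  assumes "state_ok E nb" "e \<in> E"
    and "\<And>x y. x \<in> V \<Longrightarrow> y \<in> V \<Longrightarrow> e = {x, y} \<Longrightarrow> nb (the (P e)) x = y"
  shows "state_ok (E - {e}) nb"
proof -
  have E: "E \<subseteq> dom P" using assms by (simp add: state_ok_def)
  have fE: "finite E" using E dom_fin by (rule finite_subset)
  have 1: "own (E - {e}) x \<le> own E x" for x
    unfolding own_def using fE by (intro card_mono) auto
  have 2: "load (E - {e}) nb x \<le> load E nb x" for x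
    unfolding load_def using finC by (intro card_mono) (auto simp: pd_def)
  have 3: "target (E - {e}) k \<le> target E k" for k
    unfolding target_def using fE by (intro card_mono) auto
  have 4: "current (E - {e}) nb k \<le> current E nb k" for k
    unfolding current_def using finV by (intro card_mono) auto
  have pv: "pot_v (E - {e}) nb x \<le> pot_v E nb x" for x
    unfolding pot_v_def by (intro of_nat_mono add_mono mult_le_mono2 order_refl 1 2)
  have pc: "pot_c (E - {e}) nb k \<le> pot_c E nb k" for k
    unfolding pot_c_def by (intro of_nat_mono add_mono mult_le_mono2 order_refl 3 4)
  have cE: "card (E - {e}) \<le> card E" using fE by (intro card_mono) auto
  have dn: "nb (the (P {x, y})) x = y" if "x \<in> V" "y \<in> V" "{x, y} \<in> dom P - (E - {e})" for x y
    using assms(1) assms(3)[of x y] that unfolding state_ok_def by (cases "{x, y} = e") auto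
  have "(\<Sum>x\<in>V. card {k\<in>C. wrong nb x k}) + 80 * card (E - {e})
      \<le> (\<Sum>x\<in>V. card {k\<in>C. wrong nb x k}) + 80 * card E"
    using cE by simp
  then have "real ((\<Sum>x\<in>V. card {k\<in>C. wrong nb x k}) + 80 * card (E - {e})) \<le> 82000 * r * s"
    using assms(1) unfolding state_ok_def by (meson of_nat_mono order_trans)
  moreover have "pot_v (E - {e}) nb x \<le> r" if "x \<in> V" for x
    using pv[of x] assms(1) that unfolding state_ok_def by force
  moreover have "pot_c (E - {e}) nb k \<le> r" if "k \<in> C" for k
    using pc[of k] assms(1) that unfolding state_ok_def by force
  moreover have "E - {e} \<subseteq> dom P" using E by blast
  ultimately show ?thesis using assms(1) dn unfolding state_ok_def by blast
qed

end

text \<open>Here \<open>a\<close> is the raw damage and \<open>b\<close> the counter of weight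
  \<open>w\<close>; \<open>l\<close> is the guaranteed drop of the counter and \<open>t\<close> the
  increase that remains.\<close>

lemma weigh:
  fixes a b w m n l t :: nat
  assumes "a' \<le> a + m" "b' + l \<le> b + n" "m + w * n \<le> w * l + t"
  shows "a' + w * b' \<le> a + w * b + t"
proof -
  have "w * (b' + l) \<le> w * (b + n)" using assms(2) by (rule mult_le_mono2)
  then show ?thesis using assms(1,3) by (simp add: add_mult_distrib2)
qed

section \<open>The potential argument for one recoloring\<close>

context precolored
begin

lemma swaps_wrong_vertex:
  assumes "swaps VS CS n nb nb'"
  shows "card {k\<in>C. wrong nb' x k} \<le> card {k\<in>C. wrong nb x k} + 2 * n"
proof -
  have f: "finite {k. nb' k x \<noteq> nb k x}"
    by (rule finite_subset[of _ "snd ` {(x, k). nb' k x \<noteq> nb k x}"]) (use swaps_changed[OF assms] in force)+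
  have "card {k\<in>C. wrong nb' x k} \<le> card ({k\<in>C. wrong nb x k} \<union> {k. nb' k x \<noteq> nb k x})"
    by (rule card_mono) (use finC f in \<open>auto simp: wrong_def\<close>)
  also have "\<dots> \<le> card {k\<in>C. wrong nb x k} + card {k. nb' k x \<noteq> nb k x}" by (rule card_Un_le)
  also have "card {k. nb' k x \<noteq> nb k x} \<le> 2 * n" using swaps_changed[OF assms] by blast
  finally show ?thesis by simp
qed

lemma swaps_wrong_color:
  assumes "swaps VS CS n nb nb'"
  shows "card {x\<in>V. wrong nb' x k} \<le> card {x\<in>V. wrong nb x k} + 4 * n"
proof -
  have f: "finite {x. nb' k x \<noteq> nb k x}"
    by (rule finite_subset[of _ "fst ` {(x, k). nb' k x \<noteq> nb k x}"]) (use swaps_changed[OF assms] in force)+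
  have "card {x\<in>V. wrong nb' x k} \<le> card ({x\<in>V. wrong nb x k} \<union> {x. nb' k x \<noteq> nb k x})"
    by (rule card_mono) (use finV f in \<open>auto simp: wrong_def\<close>)
  also have "\<dots> \<le> card {x\<in>V. wrong nb x k} + card {x. nb' k x \<noteq> nb k x}" by (rule card_Un_le)
  also have "card {x. nb' k x \<noteq> nb k x} \<le> 4 * n" using swaps_changed[OF assms] by blast
  finally show ?thesis by simp
qed

lemma swaps_wrong_total:
  assumes "swaps VS CS n nb nb'"
  shows "(\<Sum>x\<in>V. card {k\<in>C. wrong nb' x k}) \<le> (\<Sum>x\<in>V. card {k\<in>C. wrong nb x k}) + 8 * n"
proof -
  have eq: "(\<Sum>x\<in>V. card {k\<in>C. wrong f x k}) = card (SIGMA x:V. {k\<in>C. wrong f x k})" for f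
    using finV finC by (subst card_SigmaI) auto
  note ch = swaps_changed[OF assms]
  have "card (SIGMA x:V. {k\<in>C. wrong nb' x k})
    \<le> card ((SIGMA x:V. {k\<in>C. wrong nb x k}) \<union> {(x, k). nb' k x \<noteq> nb k x})"
    by (rule card_mono) (use finV finC ch in \<open>auto simp: wrong_def\<close>)
  also have "\<dots> \<le> card (SIGMA x:V. {k\<in>C. wrong nb x k}) + card {(x, k). nb' k x \<noteq> nb k x}"
    by (rule card_Un_le)
  also have "card {(x, k). nb' k x \<noteq> nb k x} \<le> 8 * n" using ch by blast
  finally show ?thesis unfolding eq by simp
qed

lemma swaps_load:
  assumes "swaps VS CS n nb nb'" "E' \<subseteq> E"
  shows "load E' nb' x \<le> load E nb x + 2 * n"
proof -
  have f: "finite {k. nb' k x \<noteq> nb k x}"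
    by (rule finite_subset[of _ "snd ` {(x, k). nb' k x \<noteq> nb k x}"]) (use swaps_changed[OF assms(1)] in force)+
  have "card {k\<in>C. pd E' (nb' k x) k} \<le> card ({k\<in>C. pd E (nb k x) k} \<union> {k. nb' k x \<noteq> nb k x})"
  proof (rule card_mono)
    show "{k\<in>C. pd E' (nb' k x) k} \<subseteq> {k\<in>C. pd E (nb k x) k} \<union> {k. nb' k x \<noteq> nb k x}"
    proof
      fix k assume k: "k \<in> {k\<in>C. pd E' (nb' k x) k}"
      show "k \<in> {k\<in>C. pd E (nb k x) k} \<union> {k. nb' k x \<noteq> nb k x}"
        using k assms(2) by (cases "nb' k x = nb k x") (auto simp: pd_def)
    qed
  qed (use finC f in auto)
  also have "\<dots> \<le> card {k\<in>C. pd E (nb k x) k} + card {k. nb' k x \<noteq> nb k x}" by (rule card_Un_le)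
  also have "card {k. nb' k x \<noteq> nb k x} \<le> 2 * n" using swaps_changed[OF assms(1)] by blast
  finally show ?thesis by (simp add: load_def)
qed

lemma swaps_current:
  assumes "swaps VS CS n nb nb'" "E' \<subseteq> E"
  shows "current E' nb' k \<le> current E nb k + 4 * n"
proof -
  have f: "finite {x. nb' k x \<noteq> nb k x}"
    by (rule finite_subset[of _ "fst ` {(x, k). nb' k x \<noteq> nb k x}"]) (use swaps_changed[OF assms(1)] in force)+
  have "card {x\<in>V. {x, nb' k x} \<in> E'} \<le> card ({x\<in>V. {x, nb k x} \<in> E} \<union> {x. nb' k x \<noteq> nb k x})"
  proof (rule card_mono)
    show "{x\<in>V. {x, nb' k x} \<in> E'} \<subseteq> {x\<in>V. {x, nb k x} \<in> E} \<union> {x. nb' k x \<noteq> nb k x}"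
    proof
      fix x assume x: "x \<in> {x\<in>V. {x, nb' k x} \<in> E'}"
      show "x \<in> {x\<in>V. {x, nb k x} \<in> E} \<union> {x. nb' k x \<noteq> nb k x}"
        using x assms(2) by (cases "nb' k x = nb k x") auto
    qed
  qed (use finV f in auto)
  also have "\<dots> \<le> card {x\<in>V. {x, nb k x} \<in> E} + card {x. nb' k x \<noteq> nb k x}" by (rule card_Un_le)
  also have "card {x. nb' k x \<noteq> nb k x} \<le> 4 * n" using swaps_changed[OF assms(1)] by blast
  finally show ?thesis by (simp add: current_def)
qed

text \<open>The freely usable vertices and colors are those whose potential is not near its limit.
  The four vertices of \<open>F\<close>, whose potential must pay for itself, are removed as well;
  the bound \<open>2 * r\<close> has room for them.\<close>

lemma switching_here:
  assumes inv: "state_ok E nb" and E: "E \<subseteq> dom P" and fE: "finite E"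
    and UV: "UV = {y\<in>V. pot_v E nb y \<le> r - 1000} - F" and F: "finite F" "card F \<le> 4"
    and UC: "UC = {k\<in>C. pot_c E nb k \<le> r - 4000}"
  shows "switching V C nb0 Q cl X L (pd E) UV UC r"
proof unfold_locales
  have sr: "s \<le> r" using s r_big by simp
  show "real (card V) = 1000 * r" "r \<ge> 10 ^ 6" by (rule r, rule r_big)
  show "real (card {k \<in> C. k \<in> L {x, y}}) \<le> r" if "x \<in> V" "y \<in> V" "x \<noteq> y" for x y
    using L_edge_s[OF that] sr by linarith
  show "real (card {y \<in> V. y \<noteq> x \<and> k \<in> L {x, y}}) \<le> r" if "x \<in> V" "k \<in> C" for x k
    using L_vertex_s[OF that] sr by linarith
  show "real (card {y \<in> V. y \<noteq> x \<and> \<not> real (card {d \<in> C. d \<in> L {nb0 d x, nb0 d y}}) \<le> r}) \<le> r"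
    if "x \<in> V" for x by (rule few_bound[OF that])
  show "real (card {k \<in> C. pd E x k}) \<le> r" if "x \<in> V" for x
  proof -
    have "own E x \<le> card {e\<in>dom P. x \<in> e}"
      unfolding own_def using E dom_fin by (intro card_mono) auto
    then show ?thesis using card_pd_le[OF fE E, of x] P_vertex[OF that] sr by linarith
  qed
  show "real (card {x \<in> V. pd E x k}) \<le> r" if "k \<in> C" for k
  proof -
    have f: "finite {e\<in>dom P. P e = Some k}" using dom_fin by simp
    have "{x \<in> V. pd E x k} \<subseteq> (\<Union>e\<in>{e\<in>dom P. P e = Some k}. {x\<in>V. x \<in> e})"
      using E by (auto simp: pd_def)
    then have "card {x \<in> V. pd E x k} \<le> card (\<Union>e\<in>{e\<in>dom P. P e = Some k}. {x\<in>V. x \<in> e})"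
      using f finV by (intro card_mono) auto
    also have "\<dots> \<le> (\<Sum>e\<in>{e\<in>dom P. P e = Some k}. card {x\<in>V. x \<in> e})" by (rule card_UN_le[OF f])
    also have "\<dots> \<le> (\<Sum>e\<in>{e\<in>dom P. P e = Some k}. 2)" using card_edge by (intro sum_mono) auto
    also have "\<dots> = 2 * card {e\<in>dom P. P e = Some k}" by simp
    finally have "real (card {x \<in> V. pd E x k}) \<le> 2 * s" using P_color[OF that] by linarith
    then show ?thesis using s r_big by simp
  qed
  show "UV \<subseteq> V" using UV by auto
  show "UC \<subseteq> C" using UC by auto
  have "C - UC \<subseteq> {k\<in>C. pot_c E nb k > r - 4000}" using UC by auto
  from card_subset_real[OF this _ card_heavy(2)[OF inv]] finC
  show "real (card (C - UC)) \<le> r" by simp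
  have 1: "real (card ({x\<in>V. pot_v E nb x > r - 1000} \<union> F)) \<le> r + 4"
    by (rule card_Un_real[OF card_heavy(1)[OF inv]]) (use F in simp)
  have 2: "V - UV \<subseteq> {x\<in>V. pot_v E nb x > r - 1000} \<union> F" using UV by auto
  have "real (card (V - UV)) \<le> r + 4"
    by (rule card_subset_real[OF 2 _ 1]) (use finV F in simp)
  then show "real (card (V - UV)) \<le> 2 * r" using r_big by simp
qed

lemma state_okD:
  assumes "state_ok E nb"
  shows "csys V C nb" "E \<subseteq> dom P"
    "\<And>x y. x \<in> V \<Longrightarrow> y \<in> V \<Longrightarrow> {x, y} \<in> dom P - E \<Longrightarrow> nb (the (P {x, y})) x = y"
    "\<And>x k. x \<in> V \<Longrightarrow> k \<in> C \<Longrightarrow> {x, nb k x} \<notin> dom P \<Longrightarrow> k \<notin> L {x, nb k x}"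
    "\<And>x. x \<in> V \<Longrightarrow> pot_v E nb x \<le> r" "\<And>k. k \<in> C \<Longrightarrow> pot_c E nb k \<le> r"
    "real ((\<Sum>x\<in>V. card {k\<in>C. wrong nb x k}) + 80 * card E) \<le> 82000 * r * s"
  using assms unfolding state_ok_def by simp_all

text \<open>A vertex of \<open>F\<close> suffers up to 20 new wrong incidences, and either its
  \<open>own\<close> (at \<open>u\<close>, \<open>v\<close>) or its \<open>load\<close> (at
  \<open>u1\<close>, \<open>v1\<close>) drops by one, worth 40. The colors \<open>a\<close> and
  \<open>c\<close> suffer up to 40, and \<open>current\<close> or \<open>target\<close> drops by
  one, worth 80, if they are not in \<open>UC\<close> anyway. All else that is touched has a
  margin.\<close>

lemma state_ok_step:
  assumes inv: "state_ok E nb" and e: "e \<in> E"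
  shows "\<exists>nb'. state_ok (E - {e}) nb'"
proof -
  have cs: "csys V C nb" and E: "E \<subseteq> dom P" using inv by (auto simp: state_ok_def)
  have fE: "finite E" using E dom_fin by (rule finite_subset)
  obtain u v where uv: "u \<in> V" "v \<in> V" "u \<noteq> v" "e = {u, v}" using P_dom e E by blast
  obtain c where c: "P e = Some c" using e E by auto
  have cC: "c \<in> C" by (rule P_C[OF c])
  show ?thesis
  proof (cases "nb c u = v")
    case True
    then have "nb c v = u" using csysD(3)[OF cs cC uv(1)] by auto
    have "state_ok (E - {e}) nb"
      by (rule state_ok_drop[OF inv e]) (use True \<open>nb c v = u\<close> uv c in \<open>auto simp: doubleton_eq_iff\<close>)
    then show ?thesis by blast
  next
    case False
    obtain a where a: "a \<in> C" "nb a u = v" using csys_cover[OF cs uv(1-3)] by blast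
    have ac: "a \<noteq> c" using a False by auto
    define u1 where "u1 = nb c u"
    define v1 where "v1 = nb c v"
    define F where "F = {u, v, u1, v1}"
    define UV where "UV = {y\<in>V. pot_v E nb y \<le> r - 1000} - F"
    define UC where "UC = {k\<in>C. pot_c E nb k \<le> r - 4000}"
    have F: "finite F" "card F \<le> 4" by (auto simp: F_def card_insert_if)
    interpret S: switching V C nb0 Q cl X L "dom P" "pd E" UV UC r
      by (rule switching_here[OF inv E fE UV_def F UC_def])
    have bad: "S.bad = wrong" by (intro ext) (simp add: S.bad_def wrong_def)
    have calm: "S.calm nb"
      unfolding S.calm_def bad
    proof (intro conjI ballI cs)
      fix x assume x: "x \<in> V"
      have "real (card {k\<in>C. wrong nb x k}) \<le> pot_v E nb x" by (simp add: pot_v_def)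
      then show "real (card {k\<in>C. wrong nb x k}) \<le> r" using state_okD(5)[OF inv x] by linarith
    next
      fix k assume k: "k \<in> C"
      have "real (card {x\<in>V. wrong nb x k}) \<le> pot_c E nb k" by (simp add: pot_c_def)
      then show "real (card {x\<in>V. wrong nb x k}) \<le> r" using state_okD(6)[OF inv k] by linarith
    qed
    have UVn: "UV \<inter> {u, v, nb c u, nb c v} = {}" by (auto simp: UV_def F_def u1_def v1_def)
    obtain nb' where sw: "swaps (F \<union> UV) (UC \<union> {a, c}) 10 nb nb'" and cu: "nb' c u = v"
      and new: "\<And>x k. nb' k x \<noteq> nb k x \<Longrightarrow> {x, nb' k x} = {u, v} \<and> k = c \<or>
       k \<notin> L {x, nb' k x} \<and> (x \<in> F \<longrightarrow> \<not> pd E (nb' k x) k) \<and> ({x, nb' k x} \<notin> dom P \<or> k \<in> UC)"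
      and old: "\<And>x k. nb' k x \<noteq> nb k x \<Longrightarrow> \<not> wrong nb x k \<or> k = c \<and> x \<in> F \<or> k = a \<and> x \<in> {u, v}"
      using S.recolor_edge[OF calm uv(1-3) a(1) cC ac a(2) False UVn, unfolded bad]
      unfolding F_def u1_def v1_def by blast
    define E' where "E' = E - {e}"
    have E'E: "E' \<subseteq> E" by (auto simp: E'_def)
    have cs': "csys V C nb'" by (rule swaps_csys[OF sw _ cs]) (use a cC in \<open>auto simp: UC_def\<close>)
    have cv: "nb' c v = u" using csysD(3)[OF cs' cC uv(1)] cu by auto
    have nbs: "nb c u1 = u" "nb c v1 = v" "nb a v = u"
      using csysD(3)[OF cs cC uv(1)] csysD(3)[OF cs cC uv(2)] csysD(3)[OF cs a(1) uv(1)] a(2)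
      by (auto simp: u1_def v1_def)
    have same: "e' = e" if "P e' = Some c" "x \<in> {u, v}" "x \<in> e'" for e' x
      by (rule P_proper[OF that(1) c that(3)]) (use that(2) uv(4) in simp)
    have "\<not> pd E' x c" if x: "x \<in> {u, v}" for x
    proof
      assume "pd E' x c"
      then obtain e' where e': "e' \<in> E'" "x \<in> e'" "P e' = Some c" unfolding pd_def by blast
      then show False using same[OF e'(3) x e'(2)] by (simp add: E'_def)
    qed
    then have nopd: "\<not> pd E' u c" "\<not> pd E' v c" by simp_all
    \<comment> \<open>Settled edges are wrong incidences, and these change only in color
      \<open>c\<close> at \<open>F\<close> or in color \<open>a\<close> at \<open>u\<close>,
      \<open>v\<close>. In the first case the settled edge would share an end and its prescribed
      color with \<open>e\<close>, in the second it would be \<open>e\<close> itself.\<close>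
    have done_e: "nb' (the (P {x, y})) x = y"
      if xy: "x \<in> V" "y \<in> V" "{x, y} \<in> dom P - E'" for x y
    proof (cases "{x, y} = e")
      case True
      then have "x = u \<and> y = v \<or> x = v \<and> y = u" unfolding uv(4) doubleton_eq_iff .
      moreover have "the (P {x, y}) = c" unfolding True using c by simp
      ultimately show ?thesis using cu cv by auto
    next
      case ne: False
      then have inE: "{x, y} \<in> dom P - E" using xy by (auto simp: E'_def)
      define k where "k = the (P {x, y})"
      have Pk: "P {x, y} = Some k" using inE by (auto simp: k_def)
      have nbk: "nb k x = y" unfolding k_def by (rule state_okD(3)[OF inv xy(1,2) inE])
      show ?thesis
        unfolding k_def[symmetric]
      proof (rule ccontr)
        assume "nb' k x \<noteq> y"
        then have ch: "nb' k x \<noteq> nb k x" using nbk by simp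
        have "wrong nb x k" using nbk Pk by (auto simp: wrong_def)
        then have "k = c \<and> x \<in> F \<or> k = a \<and> x \<in> {u, v}" using old[OF ch] by blast
        then show False
        proof
          assume kx: "k = a \<and> x \<in> {u, v}"
          then have "{x, y} = {u, v}" using nbk a nbs by auto
          then show False using ne uv by simp
        next
          assume kx: "k = c \<and> x \<in> F"
          then have "u \<in> {x, y} \<or> v \<in> {x, y}" using nbk nbs unfolding F_def by auto
          then show False using same[of "{x, y}" u] same[of "{x, y}" v] Pk kx ne by blast
        qed
      qed
    qed
    have lists: "k \<notin> L {x, nb' k x}" if x: "x \<in> V" "k \<in> C" "{x, nb' k x} \<notin> dom P" for x k
    proof (cases "nb' k x = nb k x")
      case True
      then show ?thesis using state_okD(4)[OF inv x(1,2)] x(3) by simp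
    next
      case ne: False
      have "{x, nb' k x} \<noteq> {u, v}" using x(3) e E uv(4) by auto
      then show ?thesis using new[OF ne] by blast
    qed
    have own': "own E' x \<le> own E x" for x
      unfolding own_def using fE E'E by (intro card_mono) auto
    have tgt': "target E' k \<le> target E k" for k
      unfolding target_def using fE E'E by (intro card_mono) auto
    have ownuv: "own E' x < own E x" if "x \<in> {u, v}" for x
    proof -
      have "{e\<in>E'. x \<in> e} \<subset> {e\<in>E. x \<in> e}" using that e uv(4) by (auto simp: E'_def)
      then show ?thesis unfolding own_def using fE by (intro psubset_card_mono) auto
    qed
    \<comment> \<open>The only new edge at \<open>F\<close> whose other end might await its color is
      \<open>u v\<close> in color \<open>c\<close>; once \<open>e\<close> is settled, properness
      leaves no demand for \<open>c\<close> at \<open>u\<close> or \<open>v\<close>.\<close>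
    have notload: "\<not> pd E' (nb' k x) k" if x: "x \<in> F" and ch: "nb' k x \<noteq> nb k x" for x k
    proof
      assume p: "pd E' (nb' k x) k"
      then have "pd E (nb' k x) k" using E'E by (auto simp: pd_def)
      then have "{x, nb' k x} = {u, v} \<and> k = c" using new[OF ch] x by blast
      then have "nb' k x \<in> {u, v}" "k = c" by auto
      then show False using p nopd by auto
    qed
    have loadsub: "{k\<in>C. pd E' (nb' k x) k} \<subseteq> {k\<in>C. pd E (nb k x) k}" if x: "x \<in> F" for x
    proof
      fix k assume k: "k \<in> {k\<in>C. pd E' (nb' k x) k}"
      then have "nb' k x = nb k x" using notload[OF x] by blast
      then show "k \<in> {k\<in>C. pd E (nb k x) k}" using k E'E by (auto simp: pd_def)
    qed
    have loadF: "load E' nb' x \<le> load E nb x" if "x \<in> F" for x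
      unfolding load_def using loadsub[OF that] finC by (intro card_mono) auto
    \<comment> \<open>The vertices \<open>u1\<close> and \<open>v1\<close> were charged because
      their \<open>c\<close>-neighbor awaited \<open>c\<close>. That demand came from
      \<open>e\<close> alone, so the charge disappears.\<close>
    have loadF1: "load E' nb' x < load E nb x" if x: "x \<in> {u1, v1}" for x
    proof -
      have xF: "x \<in> F" using x by (auto simp: F_def)
      have nx: "nb c x \<in> {u, v}" using x nbs by auto
      have "c \<in> {k\<in>C. pd E (nb k x) k}" using cC nx e c uv(4) by (auto simp: pd_def)
      moreover have "\<not> pd E' (nb' c x) c"
        using notload[OF xF, of c] nopd nx by (cases "nb' c x = nb c x") auto
      ultimately have "{k\<in>C. pd E' (nb' k x) k} \<subset> {k\<in>C. pd E (nb k x) k}" using loadsub[OF xF] by blast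
      then show ?thesis unfolding load_def using finC by (intro psubset_card_mono) auto
    qed
    have pv: "pot_v E' nb' x \<le> r" if x: "x \<in> V" for x
    proof -
      have old_r: "pot_v E nb x \<le> r" using state_okD(5)[OF inv x] by linarith
      have wv: "card {k\<in>C. wrong nb' x k} \<le> card {k\<in>C. wrong nb x k} + 20"
        using swaps_wrong_vertex[OF sw, of x] by simp
      consider "x \<in> F" | "x \<in> UV" "x \<notin> F" | "x \<notin> F \<union> UV" by blast
      then show ?thesis
      proof cases
        case 1
        then have "own E' x + load E' nb' x + 1 \<le> own E x + load E nb x + 0"
          using own'[of x] ownuv[of x] loadF[of x] loadF1[of x] unfolding F_def by fastforce
        from weigh[OF wv this, of 40 0]
        have "card {k\<in>C. wrong nb' x k} + 40 * (own E' x + load E' nb' x)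
          \<le> card {k\<in>C. wrong nb x k} + 40 * (own E x + load E nb x)" by simp
        then show ?thesis using old_r unfolding pot_v_def by (meson of_nat_mono order_trans)
      next
        \<comment> \<open>At a free vertex both counts may rise by 20, so the potential rises by at
          most 20 + 40 * 20 = 820, below the margin 1000.\<close>
        case 2
        have "load E' nb' x \<le> load E nb x + 20" using swaps_load[OF sw E'E, of x] by simp
        then have "own E' x + load E' nb' x + 0 \<le> own E x + load E nb x + 20" using own'[of x] by simp
        from weigh[OF wv this, of 40 820] have "card {k\<in>C. wrong nb' x k} + 40 * (own E' x + load E' nb' x)
          \<le> card {k\<in>C. wrong nb x k} + 40 * (own E x + load E nb x) + 820" by simp
        then have "pot_v E' nb' x \<le> pot_v E nb x + 820" unfolding pot_v_def by simp
        then show ?thesis using 2 by (auto simp: UV_def)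
      next
        case 3
        then have eq: "nb' k x = nb k x" for k using swaps_unchanged[OF sw] by blast
        have "load E' nb' x \<le> load E nb x"
          unfolding load_def eq using finC E'E by (intro card_mono) (auto simp: pd_def)
        moreover have "card {k\<in>C. wrong nb' x k} = card {k\<in>C. wrong nb x k}" by (simp add: wrong_def eq)
        ultimately have "card {k\<in>C. wrong nb' x k} + 40 * (own E' x + load E' nb' x)
          \<le> card {k\<in>C. wrong nb x k} + 40 * (own E x + load E nb x)"
          using own'[of x] by (simp add: add_mono)
        then show ?thesis using old_r unfolding pot_v_def by (meson of_nat_mono order_trans)
      qed
    qed
    have pc: "pot_c E' nb' k \<le> r" if k: "k \<in> C" for k
    proof -
      have old_r: "pot_c E nb k \<le> r" using state_okD(6)[OF inv k] by linarith
      have wc: "card {x\<in>V. wrong nb' x k} \<le> card {x\<in>V. wrong nb x k} + 40"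
        using swaps_wrong_color[OF sw, of k] by simp
      consider "k \<in> UC" | "k \<notin> UC" "k \<in> {a, c}" | "k \<notin> UC \<union> {a, c}" by blast
      then show ?thesis
      proof cases
        \<comment> \<open>For a free color both counts may rise by 40, so the potential rises by at
          most 40 + 80 * 40 = 3240, below the margin 4000.\<close>
        case 1
        have "current E' nb' k \<le> current E nb k + 40" using swaps_current[OF sw E'E, of k] by simp
        then have "target E' k + current E' nb' k + 0 \<le> target E k + current E nb k + 40" using tgt'[of k] by simp
        from weigh[OF wc this, of 80 3240]
        have "card {x\<in>V. wrong nb' x k} + 80 * (target E' k + current E' nb' k)
          \<le> card {x\<in>V. wrong nb x k} + 80 * (target E k + current E nb k) + 3240" by simp
        then have "pot_c E' nb' k \<le> pot_c E nb k + 3240" unfolding pot_c_def by simp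
        then show ?thesis using 1 by (auto simp: UC_def)
      next
        case 2
        \<comment> \<open>Outside \<open>UC\<close> no pending edge newly receives color
          \<open>k\<close>, so \<open>current\<close> cannot grow and a single drop
          suffices.\<close>
        have unch: "nb' k x = nb k x" if "{x, nb' k x} \<in> E'" for x
        proof (rule ccontr)
          assume "nb' k x \<noteq> nb k x"
          moreover have "{x, nb' k x} \<noteq> {u, v}" "{x, nb' k x} \<in> dom P" using that uv(4) E by (auto simp: E'_def)
          ultimately show False using new[of k x] 2 by blast
        qed
        have sub: "{x\<in>V. {x, nb' k x} \<in> E'} \<subseteq> {x\<in>V. {x, nb k x} \<in> E}"
        proof
          fix x assume x: "x \<in> {x\<in>V. {x, nb' k x} \<in> E'}"
          then have "nb' k x = nb k x" using unch by blast
          then show "x \<in> {x\<in>V. {x, nb k x} \<in> E}" using x E'E by auto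
        qed
        have cur: "current E' nb' k \<le> current E nb k"
          unfolding current_def using finV sub by (intro card_mono) auto
        have "target E' k + current E' nb' k + 1 \<le> target E k + current E nb k + 0"
        proof (cases "k = c")
          case True
          have "{e\<in>E'. P e = Some k} \<subset> {e\<in>E. P e = Some k}" using e c True by (auto simp: E'_def)
          then have "target E' k < target E k"
            unfolding target_def using fE by (intro psubset_card_mono) auto
          then show ?thesis using cur by linarith
        next
          case nc: False
          then have ka: "k = a" using 2 by auto
          have "u \<in> {x\<in>V. {x, nb k x} \<in> E}" using ka a uv e by auto
          moreover have "u \<notin> {x\<in>V. {x, nb' k x} \<in> E'}"
          proof
            assume "u \<in> {x\<in>V. {x, nb' k x} \<in> E'}"
            then have m: "{u, nb' k u} \<in> E'" by simp
            then have "nb' k u = v" using unch[OF m] ka a by simp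
            then show False using m uv(4) by (auto simp: E'_def)
          qed
          ultimately have "{x\<in>V. {x, nb' k x} \<in> E'} \<subset> {x\<in>V. {x, nb k x} \<in> E}" using sub by blast
          then have "current E' nb' k < current E nb k"
            unfolding current_def using finV by (intro psubset_card_mono) auto
          then show ?thesis using tgt'[of k] by linarith
        qed
        from weigh[OF wc this, of 80 0]
        have "card {x\<in>V. wrong nb' x k} + 80 * (target E' k + current E' nb' k)
          \<le> card {x\<in>V. wrong nb x k} + 80 * (target E k + current E nb k)" by simp
        then show ?thesis using old_r unfolding pot_c_def by (meson of_nat_mono order_trans)
      next
        case 3
        then have eq: "nb' k x = nb k x" for x using swaps_unchanged[OF sw] by blast
        have "current E' nb' k \<le> current E nb k"
          unfolding current_def eq using finV E'E by (intro card_mono) auto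
        moreover have "card {x\<in>V. wrong nb' x k} = card {x\<in>V. wrong nb x k}" by (simp add: wrong_def eq)
        ultimately have "card {x\<in>V. wrong nb' x k} + 80 * (target E' k + current E' nb' k)
          \<le> card {x\<in>V. wrong nb x k} + 80 * (target E k + current E nb k)"
          using tgt'[of k] by (simp add: add_mono)
        then show ?thesis using old_r unfolding pot_c_def by (meson of_nat_mono order_trans)
      qed
    qed
    have tot: "real ((\<Sum>x\<in>V. card {k\<in>C. wrong nb' x k}) + 80 * card E') \<le> 82000 * r * s"
    proof -
      have "card E' + 1 = card E" unfolding E'_def using card_Suc_Diff1[OF fE e] by simp
      then have "(\<Sum>x\<in>V. card {k\<in>C. wrong nb' x k}) + 80 * card E'
        \<le> (\<Sum>x\<in>V. card {k\<in>C. wrong nb x k}) + 80 * card E"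
        using swaps_wrong_total[OF sw] by linarith
      then show ?thesis using state_okD(7)[OF inv] by (meson of_nat_mono order_trans)
    qed
    have "state_ok E' nb'"
      unfolding state_ok_def
      by (intro conjI cs' ballI impI done_e lists pv pc tot) (use E E'E in auto)
    then show ?thesis unfolding E'_def by blast
  qed
qed

text \<open>At a vertex the damage consists of at most 10 exceptional incidences, \<open>s\<close>
  precolored edges and 1 for a doubly covered pair. The assumption \<open>s \<ge> 11\<close> lets
  these constants be absorbed into the budget.\<close>

lemma state_ok_initial: "state_ok (dom P) nb0"
proof -
  have wr: "wrong nb0 x k \<longleftrightarrow> (x, k) \<in> X \<or> {x, nb0 k x} \<in> dom P" for x k by (simp add: wrong_def)
  have wv: "real (card {k\<in>C. wrong nb0 x k}) \<le> 11 + s" if x: "x \<in> V" for x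
  proof -
    let ?B = "{y\<in>V. {x, y} \<in> dom P}"
    have B: "card ?B \<le> card {e\<in>dom P. x \<in> e}"
      by (rule card_inj_on_le[of "\<lambda>y. {x, y}"]) (use dom_fin in \<open>auto simp: inj_on_def doubleton_eq_iff\<close>)
    have "card {k\<in>C. nb0 k x \<in> ?B} \<le> card (?B \<inter> V) + 1"
      by (rule card_colors_le[OF cs0 finV finC cardC x])
    moreover have "?B \<inter> V = ?B" by auto
    ultimately have 1: "real (card {k\<in>C. nb0 k x \<in> ?B}) \<le> s + 1" using B P_vertex[OF x] by simp
    have 2: "real (card {k\<in>C. (x, k) \<in> X}) \<le> 10" using X_vertex[OF x] by simp
    have "{k\<in>C. wrong nb0 x k} \<subseteq> {k\<in>C. (x, k) \<in> X} \<union> {k\<in>C. nb0 k x \<in> ?B}"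
      using csysD(1)[OF cs0 _ x] by (auto simp: wr)
    from card_subset_real[OF this _ card_Un_real[OF 2 1]] show ?thesis using finC by simp
  qed
  have own_s: "real (own (dom P) x) \<le> s" if "x \<in> V" for x
    using P_vertex[OF that] by (simp add: own_def)
  have pv: "pot_v (dom P) nb0 x \<le> r" if x: "x \<in> V" for x
  proof -
    have "real (load (dom P) nb0 x) \<le> s" using P_load[OF x] by (simp add: load_def pd_def)
    then have "pot_v (dom P) nb0 x \<le> (11 + s) + 40 * (s + s)"
      using own_s[OF x] wv[OF x] unfolding pot_v_def by simp
    also have "\<dots> \<le> r" using s r_big by simp
    finally show ?thesis .
  qed
  have pc: "pot_c (dom P) nb0 k \<le> r" if k: "k \<in> C" for k
  proof -
    have 1: "real (card {x\<in>V. (x, k) \<in> X}) \<le> 10" using X_color[OF k] by simp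
    have "{x\<in>V. wrong nb0 x k} \<subseteq> {x\<in>V. (x, k) \<in> X} \<union> {x\<in>V. {x, nb0 k x} \<in> dom P}" by (auto simp: wr)
    from card_subset_real[OF this _ card_Un_real[OF 1 P_class[OF k]]]
    have "real (card {x\<in>V. wrong nb0 x k}) \<le> 10 + s" using finV by simp
    moreover have "real (target (dom P) k) \<le> s" using P_color[OF k] by (simp add: target_def)
    moreover have "real (current (dom P) nb0 k) \<le> s" using P_class[OF k] by (simp add: current_def)
    ultimately have "pot_c (dom P) nb0 k \<le> (10 + s) + 80 * (s + s)" unfolding pot_c_def by simp
    also have "\<dots> \<le> r" using s r_big by simp
    finally show ?thesis .
  qed
  have "real (\<Sum>x\<in>V. card {k\<in>C. wrong nb0 x k}) \<le> (\<Sum>x\<in>V. 11 + s)"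
    unfolding of_nat_sum by (rule sum_mono[OF wv])
  also have "\<dots> = 1000 * r * (11 + s)" using r by simp
  also have "\<dots> \<le> 1000 * r * (2 * s)" using rs_pos s_big by (intro mult_left_mono) auto
  finally have t1: "real (\<Sum>x\<in>V. card {k\<in>C. wrong nb0 x k}) \<le> 2000 * (r * s)" by simp
  have "card (dom P) \<le> (\<Sum>x\<in>V. own (dom P) x)"
  proof -
    have "(\<Sum>e\<in>dom P. 1) \<le> (\<Sum>e\<in>dom P. card {x\<in>V. x \<in> e})"
    proof (rule sum_mono)
      fix e assume "e \<in> dom P"
      then obtain x where "x \<in> V" "x \<in> e" using P_dom by blast
      then have "{x\<in>V. x \<in> e} \<noteq> {}" by blast
      then show "1 \<le> card {x\<in>V. x \<in> e}" using finV by (simp add: Suc_le_eq card_gt_0_iff)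
    qed
    also have "\<dots> = (\<Sum>x\<in>V. own (dom P) x)"
      unfolding own_def by (rule double_count[OF finV dom_fin, symmetric])
    finally show ?thesis by simp
  qed
  then have "real (card (dom P)) \<le> (\<Sum>x\<in>V. real (own (dom P) x))"
    unfolding of_nat_sum[symmetric] by (rule of_nat_mono)
  also have "\<dots> \<le> (\<Sum>x\<in>V. s)" using own_s by (intro sum_mono) auto
  also have "\<dots> = 1000 * (r * s)" using r by simp
  finally have t2: "real (card (dom P)) \<le> 1000 * (r * s)" .
  have tot: "real ((\<Sum>x\<in>V. card {k\<in>C. wrong nb0 x k}) + 80 * card (dom P)) \<le> 82000 * r * s"
    using t1 t2 by simp
  show ?thesis unfolding state_ok_def
    by (intro conjI cs0 ballI impI pv pc tot) (use P_conflict in auto)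
qed

lemma state_ok_reach:
  assumes "state_ok E nb"
  shows "\<exists>nb'. state_ok {} nb'"
proof -
  have "finite E" using assms finite_subset[OF _ dom_fin] by (auto simp: state_ok_def)
  then show ?thesis using assms
  proof (induction "card E" arbitrary: E nb)
    case 0
    then show ?case by auto
  next
    case (Suc n)
    then obtain e where e: "e \<in> E" by fastforce
    then obtain nb' where "state_ok (E - {e}) nb'" using state_ok_step[OF Suc.prems(2)] by blast
    moreover have "n = card (E - {e})" "finite (E - {e})" using Suc.hyps(2) e Suc.prems(1) by auto
    ultimately show ?case using Suc.hyps(1) by blast
  qed
qed

lemma extension:
  obtains nb where "csys V C nb"
    "\<And>x y. x \<in> V \<Longrightarrow> y \<in> V \<Longrightarrow> {x, y} \<in> dom P \<Longrightarrow> nb (the (P {x, y})) x = y"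
    "\<And>x k. x \<in> V \<Longrightarrow> k \<in> C \<Longrightarrow> {x, nb k x} \<notin> dom P \<Longrightarrow> k \<notin> L {x, nb k x}"
proof -
  obtain nb where "state_ok {} nb" using state_ok_reach[OF state_ok_initial] by blast
  from state_okD[OF this] show ?thesis using that[of nb] by simp
qed

end

section \<open>Random permutations\<close>

lemma card_perms_agree:
  assumes "finite S" "T \<subseteq> S"
  shows "card {\<pi>. \<pi> permutes S \<and> (\<forall>z\<in>T. \<pi> z = g z)} \<le> fact (card S - card T)"
proof (cases "{\<pi>. \<pi> permutes S \<and> (\<forall>z\<in>T. \<pi> z = g z)} = {}")
  case True
  show ?thesis unfolding True by simp
next
  case False
  then obtain \<pi>0 where \<pi>0: "\<pi>0 permutes S" "\<forall>z\<in>T. \<pi>0 z = g z" by blast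
  have fT: "finite T" using assms finite_subset by blast
  have "card {\<pi>. \<pi> permutes S \<and> (\<forall>z\<in>T. \<pi> z = g z)} \<le> card {\<sigma>. \<sigma> permutes (S - T)}"
  proof (rule card_inj_on_le[of "\<lambda>\<pi>. inv \<pi>0 \<circ> \<pi>"])
    show "inj_on (\<lambda>\<pi>. inv \<pi>0 \<circ> \<pi>) {\<pi>. \<pi> permutes S \<and> (\<forall>z\<in>T. \<pi> z = g z)}"
    proof (rule inj_onI)
      fix \<pi> \<pi>' assume "inv \<pi>0 \<circ> \<pi> = inv \<pi>0 \<circ> \<pi>'"
      then have "\<pi>0 \<circ> (inv \<pi>0 \<circ> \<pi>) = \<pi>0 \<circ> (inv \<pi>0 \<circ> \<pi>')" by simp
      then show "\<pi> = \<pi>'" using permutes_inv_o(1)[OF \<pi>0(1)] by (simp add: o_assoc)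
    qed
    show "(\<lambda>\<pi>. inv \<pi>0 \<circ> \<pi>) ` {\<pi>. \<pi> permutes S \<and> (\<forall>z\<in>T. \<pi> z = g z)} \<subseteq> {\<sigma>. \<sigma> permutes (S - T)}"
    proof clarify
      fix \<pi> assume \<pi>: "\<pi> permutes S" "\<forall>z\<in>T. \<pi> z = g z"
      have "(inv \<pi>0 \<circ> \<pi>) permutes S" by (rule permutes_compose[OF \<pi>(1) permutes_inv[OF \<pi>0(1)]])
      moreover have "(inv \<pi>0 \<circ> \<pi>) x = x" if "x \<in> S - (S - T)" for x
        using that \<pi>(2) \<pi>0(2) permutes_inverses(2)[OF \<pi>0(1), of x] by auto
      ultimately show "(inv \<pi>0 \<circ> \<pi>) permutes (S - T)" by (rule permutes_superset)
    qed
    show "finite {\<sigma>. \<sigma> permutes (S - T)}" using assms by (simp add: finite_permutations)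
  qed
  also have "\<dots> = fact (card (S - T))" using assms by (simp add: card_permutations)
  also have "card (S - T) = card S - card T" using assms fT by (simp add: card_Diff_subset)
  finally show ?thesis .
qed

lemma card_perms_into:
  assumes S: "finite S" and T: "T \<subseteq> S" and W: "\<And>z. z \<in> T \<Longrightarrow> finite (W z) \<and> card (W z) \<le> w"
  shows "card {\<pi>. \<pi> permutes S \<and> (\<forall>z\<in>T. \<pi> z \<in> W z)} \<le> w ^ card T * fact (card S - card T)"
proof -
  have fT: "finite T" using S T finite_subset by blast
  have fP: "finite (PiE T W)" using fT W by (intro finite_PiE) auto
  have fU: "finite (\<Union>g\<in>PiE T W. {\<pi>. \<pi> permutes S \<and> (\<forall>z\<in>T. \<pi> z = g z)})"
    using fP finite_permutations[OF S] by auto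
  have "{\<pi>. \<pi> permutes S \<and> (\<forall>z\<in>T. \<pi> z \<in> W z)}
    \<subseteq> (\<Union>g\<in>PiE T W. {\<pi>. \<pi> permutes S \<and> (\<forall>z\<in>T. \<pi> z = g z)})"
  proof clarify
    fix \<pi> assume "\<pi> permutes S" "\<forall>z\<in>T. \<pi> z \<in> W z"
    then show "\<pi> \<in> (\<Union>g\<in>PiE T W. {\<pi>. \<pi> permutes S \<and> (\<forall>z\<in>T. \<pi> z = g z)})"
      by (intro UN_I[of "restrict \<pi> T"]) auto
  qed
  then have "card {\<pi>. \<pi> permutes S \<and> (\<forall>z\<in>T. \<pi> z \<in> W z)}
    \<le> card (\<Union>g\<in>PiE T W. {\<pi>. \<pi> permutes S \<and> (\<forall>z\<in>T. \<pi> z = g z)})"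
    by (intro card_mono fU)
  also have "\<dots> \<le> (\<Sum>g\<in>PiE T W. card {\<pi>. \<pi> permutes S \<and> (\<forall>z\<in>T. \<pi> z = g z)})"
    by (rule card_UN_le[OF fP])
  also have "\<dots> \<le> (\<Sum>g\<in>PiE T W. fact (card S - card T))"
    by (intro sum_mono card_perms_agree[OF S T])
  also have "\<dots> = card (PiE T W) * fact (card S - card T)" by simp
  also have "card (PiE T W) = (\<Prod>z\<in>T. card (W z))" by (rule card_PiE[OF fT])
  also have "\<dots> \<le> (\<Prod>z\<in>T. w)" using W by (intro prod_mono) auto
  also have "\<dots> = w ^ card T" by simp
  finally show ?thesis by simp
qed

text \<open>A union bound over the \<open>k\<close>-subsets of \<open>S\<close>: there are n choose
  k of them, each contained in the hit set for at most \<open>w ^ k\<close> times (n - k)!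
  permutations, where n is \<open>card S\<close>. The probability of \<open>k\<close> hits is thus
  at most \<open>w ^ k / fact k\<close>, stated without division.\<close>

lemma card_perms_many_hits:
  assumes S: "finite S" and W: "\<And>z. z \<in> S \<Longrightarrow> card (W z \<inter> S) \<le> w"
  shows "card {\<pi>. \<pi> permutes S \<and> k \<le> card {z\<in>S. \<pi> z \<in> W z}} * fact k \<le> w ^ k * fact (card S)"
proof (cases "k \<le> card S")
  case False
  have "card {z\<in>S. \<pi> z \<in> W z} \<le> card S" for \<pi> using S by (intro card_mono) auto
  then have "{\<pi>. \<pi> permutes S \<and> k \<le> card {z\<in>S. \<pi> z \<in> W z}} = {}" using False order_trans by blast
  then show ?thesis by (simp only: card.empty)
next
  case k: True
  let ?T = "{T. T \<subseteq> S \<and> card T = k}"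
  have fT: "finite ?T" using S by simp
  have fU: "finite (\<Union>T\<in>?T. {\<pi>. \<pi> permutes S \<and> (\<forall>z\<in>T. \<pi> z \<in> W z \<inter> S)})"
    using fT finite_permutations[OF S] by auto
  have sub: "{\<pi>. \<pi> permutes S \<and> k \<le> card {z\<in>S. \<pi> z \<in> W z}}
    \<subseteq> (\<Union>T\<in>?T. {\<pi>. \<pi> permutes S \<and> (\<forall>z\<in>T. \<pi> z \<in> W z \<inter> S)})"
  proof clarify
    fix \<pi> assume \<pi>: "\<pi> permutes S" "k \<le> card {z\<in>S. \<pi> z \<in> W z}"
    then obtain T where T: "T \<subseteq> {z\<in>S. \<pi> z \<in> W z}" "card T = k"
      using obtain_subset_with_card_n by metis
    then show "\<pi> \<in> (\<Union>T\<in>?T. {\<pi>. \<pi> permutes S \<and> (\<forall>z\<in>T. \<pi> z \<in> W z \<inter> S)})"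
      using \<pi>(1) permutes_in_image[OF \<pi>(1)] by (intro UN_I[of T]) auto
  qed
  have "card {\<pi>. \<pi> permutes S \<and> k \<le> card {z\<in>S. \<pi> z \<in> W z}}
    \<le> card (\<Union>T\<in>?T. {\<pi>. \<pi> permutes S \<and> (\<forall>z\<in>T. \<pi> z \<in> W z \<inter> S)})"
    by (rule card_mono[OF fU sub])
  also have "\<dots> \<le> (\<Sum>T\<in>?T. card {\<pi>. \<pi> permutes S \<and> (\<forall>z\<in>T. \<pi> z \<in> W z \<inter> S)})"
    by (rule card_UN_le[OF fT])
  also have "\<dots> \<le> (\<Sum>T\<in>?T. w ^ k * fact (card S - k))"
  proof (rule sum_mono)
    fix T assume "T \<in> ?T"
    then have T: "T \<subseteq> S" "card T = k" by auto
    have "card {\<pi>. \<pi> permutes S \<and> (\<forall>z\<in>T. \<pi> z \<in> W z \<inter> S)} \<le> w ^ card T * fact (card S - card T)"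
      by (rule card_perms_into[OF S T(1)]) (use W T S in auto)
    then show "card {\<pi>. \<pi> permutes S \<and> (\<forall>z\<in>T. \<pi> z \<in> W z \<inter> S)} \<le> w ^ k * fact (card S - k)"
      using T by simp
  qed
  also have "\<dots> = (card S choose k) * (w ^ k * fact (card S - k))" using n_subsets[OF S] by simp
  finally have "card {\<pi>. \<pi> permutes S \<and> k \<le> card {z\<in>S. \<pi> z \<in> W z}} * fact k
    \<le> (card S choose k) * (w ^ k * fact (card S - k)) * fact k" by (rule mult_le_mono1)
  also have "\<dots> = w ^ k * (fact k * fact (card S - k) * (card S choose k))" by simp
  also have "fact k * fact (card S - k) * (card S choose k) = fact (card S)"
    by (rule binomial_fact_lemma[OF k])
  finally show ?thesis .
qed

text \<open>Composing with a random permutation of \<open>S\<close> preserves the uniform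
  distribution, so it suffices to bound the conditional probability once everything outside
  \<open>S\<close> is placed. This removes the dependence between the two ends of an edge.\<close>

lemma card_perms_coset:
  fixes a b :: nat
  assumes V: "finite V" and S: "S \<subseteq> V"
    and coset: "\<And>\<pi>. \<pi> permutes V \<Longrightarrow> card {\<sigma>. \<sigma> permutes S \<and> B (\<pi> \<circ> \<sigma>)} * a \<le> b * fact (card S)"
  shows "card {\<pi>. \<pi> permutes V \<and> B \<pi>} * a \<le> b * fact (card V)"
proof -
  have fS: "finite S" using V S finite_subset by blast
  let ?PV = "{\<pi>. \<pi> permutes V}" and ?PS = "{\<sigma>. \<sigma> permutes S}"
  have f: "finite ?PV" "finite ?PS" using V fS by (auto intro: finite_permutations)
  have shift: "card {\<pi>\<in>?PV. B (\<pi> \<circ> \<sigma>)} = card {\<pi>\<in>?PV. B \<pi>}" if "\<sigma> \<in> ?PS" for \<sigma>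
  proof (rule bij_betw_same_card[of "\<lambda>\<pi>. \<pi> \<circ> \<sigma>"], rule bij_betw_byWitness[where f' = "\<lambda>\<pi>. \<pi> \<circ> inv \<sigma>"])
    have \<sigma>: "\<sigma> permutes V" using that S by (auto intro: permutes_subset)
    show "\<forall>\<pi>\<in>{\<pi>\<in>?PV. B (\<pi> \<circ> \<sigma>)}. \<pi> \<circ> \<sigma> \<circ> inv \<sigma> = \<pi>"
      using permutes_inv_o(1)[OF \<sigma>] by (simp add: o_assoc[symmetric])
    show "\<forall>\<pi>\<in>{\<pi>\<in>?PV. B \<pi>}. \<pi> \<circ> inv \<sigma> \<circ> \<sigma> = \<pi>"
      using permutes_inv_o(2)[OF \<sigma>] by (simp add: o_assoc[symmetric])
    show "(\<lambda>\<pi>. \<pi> \<circ> \<sigma>) ` {\<pi>\<in>?PV. B (\<pi> \<circ> \<sigma>)} \<subseteq> {\<pi>\<in>?PV. B \<pi>}"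
      using permutes_compose[OF \<sigma>] by auto
    show "(\<lambda>\<pi>. \<pi> \<circ> inv \<sigma>) ` {\<pi>\<in>?PV. B \<pi>} \<subseteq> {\<pi>\<in>?PV. B (\<pi> \<circ> \<sigma>)}"
      using permutes_compose[OF permutes_inv[OF \<sigma>]] permutes_inv_o(2)[OF \<sigma>]
      by (auto simp: o_assoc[symmetric])
  qed
  have "fact (card S) * card {\<pi>\<in>?PV. B \<pi>} = (\<Sum>\<sigma>\<in>?PS. card {\<pi>\<in>?PV. B (\<pi> \<circ> \<sigma>)})"
    using shift card_permutations[OF refl fS] by simp
  also have "\<dots> = (\<Sum>\<pi>\<in>?PV. card {\<sigma>\<in>?PS. B (\<pi> \<circ> \<sigma>)})"
    by (rule double_count[OF f(2,1)])
  finally have "fact (card S) * card {\<pi>\<in>?PV. B \<pi>} * a = (\<Sum>\<pi>\<in>?PV. card {\<sigma>\<in>?PS. B (\<pi> \<circ> \<sigma>)} * a)"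
    by (simp add: sum_distrib_right)
  also have "\<dots> \<le> (\<Sum>\<pi>\<in>?PV. b * fact (card S))"
    using coset by (intro sum_mono) auto
  also have "\<dots> = fact (card S) * (b * fact (card V))"
    using card_permutations[OF refl V] by simp
  finally have "fact (card S) * (card {\<pi>\<in>?PV. B \<pi>} * a) \<le> fact (card S) * (b * fact (card V))"
    by (simp only: mult.assoc)
  then have "card {\<pi>\<in>?PV. B \<pi>} * a \<le> b * fact (card V)" by (simp only: mult_le_cancel1 fact_gt_zero simp_thms)
  then show ?thesis by simp
qed

text \<open>One term of the exponential series at \<open>k\<close>, together with e at most
  3.\<close>

lemma power_le_fact: "real k ^ k \<le> 3 ^ k * fact k"
proof -
  have "(\<Sum>n\<in>{k}. real k ^ n /\<^sub>R fact n) \<le> (\<Sum>n. real k ^ n /\<^sub>R fact n)"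
    by (rule sum_le_suminf[OF summable_exp_generic]) auto
  then have "real k ^ k / fact k \<le> exp (real k)" by (simp add: exp_def divide_inverse mult.commute)
  also have "\<dots> = exp 1 ^ k" by (simp add: exp_of_nat_mult[symmetric])
  also have "\<dots> \<le> 3 ^ k" by (intro power_mono exp_le) simp
  finally show ?thesis by (simp add: field_simps)
qed

text \<open>From \<open>(24 * w) ^ k \<le> k ^ k \<le> 3 ^ k * fact k\<close> follows
  \<open>(8 * w) ^ k \<le> fact k\<close>. Halving the base leaves a factor \<open>2 ^ k\<close>,
  which pays for the number of events.\<close>

lemma fact_dominates:
  assumes "24 * w \<le> k" "2 * N < 2 ^ k" "w \<ge> 1"
  shows "2 * N * (4 * w) ^ k < fact k"
proof -
  have "3 ^ k * (8 * w) ^ k = (24 * w) ^ k"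
    unfolding power_mult_distrib[symmetric] by simp
  also have "\<dots> \<le> k ^ k" using assms(1) by (rule power_mono) simp
  also have "k ^ k \<le> 3 ^ k * fact k"
  proof -
    have "real (k ^ k) \<le> real (3 ^ k * fact k)" using power_le_fact[of k] by simp
    then show ?thesis by (simp only: of_nat_le_iff)
  qed
  finally have "(8 * w) ^ k \<le> fact k" by simp
  moreover have "(8 * w) ^ k = 2 ^ k * (4 * w) ^ k"
    unfolding power_mult_distrib[symmetric] by simp
  moreover have "2 * N * (4 * w) ^ k < 2 ^ k * (4 * w) ^ k"
    using assms(2,3) by (intro mult_strict_right_mono) auto
  ultimately show ?thesis by linarith
qed

lemma card_permuted:
  assumes "\<pi> permutes V"
  shows "card {z\<in>V. P (\<pi> z)} = card {y\<in>V. P y}"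
proof (rule bij_betw_same_card[of \<pi>], rule bij_betw_imageI)
  show "inj_on \<pi> {z\<in>V. P (\<pi> z)}" using permutes_inj[OF assms] by (rule inj_on_subset) simp
  show "\<pi> ` {z\<in>V. P (\<pi> z)} = {y\<in>V. P y}"
  proof
    show "\<pi> ` {z\<in>V. P (\<pi> z)} \<subseteq> {y\<in>V. P y}" using permutes_in_image[OF assms] by auto
    show "{y\<in>V. P y} \<subseteq> \<pi> ` {z\<in>V. P (\<pi> z)}"
    proof
      fix y assume y: "y \<in> {y\<in>V. P y}"
      then have "y = \<pi> (inv \<pi> y)" "inv \<pi> y \<in> V"
        using permutes_inverses(1)[OF assms] permutes_in_image[OF permutes_inv[OF assms]] by auto
      then show "y \<in> \<pi> ` {z\<in>V. P (\<pi> z)}" using y by (intro image_eqI[of _ _ "inv \<pi> y"]) auto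
    qed
  qed
qed

section \<open>Tail bounds for a random placement of the vertices\<close>

locale placement =
  fixes V :: "'v::linorder set" and C :: "'c set" and nb :: "'c \<Rightarrow> 'v \<Rightarrow> 'v"
    and L :: "'v set \<Rightarrow> 'c set" and D :: "'v set set" and pd :: "'v \<Rightarrow> 'c \<Rightarrow> bool" and w k :: nat
  assumes finV: "finite V" and finC: "finite C" and cardC: "card C \<le> card V"
    and cs: "csys V C nb"
    and L_vertex: "x \<in> V \<Longrightarrow> c \<in> C \<Longrightarrow> card {y\<in>V. y \<noteq> x \<and> c \<in> L {x, y}} \<le> w"
    and D_vertex: "x \<in> V \<Longrightarrow> card {y\<in>V. y \<noteq> x \<and> {x, y} \<in> D} \<le> w"
    and pd_color: "c \<in> C \<Longrightarrow> card {x\<in>V. pd x c} \<le> w"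
    and wk: "24 * w \<le> k" "2 * card V < 2 ^ k" "w \<ge> 1"
begin

definition bad_vertex where
  "bad_vertex x \<pi> \<longleftrightarrow> 2 * k < card {c\<in>C. c \<in> L {\<pi> x, \<pi> (nb c x)} \<or> pd (\<pi> (nb c x)) c}"

definition bad_color where
  "bad_color c \<pi> \<longleftrightarrow> 2 * k < card {x\<in>V. c \<in> L {\<pi> x, \<pi> (nb c x)} \<or> {\<pi> x, \<pi> (nb c x)} \<in> D}"

text \<open>With the image of \<open>x\<close> fixed, only the images of its neighbors are random.
  At most two colors lead from \<open>x\<close> to \<open>z\<close>, and each forbids at most
  \<open>w\<close> places by the lists and \<open>w\<close> by the precoloring, whence
  \<open>4 * w\<close>.\<close>

lemma card_bad_vertex:
  assumes x: "x \<in> V"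
  shows "card {\<pi>. \<pi> permutes V \<and> bad_vertex x \<pi>} * fact k \<le> (4 * w) ^ k * fact (card V)"
proof (rule card_perms_coset[OF finV, of "V - {x}"])
  show "V - {x} \<subseteq> V" by auto
  fix \<pi> assume \<pi>: "\<pi> permutes V"
  define W where "W = (\<lambda>z. {z'\<in>V. \<exists>c\<in>C. nb c x = z \<and> (c \<in> L {\<pi> x, \<pi> z'} \<or> pd (\<pi> z') c)})"
  have fS: "finite (V - {x})" using finV by simp
  have \<pi>x: "\<pi> x \<in> V" using permutes_in_image[OF \<pi>] x by simp
  have Wc: "card (W z \<inter> (V - {x})) \<le> 4 * w" for z
  proof -
    let ?K = "{c\<in>C. nb c x \<in> {z}}"
    have fK: "finite ?K" using finC by simp
    have "card ?K \<le> card ({z} \<inter> V) + 1" by (rule card_colors_le[OF cs finV finC cardC x])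
    also have "card ({z} \<inter> V) \<le> 1" by (rule order_trans[OF card_mono[of "{z}"]]) auto
    finally have K2: "card ?K \<le> 2" by simp
    have each: "card ({z'\<in>V. \<pi> z' \<noteq> \<pi> x \<and> c \<in> L {\<pi> x, \<pi> z'}} \<union> {z'\<in>V. pd (\<pi> z') c}) \<le> 2 * w"
      if c: "c \<in> ?K" for c
    proof -
      have cC: "c \<in> C" using c by simp
      have "card {z'\<in>V. \<pi> z' \<noteq> \<pi> x \<and> c \<in> L {\<pi> x, \<pi> z'}} \<le> w"
        using card_permuted[OF \<pi>, of "\<lambda>y. y \<noteq> \<pi> x \<and> c \<in> L {\<pi> x, y}"] L_vertex[OF \<pi>x cC] by simp
      moreover have "card {z'\<in>V. pd (\<pi> z') c} \<le> w"
        using card_permuted[OF \<pi>, of "\<lambda>y. pd y c"] pd_color[OF cC] by simp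
      ultimately show ?thesis
        using card_Un_le[of "{z'\<in>V. \<pi> z' \<noteq> \<pi> x \<and> c \<in> L {\<pi> x, \<pi> z'}}" "{z'\<in>V. pd (\<pi> z') c}"] by linarith
    qed
    have "W z \<inter> (V - {x}) \<subseteq>
      (\<Union>c\<in>?K. {z'\<in>V. \<pi> z' \<noteq> \<pi> x \<and> c \<in> L {\<pi> x, \<pi> z'}} \<union> {z'\<in>V. pd (\<pi> z') c})"
    proof
      fix z' assume z': "z' \<in> W z \<inter> (V - {x})"
      then have "\<pi> z' \<noteq> \<pi> x" using permutes_inj[OF \<pi>] by (auto dest: injD)
      then show "z' \<in> (\<Union>c\<in>?K. {z'\<in>V. \<pi> z' \<noteq> \<pi> x \<and> c \<in> L {\<pi> x, \<pi> z'}} \<union> {z'\<in>V. pd (\<pi> z') c})"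
        using z' unfolding W_def by blast
    qed
    then have "card (W z \<inter> (V - {x})) \<le>
      card (\<Union>c\<in>?K. {z'\<in>V. \<pi> z' \<noteq> \<pi> x \<and> c \<in> L {\<pi> x, \<pi> z'}} \<union> {z'\<in>V. pd (\<pi> z') c})"
      using fK finV by (intro card_mono) auto
    also have "\<dots> \<le> (\<Sum>c\<in>?K. card ({z'\<in>V. \<pi> z' \<noteq> \<pi> x \<and> c \<in> L {\<pi> x, \<pi> z'}} \<union> {z'\<in>V. pd (\<pi> z') c}))"
      by (rule card_UN_le[OF fK])
    also have "\<dots> \<le> (\<Sum>c\<in>?K. 2 * w)" by (rule sum_mono[OF each])
    also have "\<dots> = card ?K * (2 * w)" by simp
    also have "\<dots> \<le> 2 * (2 * w)" using K2 by (rule mult_le_mono1)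
    finally show ?thesis by simp
  qed
  have sub: "{\<sigma>. \<sigma> permutes (V - {x}) \<and> bad_vertex x (\<pi> \<circ> \<sigma>)}
    \<subseteq> {\<sigma>. \<sigma> permutes (V - {x}) \<and> k \<le> card {z\<in>V - {x}. \<sigma> z \<in> W z}}"
  proof (intro subsetI CollectI conjI; elim CollectE conjE)
    fix \<sigma> assume \<sigma>: "\<sigma> permutes (V - {x})" and b: "bad_vertex x (\<pi> \<circ> \<sigma>)"
    show "\<sigma> permutes (V - {x})" by (rule \<sigma>)
    have \<sigma>x: "\<sigma> x = x" using permutes_not_in[OF \<sigma>] by simp
    let ?Z = "{z\<in>V - {x}. \<sigma> z \<in> W z}"
    have "{c\<in>C. c \<in> L {(\<pi> \<circ> \<sigma>) x, (\<pi> \<circ> \<sigma>) (nb c x)} \<or> pd ((\<pi> \<circ> \<sigma>) (nb c x)) c} \<subseteq> {c\<in>C. nb c x \<in> ?Z}"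
    proof
      fix c assume c: "c \<in> {c\<in>C. c \<in> L {(\<pi> \<circ> \<sigma>) x, (\<pi> \<circ> \<sigma>) (nb c x)} \<or> pd ((\<pi> \<circ> \<sigma>) (nb c x)) c}"
      then have n: "nb c x \<in> V - {x}" using csysD[OF cs _ x] by auto
      then have "\<sigma> (nb c x) \<in> V - {x}" using permutes_in_image[OF \<sigma>] by blast
      then have "\<sigma> (nb c x) \<in> W (nb c x)" using c \<sigma>x unfolding W_def by auto
      then show "c \<in> {c\<in>C. nb c x \<in> ?Z}" using c n by auto
    qed
    then have "card {c\<in>C. c \<in> L {(\<pi> \<circ> \<sigma>) x, (\<pi> \<circ> \<sigma>) (nb c x)} \<or> pd ((\<pi> \<circ> \<sigma>) (nb c x)) c}
      \<le> card {c\<in>C. nb c x \<in> ?Z}" using finC by (intro card_mono) auto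
    also have "\<dots> \<le> card (?Z \<inter> V) + 1" by (rule card_colors_le[OF cs finV finC cardC x])
    also have "?Z \<inter> V = ?Z" by auto
    finally have "2 * k < card ?Z + 1" using b by (simp add: bad_vertex_def)
    then show "k \<le> card ?Z" by linarith
  qed
  have "card {\<sigma>. \<sigma> permutes (V - {x}) \<and> bad_vertex x (\<pi> \<circ> \<sigma>)}
    \<le> card {\<sigma>. \<sigma> permutes (V - {x}) \<and> k \<le> card {z\<in>V - {x}. \<sigma> z \<in> W z}}"
    by (rule card_mono[OF _ sub]) (use finite_permutations[OF fS] in simp)
  then have "card {\<sigma>. \<sigma> permutes (V - {x}) \<and> bad_vertex x (\<pi> \<circ> \<sigma>)} * fact k
    \<le> card {\<sigma>. \<sigma> permutes (V - {x}) \<and> k \<le> card {z\<in>V - {x}. \<sigma> z \<in> W z}} * fact k"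
    by (rule mult_le_mono1)
  also have "\<dots> \<le> (4 * w) ^ k * fact (card (V - {x}))"
    by (rule card_perms_many_hits[OF fS Wc])
  finally show "card {\<sigma>. \<sigma> permutes (V - {x}) \<and> bad_vertex x (\<pi> \<circ> \<sigma>)} * fact k
    \<le> (4 * w) ^ k * fact (card (V - {x}))" .
qed

text \<open>With one end of every edge of the color class fixed, the other ends are permuted among
  themselves, and each has at most \<open>2 * w\<close> forbidden places. An edge is counted at both
  ends, which explains the threshold \<open>2 * k\<close>.\<close>

lemma card_bad_color:
  assumes c: "c \<in> C"
  shows "card {\<pi>. \<pi> permutes V \<and> bad_color c \<pi>} * fact k \<le> (4 * w) ^ k * fact (card V)"
proof -
  \<comment> \<open>The linear order selects one end of each edge of color \<open>c\<close>.\<close>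
  define Y where "Y = {x\<in>V. x < nb c x}"
  note N = csysD[OF cs c]
  have YV: "Y \<subseteq> V" by (auto simp: Y_def)
  have fY: "finite Y" using YV finV finite_subset by blast
  have nY: "nb c y \<in> V" "nb c y \<notin> Y" if "y \<in> Y" for y
    using that N[of y] by (auto simp: Y_def)
  show ?thesis
  proof (rule card_perms_coset[OF finV YV])
    fix \<pi> assume \<pi>: "\<pi> permutes V"
    define W where "W = (\<lambda>y. {z. c \<in> L {\<pi> (nb c y), \<pi> z} \<or> {\<pi> (nb c y), \<pi> z} \<in> D})"
    have Wc: "card (W y \<inter> Y) \<le> 4 * w" if y: "y \<in> Y" for y
    proof -
      let ?q = "\<pi> (nb c y)"
      have q: "?q \<in> V" using permutes_in_image[OF \<pi>] nY[OF y] by simp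
      have "W y \<inter> Y \<subseteq> {z\<in>V. \<pi> z \<noteq> ?q \<and> c \<in> L {?q, \<pi> z}} \<union> {z\<in>V. \<pi> z \<noteq> ?q \<and> {?q, \<pi> z} \<in> D}"
      proof
        fix z assume z: "z \<in> W y \<inter> Y"
        then have "\<pi> z \<noteq> ?q" using permutes_inj[OF \<pi>] nY[OF y] by (auto dest: injD)
        then show "z \<in> {z\<in>V. \<pi> z \<noteq> ?q \<and> c \<in> L {?q, \<pi> z}} \<union> {z\<in>V. \<pi> z \<noteq> ?q \<and> {?q, \<pi> z} \<in> D}"
          using z YV unfolding W_def by auto
      qed
      then have "card (W y \<inter> Y)
        \<le> card ({z\<in>V. \<pi> z \<noteq> ?q \<and> c \<in> L {?q, \<pi> z}} \<union> {z\<in>V. \<pi> z \<noteq> ?q \<and> {?q, \<pi> z} \<in> D})"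
        using finV by (intro card_mono) auto
      also have "\<dots> \<le> card {z\<in>V. \<pi> z \<noteq> ?q \<and> c \<in> L {?q, \<pi> z}} + card {z\<in>V. \<pi> z \<noteq> ?q \<and> {?q, \<pi> z} \<in> D}"
        by (rule card_Un_le)
      also have "\<dots> \<le> w + w"
        using card_permuted[OF \<pi>, of "\<lambda>z. z \<noteq> ?q \<and> c \<in> L {?q, z}"] L_vertex[OF q c]
          card_permuted[OF \<pi>, of "\<lambda>z. z \<noteq> ?q \<and> {?q, z} \<in> D"] D_vertex[OF q] by simp
      finally show ?thesis by simp
    qed
    have sub: "{\<sigma>. \<sigma> permutes Y \<and> bad_color c (\<pi> \<circ> \<sigma>)}
      \<subseteq> {\<sigma>. \<sigma> permutes Y \<and> k \<le> card {y\<in>Y. \<sigma> y \<in> W y}}"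
    proof (intro subsetI CollectI conjI; elim CollectE conjE)
      fix \<sigma> assume \<sigma>: "\<sigma> permutes Y" and b: "bad_color c (\<pi> \<circ> \<sigma>)"
      show "\<sigma> permutes Y" by (rule \<sigma>)
      let ?R = "\<lambda>x. c \<in> L {\<pi> (\<sigma> x), \<pi> (\<sigma> (nb c x))} \<or> {\<pi> (\<sigma> x), \<pi> (\<sigma> (nb c x))} \<in> D"
      let ?H = "{y\<in>Y. \<sigma> y \<in> W y}"
      have HR: "y \<in> ?H" if "y \<in> Y" "?R y" for y
      proof -
        have "\<sigma> (nb c y) = nb c y" using permutes_not_in[OF \<sigma> nY(2)[OF that(1)]] .
        then show ?thesis using that by (auto simp: W_def insert_commute)
      qed
      have "{x\<in>V. ?R x} \<subseteq> ?H \<union> nb c ` ?H"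
      proof
        fix x assume x: "x \<in> {x\<in>V. ?R x}"
        show "x \<in> ?H \<union> nb c ` ?H"
        proof (cases "x \<in> Y")
          case True
          then show ?thesis using HR x by blast
        next
          case False
          have xV: "x \<in> V" using x by simp
          have "nb c x < x" using False xV N(2)[OF xV] by (auto simp: Y_def)
          then have "nb c x \<in> Y" using N(1,3)[OF xV] by (simp add: Y_def)
          moreover have "?R (nb c x)" using x N(3)[OF xV] by (auto simp: insert_commute)
          ultimately have "nb c x \<in> ?H" by (rule HR)
          then have "nb c (nb c x) \<in> nb c ` ?H" by (rule imageI)
          then show ?thesis using N(3)[OF xV] by simp
        qed
      qed
      then have "card {x\<in>V. ?R x} \<le> card (?H \<union> nb c ` ?H)" using fY by (intro card_mono) auto
      also have "\<dots> \<le> card ?H + card (nb c ` ?H)" by (rule card_Un_le)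
      also have "card (nb c ` ?H) \<le> card ?H" using fY by (intro card_image_le) auto
      finally have "2 * k < card ?H + card ?H" using b by (simp add: bad_color_def)
      then show "k \<le> card ?H" by linarith
    qed
    have "card {\<sigma>. \<sigma> permutes Y \<and> bad_color c (\<pi> \<circ> \<sigma>)}
      \<le> card {\<sigma>. \<sigma> permutes Y \<and> k \<le> card {y\<in>Y. \<sigma> y \<in> W y}}"
      by (rule card_mono[OF _ sub]) (use finite_permutations[OF fY] in simp)
    then have "card {\<sigma>. \<sigma> permutes Y \<and> bad_color c (\<pi> \<circ> \<sigma>)} * fact k
      \<le> card {\<sigma>. \<sigma> permutes Y \<and> k \<le> card {y\<in>Y. \<sigma> y \<in> W y}} * fact k"
      by (rule mult_le_mono1)
    also have "\<dots> \<le> (4 * w) ^ k * fact (card Y)"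
      by (rule card_perms_many_hits[OF fY Wc])
    finally show "card {\<sigma>. \<sigma> permutes Y \<and> bad_color c (\<pi> \<circ> \<sigma>)} * fact k
      \<le> (4 * w) ^ k * fact (card Y)" .
  qed
qed

text \<open>There are at most \<open>2 * card V\<close> bad events, each of probability at most
  \<open>(4 * w) ^ k / fact k\<close>, so by \<open>fact_dominates\<close> some permutation avoids
  them all.\<close>

lemma exists_placement:
  obtains \<pi> where "\<pi> permutes V" "\<And>x. x \<in> V \<Longrightarrow> \<not> bad_vertex x \<pi>" "\<And>c. c \<in> C \<Longrightarrow> \<not> bad_color c \<pi>"
proof -
  let ?P = "{\<pi>. \<pi> permutes V}"
  let ?A = "\<Union>x\<in>V. {\<pi>. \<pi> permutes V \<and> bad_vertex x \<pi>}"
  let ?B = "\<Union>c\<in>C. {\<pi>. \<pi> permutes V \<and> bad_color c \<pi>}"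
  have fP: "finite ?P" using finV by (rule finite_permutations)
  have "card ?A \<le> (\<Sum>x\<in>V. card {\<pi>. \<pi> permutes V \<and> bad_vertex x \<pi>})" by (rule card_UN_le[OF finV])
  then have "card ?A * fact k \<le> (\<Sum>x\<in>V. card {\<pi>. \<pi> permutes V \<and> bad_vertex x \<pi>}) * fact k"
    by (rule mult_le_mono1)
  also have "\<dots> \<le> (\<Sum>x\<in>V. (4 * w) ^ k * fact (card V))"
    unfolding sum_distrib_right by (rule sum_mono[OF card_bad_vertex])
  finally have A: "card ?A * fact k \<le> card V * ((4 * w) ^ k * fact (card V))" by simp
  have "card ?B \<le> (\<Sum>c\<in>C. card {\<pi>. \<pi> permutes V \<and> bad_color c \<pi>})" by (rule card_UN_le[OF finC])
  then have "card ?B * fact k \<le> (\<Sum>c\<in>C. card {\<pi>. \<pi> permutes V \<and> bad_color c \<pi>}) * fact k"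
    by (rule mult_le_mono1)
  also have "\<dots> \<le> (\<Sum>c\<in>C. (4 * w) ^ k * fact (card V))"
    unfolding sum_distrib_right by (rule sum_mono[OF card_bad_color])
  also have "\<dots> = card C * ((4 * w) ^ k * fact (card V))" by simp
  also have "\<dots> \<le> card V * ((4 * w) ^ k * fact (card V))" using cardC by (rule mult_le_mono1)
  finally have B: "card ?B * fact k \<le> card V * ((4 * w) ^ k * fact (card V))" .
  have "card (?A \<union> ?B) * fact k \<le> (card ?A + card ?B) * fact k"
    by (rule mult_le_mono1[OF card_Un_le])
  also have "\<dots> \<le> 2 * card V * (4 * w) ^ k * fact (card V)"
    using A B by (simp add: add_mult_distrib)
  also have "\<dots> < fact k * fact (card V)"
    using fact_dominates[OF wk] by (intro mult_strict_right_mono) auto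
  finally have "card (?A \<union> ?B) * fact k < fact (card V) * fact k" by (simp only: mult.commute)
  then have "card (?A \<union> ?B) < card ?P" using card_permutations[OF refl finV] by simp
  moreover have "finite (?A \<union> ?B)" by (rule finite_subset[OF _ fP]) auto
  ultimately have "\<not> ?P \<subseteq> ?A \<union> ?B" using card_mono[of "?A \<union> ?B" ?P] by linarith
  then obtain \<pi> where "\<pi> \<in> ?P" "\<pi> \<notin> ?A \<union> ?B" by blast
  then show ?thesis using that[of \<pi>] by blast
qed

end

section \<open>Precoloring the conflicting edges\<close>

text \<open>The last four assumptions are what the random placement provides; the preceding bounds
  express density of the precoloring and sparseness of the lists.\<close>

locale placed = sbase V C nb0 Q cl X
  for V :: "'v set" and C :: "'c set" and nb0 Q cl X +
  fixes L :: "'v set \<Rightarrow> 'c set" and \<phi> :: "'v set \<rightharpoonup> 'c" and \<epsilon> s :: real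
  assumes card_C: "card V \<le> card C + 1"
    and \<epsilon>: "real (card V) = 10 ^ 12 * \<epsilon>" and \<epsilon>_big: "\<epsilon> \<ge> 1000"
    and s: "s = 100 * \<epsilon>"
    and \<phi>_dom: "e \<in> dom \<phi> \<Longrightarrow> \<exists>x\<in>V. \<exists>y\<in>V. x \<noteq> y \<and> e = {x, y}"
    and \<phi>_C: "\<phi> e = Some c \<Longrightarrow> c \<in> C"
    and \<phi>_proper: "\<phi> e = Some c \<Longrightarrow> \<phi> e' = Some c \<Longrightarrow> x \<in> e \<Longrightarrow> x \<in> e' \<Longrightarrow> e = e'"
    and \<phi>_L: "\<phi> e = Some c \<Longrightarrow> c \<notin> L e"
    and L_edge: "x \<in> V \<Longrightarrow> y \<in> V \<Longrightarrow> x \<noteq> y \<Longrightarrow> real (card {k\<in>C. k \<in> L {x, y}}) \<le> \<epsilon>"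
    and L_vertex: "x \<in> V \<Longrightarrow> k \<in> C \<Longrightarrow> real (card {y\<in>V. y \<noteq> x \<and> k \<in> L {x, y}}) \<le> \<epsilon>"
    and \<phi>_vertex: "x \<in> V \<Longrightarrow> real (card {e\<in>dom \<phi>. x \<in> e}) \<le> \<epsilon>"
    and \<phi>_color: "k \<in> C \<Longrightarrow> real (card {e\<in>dom \<phi>. \<phi> e = Some k}) \<le> \<epsilon>"
    and \<phi>_load: "y \<in> V \<Longrightarrow> real (card {k\<in>C. \<exists>e\<in>dom \<phi>. nb0 k y \<in> e \<and> \<phi> e = Some k}) \<le> \<epsilon>"
    and \<phi>_class: "k \<in> C \<Longrightarrow> real (card {x\<in>V. {x, nb0 k x} \<in> dom \<phi>}) \<le> \<epsilon>"
    and conflict_vertex: "x \<in> V \<Longrightarrow> real (card {k\<in>C. k \<in> L {x, nb0 k x}}) \<le> \<epsilon>"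
    and conflict_class: "k \<in> C \<Longrightarrow> real (card {x\<in>V. k \<in> L {x, nb0 k x}}) \<le> \<epsilon>"
begin

definition conflicts :: "'v set set" where
  "conflicts = {e. \<exists>x\<in>V. \<exists>k\<in>C. e = {x, nb0 k x} \<and> k \<in> L e}"

lemma conflict_at:
  assumes "e \<in> conflicts" "x \<in> e"
  shows "\<exists>k\<in>C. e = {x, nb0 k x} \<and> k \<in> L e"
proof -
  obtain y k where y: "y \<in> V" "k \<in> C" "e = {y, nb0 k y}" "k \<in> L e"
    using assms(1) by (auto simp: conflicts_def)
  then consider "x = y" | "x = nb0 k y" using assms(2) by auto
  then show ?thesis
  proof cases
    case 1
    then show ?thesis using y by blast
  next
    case 2
    then have "{x, nb0 k x} = e" using y csysD(3)[OF cs0 y(2,1)] by auto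
    then show ?thesis using y(2,4) by blast
  qed
qed

lemma conflicts_edge:
  assumes "e \<in> conflicts"
  shows "\<exists>x\<in>V. \<exists>y\<in>V. x \<noteq> y \<and> e = {x, y}"
proof -
  obtain y k where "y \<in> V" "k \<in> C" "e = {y, nb0 k y}"
    using assms by (auto simp: conflicts_def)
  then show ?thesis using csysD[OF cs0, of k y] by metis
qed

lemma dom_fin: "finite (dom \<phi>)"
proof (rule finite_subset)
  show "dom \<phi> \<subseteq> Pow V" using \<phi>_dom by blast
qed (use finV in simp)

lemma conflicts_fin: "finite conflicts"
proof (rule finite_subset)
  show "conflicts \<subseteq> Pow V" using conflicts_edge by blast
qed (use finV in simp)

lemma edges_vertex:
  assumes x: "x \<in> V"
  shows "real (card {e\<in>dom \<phi> \<union> conflicts. x \<in> e}) \<le> 2 * \<epsilon>"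
proof -
  have "{e\<in>conflicts. x \<in> e} \<subseteq> (\<lambda>k. {x, nb0 k x}) ` {k\<in>C. k \<in> L {x, nb0 k x}}"
    using conflict_at by fastforce
  then have "card {e\<in>conflicts. x \<in> e} \<le> card {k\<in>C. k \<in> L {x, nb0 k x}}"
    using finC by (intro surj_card_le) auto
  then have 1: "real (card {e\<in>conflicts. x \<in> e}) \<le> \<epsilon>" using conflict_vertex[OF x] by linarith
  have "{e\<in>dom \<phi> \<union> conflicts. x \<in> e} = {e\<in>dom \<phi>. x \<in> e} \<union> {e\<in>conflicts. x \<in> e}" by auto
  then show ?thesis using card_Un_real[OF \<phi>_vertex[OF x] 1] by simp
qed

text \<open>A pair may be in conflict because of its second color rather than \<open>k\<close>; the
  10 accounts for the doubly covered pairs.\<close>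

lemma edges_class:
  assumes k: "k \<in> C"
  shows "real (card {x\<in>V. {x, nb0 k x} \<in> dom \<phi> \<union> conflicts}) \<le> 2 * \<epsilon> + 10"
proof -
  have 1: "real (card {x\<in>V. \<exists>k'\<in>C. k' \<noteq> k \<and> nb0 k' x = nb0 k x}) \<le> 10" using dup[OF k] by linarith
  have sub: "{x\<in>V. {x, nb0 k x} \<in> dom \<phi> \<union> conflicts} \<subseteq> {x\<in>V. {x, nb0 k x} \<in> dom \<phi>}
     \<union> {x\<in>V. k \<in> L {x, nb0 k x}} \<union> {x\<in>V. \<exists>k'\<in>C. k' \<noteq> k \<and> nb0 k' x = nb0 k x}"
  proof
    fix x assume x: "x \<in> {x\<in>V. {x, nb0 k x} \<in> dom \<phi> \<union> conflicts}"
    show "x \<in> {x\<in>V. {x, nb0 k x} \<in> dom \<phi>} \<union> {x\<in>V. k \<in> L {x, nb0 k x}}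
      \<union> {x\<in>V. \<exists>k'\<in>C. k' \<noteq> k \<and> nb0 k' x = nb0 k x}"
    proof (cases "{x, nb0 k x} \<in> dom \<phi>")
      case True then show ?thesis using x by blast
    next
      case False
      then have "{x, nb0 k x} \<in> conflicts" using x by blast
      from conflict_at[OF this insertI1] obtain j
        where j: "j \<in> C" "{x, nb0 k x} = {x, nb0 j x}" "j \<in> L {x, nb0 k x}" by blast
      then have "nb0 j x = nb0 k x" by (auto simp: doubleton_eq_iff)
      then show ?thesis using j x by (cases "j = k") auto
    qed
  qed
  have "real (card ({x\<in>V. {x, nb0 k x} \<in> dom \<phi>} \<union> {x\<in>V. k \<in> L {x, nb0 k x}}
    \<union> {x\<in>V. \<exists>k'\<in>C. k' \<noteq> k \<and> nb0 k' x = nb0 k x})) \<le> \<epsilon> + \<epsilon> + 10"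
    by (intro card_Un_real \<phi>_class conflict_class k 1)
  from card_subset_real[OF sub _ this] show ?thesis using finV by simp
qed

definition admissible :: "('v set \<rightharpoonup> 'c) \<Rightarrow> 'v set set \<Rightarrow> bool" where
  "admissible P E \<longleftrightarrow> \<phi> \<subseteq>\<^sub>m P \<and> dom P = dom \<phi> \<union> E \<and> (\<forall>e c. P e = Some c \<longrightarrow> c \<in> C \<and> c \<notin> L e) \<and>
     (\<forall>e e' c x. P e = Some c \<longrightarrow> P e' = Some c \<longrightarrow> x \<in> e \<longrightarrow> x \<in> e' \<longrightarrow> e = e') \<and>
     (\<forall>k\<in>C. real (card {e\<in>dom P. P e = Some k}) \<le> s) \<and>
     (\<forall>y\<in>V. real (card {k\<in>C. \<exists>e\<in>dom P. nb0 k y \<in> e \<and> P e = Some k}) \<le> s)"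

lemma admissibleD:
  assumes "admissible P E"
  shows "\<phi> \<subseteq>\<^sub>m P" "dom P = dom \<phi> \<union> E" "\<And>e c. P e = Some c \<Longrightarrow> c \<in> C" "\<And>e c. P e = Some c \<Longrightarrow> c \<notin> L e"
    "\<And>e e' c x. P e = Some c \<Longrightarrow> P e' = Some c \<Longrightarrow> x \<in> e \<Longrightarrow> x \<in> e' \<Longrightarrow> e = e'"
    "\<And>k. k \<in> C \<Longrightarrow> real (card {e\<in>dom P. P e = Some k}) \<le> s"
    "\<And>y. y \<in> V \<Longrightarrow> real (card {k\<in>C. \<exists>e\<in>dom P. nb0 k y \<in> e \<and> P e = Some k}) \<le> s"
proof -
  note A = assms[unfolded admissible_def]
  show "\<phi> \<subseteq>\<^sub>m P" by (rule A[THEN conjunct1])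
  show "dom P = dom \<phi> \<union> E" by (rule A[THEN conjunct2, THEN conjunct1])
  note A' = A[THEN conjunct2, THEN conjunct2]
  have "\<forall>e c. P e = Some c \<longrightarrow> c \<in> C \<and> c \<notin> L e" by (rule A'[THEN conjunct1])
  then show "\<And>e c. P e = Some c \<Longrightarrow> c \<in> C" "\<And>e c. P e = Some c \<Longrightarrow> c \<notin> L e" by blast+
  have "\<forall>e e' c x. P e = Some c \<longrightarrow> P e' = Some c \<longrightarrow> x \<in> e \<longrightarrow> x \<in> e' \<longrightarrow> e = e'"
    by (rule A'[THEN conjunct2, THEN conjunct1])
  then show "\<And>e e' c x. P e = Some c \<Longrightarrow> P e' = Some c \<Longrightarrow> x \<in> e \<Longrightarrow> x \<in> e' \<Longrightarrow> e = e'" by blast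
  have "\<forall>k\<in>C. real (card {e\<in>dom P. P e = Some k}) \<le> s" by (rule A'[THEN conjunct2, THEN conjunct2, THEN conjunct1])
  then show "\<And>k. k \<in> C \<Longrightarrow> real (card {e\<in>dom P. P e = Some k}) \<le> s" by blast
  have "\<forall>y\<in>V. real (card {k\<in>C. \<exists>e\<in>dom P. nb0 k y \<in> e \<and> P e = Some k}) \<le> s" by (rule A'[THEN conjunct2, THEN conjunct2, THEN conjunct2])
  then show "\<And>y. y \<in> V \<Longrightarrow> real (card {k\<in>C. \<exists>e\<in>dom P. nb0 k y \<in> e \<and> P e = Some k}) \<le> s" by blast
qed

text \<open>Color counts and loads each sum to at most \<open>card V * (2 * \<epsilon>)\<close>. As
  \<open>s\<close> is 100 times \<open>\<epsilon>\<close>, Markov's inequality puts at most 4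
  percent of \<open>card V\<close> above \<open>s - 1\<close>. This excludes heavy colors and colors
  leading from \<open>u\<close> or \<open>v\<close> to a heavily loaded vertex; lists and colors
  already used at \<open>u\<close> or \<open>v\<close> are negligible.\<close>

lemma free_color:
  assumes P: "admissible P E" and E: "E \<subseteq> conflicts" and u: "u \<in> V" and v: "v \<in> V" and uv: "u \<noteq> v"
  obtains c where "c \<in> C" "c \<notin> L {u, v}" "\<not> (\<exists>e\<in>dom P. u \<in> e \<and> P e = Some c)"
    "\<not> (\<exists>e\<in>dom P. v \<in> e \<and> P e = Some c)" "real (card {e\<in>dom P. P e = Some c}) \<le> s - 1"
    "\<And>y. y \<in> {nb0 c u, nb0 c v} \<Longrightarrow> real (card {k\<in>C. \<exists>e\<in>dom P. nb0 k y \<in> e \<and> P e = Some k}) \<le> s - 1"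
proof -
  let ?pd = "\<lambda>x k. \<exists>e\<in>dom P. x \<in> e \<and> P e = Some k"
  let ?ld = "\<lambda>y. real (card {k\<in>C. \<exists>e\<in>dom P. nb0 k y \<in> e \<and> P e = Some k})"
  have dP: "dom P \<subseteq> dom \<phi> \<union> conflicts" using admissibleD(2)[OF P] E by auto
  have fd: "finite (dom P)" using finite_subset[OF dP] dom_fin conflicts_fin by auto
  have vert: "real (card {e\<in>dom P. x \<in> e}) \<le> 2 * \<epsilon>" if "x \<in> V" for x
    by (rule card_subset_real[OF _ _ edges_vertex[OF that]]) (use dP dom_fin conflicts_fin in auto)
  have pdc: "card {k\<in>C. ?pd x k} \<le> card {e\<in>dom P. x \<in> e}" for x
  proof -
    have "{k\<in>C. ?pd x k} \<subseteq> (\<lambda>e. the (P e)) ` {e\<in>dom P. x \<in> e}" by force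
    then show ?thesis using fd by (intro surj_card_le) auto
  qed
  have pd2: "real (card {k\<in>C. ?pd x k}) \<le> 2 * \<epsilon>" if "x \<in> V" for x
    using pdc[of x] vert[OF that] by linarith
  have sumv: "(\<Sum>x\<in>V. real (card {e\<in>dom P. x \<in> e})) \<le> card V * (2 * \<epsilon>)"
    using sum_mono[OF vert] by simp
  have dP_edge: "\<exists>x\<in>V. x \<in> e" if "e \<in> dom P" for e
    using that dP \<phi>_dom[of e] conflicts_edge[of e] by blast
  have sumc: "(\<Sum>k\<in>C. real (card {e\<in>dom P. P e = Some k})) \<le> card V * (2 * \<epsilon>)"
  proof -
    have "(\<Sum>k\<in>C. card {e\<in>dom P. P e = Some k}) = (\<Sum>e\<in>dom P. card {k\<in>C. P e = Some k})"
      by (rule double_count[OF finC fd])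
    also have "\<dots> \<le> (\<Sum>e\<in>dom P. card {x\<in>V. x \<in> e})"
    proof (rule sum_mono)
      fix e assume e: "e \<in> dom P"
      have "card {k\<in>C. P e = Some k} \<le> card {the (P e)}" by (intro card_mono) auto
      moreover have "card {x\<in>V. x \<in> e} \<ge> 1"
        using dP_edge[OF e] finV by (auto simp: Suc_le_eq card_gt_0_iff)
      ultimately show "card {k\<in>C. P e = Some k} \<le> card {x\<in>V. x \<in> e}" by simp
    qed
    also have "\<dots> = (\<Sum>x\<in>V. card {e\<in>dom P. x \<in> e})" by (rule double_count[OF fd finV])
    finally have "real (\<Sum>k\<in>C. card {e\<in>dom P. P e = Some k}) \<le> real (\<Sum>x\<in>V. card {e\<in>dom P. x \<in> e})"
      by (rule of_nat_mono)
    then show ?thesis using sumv unfolding of_nat_sum by linarith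
  qed
  have suml: "(\<Sum>y\<in>V. ?ld y) \<le> card V * (2 * \<epsilon>)"
  proof -
    have "(\<Sum>y\<in>V. card {k\<in>C. ?pd (nb0 k y) k}) = (\<Sum>k\<in>C. card {y\<in>V. ?pd (nb0 k y) k})"
      by (rule double_count[OF finV finC])
    also have "\<dots> \<le> (\<Sum>k\<in>C. card {x\<in>V. ?pd x k})"
    proof (rule sum_mono)
      fix k assume k: "k \<in> C"
      have "{y\<in>V. ?pd (nb0 k y) k} = {y\<in>V. nb0 k y \<in> {x\<in>V. ?pd x k}}"
        using csysD(1)[OF cs0 k] by auto
      then show "card {y\<in>V. ?pd (nb0 k y) k} \<le> card {x\<in>V. ?pd x k}"
        using card_vimage_nb_le[OF cs0 k finV, of "{x\<in>V. ?pd x k}"] by (simp add: Int_absorb2)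
    qed
    also have "\<dots> = (\<Sum>x\<in>V. card {k\<in>C. ?pd x k})" by (rule double_count[OF finC finV])
    also have "\<dots> \<le> (\<Sum>x\<in>V. card {e\<in>dom P. x \<in> e})" by (rule sum_mono[OF pdc])
    finally have "real (\<Sum>y\<in>V. card {k\<in>C. ?pd (nb0 k y) k}) \<le> real (\<Sum>x\<in>V. card {e\<in>dom P. x \<in> e})"
      by (rule of_nat_mono)
    then show ?thesis using sumv unfolding of_nat_sum by linarith
  qed
  have pos: "\<epsilon> > 0" using \<epsilon>_big by simp
  have bound: "real (card V) * (2 * \<epsilon>) / (s - 1) \<le> 4 * 10 ^ 10 * \<epsilon>"
  proof -
    have "real (card V) * (2 * \<epsilon>) = \<epsilon> * (2 * 10 ^ 12 * \<epsilon>)" using \<epsilon> by simp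
    also have "\<dots> \<le> \<epsilon> * (4 * 10 ^ 10 * (s - 1))" using \<epsilon>_big s by (intro mult_left_mono) auto
    finally show ?thesis using \<epsilon>_big s by (simp add: pos_divide_le_eq)
  qed
  have heavy_c: "real (card {k\<in>C. real (card {e\<in>dom P. P e = Some k}) > s - 1}) \<le> 4 * 10 ^ 10 * \<epsilon>"
    by (rule order_trans[OF card_large_le[OF finC _ sumc] bound]) (use \<epsilon>_big s in auto)
  have heavy_l: "real (card {y\<in>V. ?ld y > s - 1}) \<le> 4 * 10 ^ 10 * \<epsilon>"
    by (rule order_trans[OF card_large_le[OF finV _ suml] bound]) (use \<epsilon>_big s in auto)
  have via: "real (card {k\<in>C. nb0 k x \<in> {y\<in>V. ?ld y > s - 1}}) \<le> 4 * 10 ^ 10 * \<epsilon> + 1" if "x \<in> V" for x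
    using card_colors_le[OF cs0 finV finC cardC that, of "{y\<in>V. ?ld y > s - 1}"] heavy_l
    by (simp add: Int_absorb2)
  let ?U = "{k\<in>C. k \<in> L {u, v}} \<union> {k\<in>C. ?pd u k} \<union> {k\<in>C. ?pd v k}
    \<union> {k\<in>C. real (card {e\<in>dom P. P e = Some k}) > s - 1}
    \<union> {k\<in>C. nb0 k u \<in> {y\<in>V. ?ld y > s - 1}} \<union> {k\<in>C. nb0 k v \<in> {y\<in>V. ?ld y > s - 1}}"
  have "real (card ?U) \<le> \<epsilon> + 2 * \<epsilon> + 2 * \<epsilon> + 4 * 10 ^ 10 * \<epsilon> + (4 * 10 ^ 10 * \<epsilon> + 1) + (4 * 10 ^ 10 * \<epsilon> + 1)"
    by (intro card_Un_real L_edge[OF u v uv] pd2 u v heavy_c via)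
  also have "\<dots> < 10 ^ 12 * \<epsilon> - 1" using \<epsilon>_big by simp
  also have "\<dots> \<le> real (card C)" using \<epsilon> card_C by linarith
  finally have "card ?U < card C" by linarith
  then have "\<not> C \<subseteq> ?U" using card_mono[of ?U C] finC by auto
  then obtain c where "c \<in> C" "c \<notin> ?U" by blast
  then show ?thesis using csysD(1)[OF cs0 _ u] csysD(1)[OF cs0 _ v] by (intro that[of c]) auto
qed

lemma admissible_insert:
  assumes P: "admissible P E" and E: "E \<subseteq> conflicts" and e: "e \<in> conflicts" "e \<notin> dom P"
  shows "\<exists>P'. admissible P' (insert e E)"
proof -
  obtain u v where uv: "u \<in> V" "v \<in> V" "u \<noteq> v" "e = {u, v}" using conflicts_edge[OF e(1)] by blast
  obtain c where c: "c \<in> C" "c \<notin> L {u, v}" "\<not> (\<exists>e\<in>dom P. u \<in> e \<and> P e = Some c)"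
    "\<not> (\<exists>e\<in>dom P. v \<in> e \<and> P e = Some c)" "real (card {e\<in>dom P. P e = Some c}) \<le> s - 1"
    and cy: "\<And>y. y \<in> {nb0 c u, nb0 c v} \<Longrightarrow> real (card {k\<in>C. \<exists>e\<in>dom P. nb0 k y \<in> e \<and> P e = Some k}) \<le> s - 1"
    using free_color[OF P E uv(1-3)] by blast
  note D = admissibleD[OF P]
  have dP: "dom P \<subseteq> dom \<phi> \<union> conflicts" using D(2) E by auto
  have fd: "finite (dom P)" using finite_subset[OF dP] dom_fin conflicts_fin by auto
  let ?P = "P(e \<mapsto> c)"
  have none: "\<not> (P e' = Some c \<and> x \<in> e' \<and> x \<in> e)" for e' x
    using c(3,4) uv(4) by blast
  have "admissible ?P (insert e E)"
    unfolding admissible_def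
  proof (intro conjI allI impI ballI)
    show "\<phi> \<subseteq>\<^sub>m ?P" using D(1) e(2) by (auto simp: map_le_def dom_def)
    show "dom ?P = dom \<phi> \<union> insert e E" using D(2) by auto
    show "k \<in> C" "k \<notin> L e'" if "?P e' = Some k" for e' k
      using that D(3,4)[of e' k] c uv(4) by (auto split: if_splits)
    show "e1 = e2" if "?P e1 = Some k" "?P e2 = Some k" "x \<in> e1" "x \<in> e2" for e1 e2 k x
      using that D(5)[of e1 k e2 x] none[of e1 x] none[of e2 x] by (auto split: if_splits)
  next
    fix k assume k: "k \<in> C"
    show "real (card {e'\<in>dom ?P. ?P e' = Some k}) \<le> s"
    proof (cases "k = c")
      case True
      have "card {e'\<in>dom ?P. ?P e' = Some k} \<le> card (insert e {e\<in>dom P. P e = Some c})"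
        using fd True by (intro card_mono) (auto split: if_splits)
      also have "\<dots> \<le> card {e\<in>dom P. P e = Some c} + 1" using fd by (simp add: card_insert_if)
      finally show ?thesis using c(5) by linarith
    next
      case False
      have "card {e'\<in>dom ?P. ?P e' = Some k} \<le> card {e\<in>dom P. P e = Some k}"
        using fd False by (intro card_mono) (auto split: if_splits)
      then show ?thesis using D(6)[OF k] by linarith
    qed
  next
    fix y assume y: "y \<in> V"
    let ?A = "{k\<in>C. \<exists>e\<in>dom P. nb0 k y \<in> e \<and> P e = Some k}"
    let ?B = "{k\<in>C. \<exists>e\<in>dom ?P. nb0 k y \<in> e \<and> ?P e = Some k}"
    show "real (card ?B) \<le> s"
    proof (cases "y \<in> {nb0 c u, nb0 c v}")
      case True
      have "?B \<subseteq> insert c ?A" by (auto split: if_splits)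
      then have "card ?B \<le> card (insert c ?A)" using finC by (intro card_mono) auto
      also have "\<dots> \<le> card ?A + 1" using finC by (simp add: card_insert_if)
      finally show ?thesis using cy[OF True] by linarith
    next
      case False
      \<comment> \<open>Coloring \<open>{u, v}\<close> with \<open>c\<close> affects the load only
        at the \<open>c\<close>-neighbors of \<open>u\<close> and \<open>v\<close>.\<close>
      have "nb0 c y \<notin> e"
      proof
        assume "nb0 c y \<in> e"
        then have "nb0 c y = u \<or> nb0 c y = v" using uv(4) by auto
        then show False using False csysD(3)[OF cs0 c(1) y] by auto
      qed
      then have "?B \<subseteq> ?A" by (auto split: if_splits)
      then have "card ?B \<le> card ?A" using finC by (intro card_mono) auto
      then show ?thesis using D(7)[OF y] by linarith
    qed
  qed
  then show ?thesis by blast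
qed

lemma admissible_initial: "admissible \<phi> {}"
proof -
  have "\<epsilon> \<le> s" using s \<epsilon>_big by simp
  then show ?thesis
    unfolding admissible_def
    by (intro conjI allI impI ballI)
       (use \<phi>_C \<phi>_L in blast | rule \<phi>_proper; assumption | rule order_trans[OF \<phi>_color] order_trans[OF \<phi>_load]; assumption | simp add: map_le_def)+
qed

lemma admissible_conflicts: "\<exists>P. admissible P conflicts"
proof -
  have "\<exists>P. admissible P E" if "finite E" "E \<subseteq> conflicts" for E
    using that
  proof (induction E)
    case empty
    then show ?case using admissible_initial by blast
  next
    case (insert e E)
    then obtain P where P: "admissible P E" by auto
    show ?case
    proof (cases "e \<in> dom P")
      case True
      then have "admissible P (insert e E)" using P unfolding admissible_def by auto
      then show ?thesis by blast
    next
      case False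
      then show ?thesis using admissible_insert[OF P] insert.prems by blast
    qed
  qed
  then show ?thesis using conflicts_fin by blast
qed

lemma completion:
  obtains P nb where "\<phi> \<subseteq>\<^sub>m P" "csys V C nb" "\<And>e c. P e = Some c \<Longrightarrow> c \<in> C \<and> c \<notin> L e"
    "\<And>x y. x \<in> V \<Longrightarrow> y \<in> V \<Longrightarrow> {x, y} \<in> dom P \<Longrightarrow> nb (the (P {x, y})) x = y"
    "\<And>x k. x \<in> V \<Longrightarrow> k \<in> C \<Longrightarrow> {x, nb k x} \<notin> dom P \<Longrightarrow> k \<notin> L {x, nb k x}"
proof -
  obtain P where P: "admissible P conflicts" using admissible_conflicts by blast
  note D = admissibleD[OF P]
  have \<epsilon>s: "\<epsilon> \<le> s" "2 * \<epsilon> \<le> s" "2 * \<epsilon> + 10 \<le> s" using s \<epsilon>_big by auto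
  \<comment> \<open>As \<open>card V\<close> is 10 ^ 12 times \<open>\<epsilon>\<close>, hence 10 ^
    10 times \<open>s\<close>, taking \<open>r\<close> as a thousandth of \<open>card V\<close>
    makes \<open>s\<close> equal to r / 10 ^ 7.\<close>
  interpret G: precolored V C nb0 Q cl X L P "real (card V) / 1000" s
  proof unfold_locales
    show "real (card V) = 1000 * (real (card V) / 1000)" by simp
    show "10 ^ 6 \<le> real (card V) / 1000" using \<epsilon> \<epsilon>_big by simp
    show "s = real (card V) / 1000 / 10 ^ 7" using \<epsilon> s by simp
    show "11 \<le> s" using s \<epsilon>_big by simp
    show "\<exists>x\<in>V. \<exists>y\<in>V. x \<noteq> y \<and> e = {x, y}" if "e \<in> dom P" for e
      using that D(2) \<phi>_dom[of e] conflicts_edge[of e] by blast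
    show "c \<in> C" "c \<notin> L e" if "P e = Some c" for e c using D(3,4) that by blast+
    show "e = e'" if "P e = Some c" "P e' = Some c" "x \<in> e" "x \<in> e'" for e e' c x
      by (rule D(5)[OF that])
    show "real (card {k \<in> C. k \<in> L {x, y}}) \<le> s" if "x \<in> V" "y \<in> V" "x \<noteq> y" for x y
      using L_edge[OF that] \<epsilon>s by linarith
    show "real (card {y \<in> V. y \<noteq> x \<and> k \<in> L {x, y}}) \<le> s" if "x \<in> V" "k \<in> C" for x k
      using L_vertex[OF that] \<epsilon>s by linarith
    show "real (card {e \<in> dom P. x \<in> e}) \<le> s" if "x \<in> V" for x
      using edges_vertex[OF that] \<epsilon>s D(2) by simp
    show "real (card {e \<in> dom P. P e = Some k}) \<le> s" if "k \<in> C" for k by (rule D(6)[OF that])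
    show "real (card {k \<in> C. \<exists>e\<in>dom P. nb0 k y \<in> e \<and> P e = Some k}) \<le> s" if "y \<in> V" for y
      by (rule D(7)[OF that])
    show "real (card {x \<in> V. {x, nb0 k x} \<in> dom P}) \<le> s" if "k \<in> C" for k
      using edges_class[OF that] \<epsilon>s unfolding D(2) by linarith
    show "{x, nb0 k x} \<in> dom P" if "x \<in> V" "k \<in> C" "k \<in> L {x, nb0 k x}" for x k
      using that unfolding D(2) conflicts_def by blast
  qed
  obtain nb where "csys V C nb"
    "\<And>x y. x \<in> V \<Longrightarrow> y \<in> V \<Longrightarrow> {x, y} \<in> dom P \<Longrightarrow> nb (the (P {x, y})) x = y"
    "\<And>x k. x \<in> V \<Longrightarrow> k \<in> C \<Longrightarrow> {x, nb k x} \<notin> dom P \<Longrightarrow> k \<notin> L {x, nb k x}"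
    using G.extension by blast
  then show ?thesis using that[of P nb] D(1,3,4) by blast
qed

end

section \<open>The main theorem\<close>

lemma complete_edges_iff: "e \<in> complete_edges V \<longleftrightarrow> (\<exists>x\<in>V. \<exists>y\<in>V. x \<noteq> y \<and> e = {x, y})"
proof
  assume "e \<in> complete_edges V"
  then have e: "e \<subseteq> V" "card e = 2" by (auto simp: complete_edges_def nsets_def)
  then obtain x y where "e = {x, y}" "x \<noteq> y" by (meson card_2_iff)
  then show "\<exists>x\<in>V. \<exists>y\<in>V. x \<noteq> y \<and> e = {x, y}" using e by blast
next
  assume "\<exists>x\<in>V. \<exists>y\<in>V. x \<noteq> y \<and> e = {x, y}"
  then show "e \<in> complete_edges V" by (auto simp: complete_edges_def nsets_def card_2_iff)
qed

lemma finite_complete_edges: "finite V \<Longrightarrow> finite (complete_edges V)"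
  unfolding complete_edges_def by (rule finite_imp_finite_nsets)

text \<open>A pair covered by two colors may take either, so the choice has to respect
  \<open>P\<close> first; elsewhere any covering color will do.\<close>

lemma coloring_from_csys:
  assumes cs: "csys V {1..m} nb"
    and P_C: "\<And>e c. P e = Some c \<Longrightarrow> c \<in> {1..m}"
    and P_nb: "\<And>x y. x \<in> V \<Longrightarrow> y \<in> V \<Longrightarrow> {x, y} \<in> dom P \<Longrightarrow> nb (the (P {x, y})) x = y"
  obtains f where "proper_edge_coloring (complete_edges V) m f"
    "\<And>e c. P e = Some c \<Longrightarrow> f e = c"
    "\<And>x y. x \<in> V \<Longrightarrow> y \<in> V \<Longrightarrow> x \<noteq> y \<Longrightarrow> f {x, y} \<in> {1..m} \<and> nb (f {x, y}) x = y"
proof -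
  define g where "g = (\<lambda>e. SOME k. k \<in> {1..m} \<and> (\<forall>x\<in>e. \<forall>y\<in>e. x \<noteq> y \<longrightarrow> nb k x = y))"
  define f where "f = (\<lambda>e. case P e of Some c \<Rightarrow> c | None \<Rightarrow> g e)"
  have g: "g {x, y} \<in> {1..m} \<and> nb (g {x, y}) x = y" if xy: "x \<in> V" "y \<in> V" "x \<noteq> y" for x y
  proof -
    obtain k where k: "k \<in> {1..m}" "nb k x = y" using csys_cover[OF cs xy] by blast
    then have "nb k y = x" using csysD(3)[OF cs k(1) xy(1)] by simp
    then have "k \<in> {1..m} \<and> (\<forall>x'\<in>{x, y}. \<forall>y'\<in>{x, y}. x' \<noteq> y' \<longrightarrow> nb k x' = y')" using k by auto
    then have "g {x, y} \<in> {1..m} \<and> (\<forall>x'\<in>{x, y}. \<forall>y'\<in>{x, y}. x' \<noteq> y' \<longrightarrow> nb (g {x, y}) x' = y')"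
      unfolding g_def by (rule someI)
    then show ?thesis using xy by auto
  qed
  have f: "f {x, y} \<in> {1..m} \<and> nb (f {x, y}) x = y" if xy: "x \<in> V" "y \<in> V" "x \<noteq> y" for x y
  proof (cases "P {x, y}")
    case None
    then show ?thesis using g[OF xy] by (simp add: f_def)
  next
    case (Some c)
    then show ?thesis using P_C[OF Some] P_nb[OF xy(1,2)] by (auto simp: f_def)
  qed
  have "proper_edge_coloring (complete_edges V) m f"
    unfolding proper_edge_coloring_def
  proof (intro conjI ballI impI)
    fix e assume "e \<in> complete_edges V"
    then show "f e \<in> {1..m}" using f unfolding complete_edges_iff by blast
  next
    fix e e' assume e: "e \<in> complete_edges V" "e' \<in> complete_edges V" and adj: "adjacent_edges e e'"
    then obtain x where x: "x \<in> e" "x \<in> e'" "e \<noteq> e'" by (auto simp: adjacent_edges_def)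
    obtain y where y: "e = {x, y}" "x \<noteq> y" "x \<in> V" "y \<in> V"
      using e(1) x(1) unfolding complete_edges_iff by blast
    obtain z where z: "e' = {x, z}" "x \<noteq> z" "z \<in> V"
      using e(2) x(2) unfolding complete_edges_iff by blast
    show "f e \<noteq> f e'"
    proof
      assume "f e = f e'"
      then have "y = z" using f[OF y(3,4,2)] f[OF y(3) z(3,2)] y(1) z(1) by metis
      then show False using x(3) y(1) z(1) by simp
    qed
  qed
  moreover have "f e = c" if "P e = Some c" for e c using that by (simp add: f_def)
  ultimately show ?thesis using that[of f] f by blast
qed

text \<open>Squaring \<open>h < 2 ^ h\<close>, with \<open>h\<close> about half the exponent, gives
  a quadratic lower bound, which beats \<open>2 * N\<close> once \<open>h\<close> is at least 10 ^
  16.\<close>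

lemma less_two_power:
  fixes N :: nat
  assumes "N \<ge> 10 ^ 30"
  shows "2 * N < 2 ^ (N div 10 ^ 13)"
proof -
  define h where "h = N div (2 * 10 ^ 13)"
  have "h < 2 ^ h" by (rule less_exp)
  then have "h * h \<le> 2 ^ h * 2 ^ h" by (intro mult_le_mono) auto
  also have "\<dots> = 2 ^ (2 * h)" by (simp add: power_add[symmetric] mult_2)
  also have "\<dots> \<le> 2 ^ (N div 10 ^ 13)"
  proof (rule power_increasing)
    have "h = N div 10 ^ 13 div 2" by (simp add: h_def div_mult2_eq[symmetric])
    then show "2 * h \<le> N div 10 ^ 13" by simp
  qed simp
  finally have 1: "h * h \<le> 2 ^ (N div 10 ^ 13)" .
  have "N < 20000000000000 + h * 20000000000000"
    using dividend_less_div_times[of "2 * 10 ^ 13" N] by (simp add: h_def)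
  moreover have h: "10 ^ 16 \<le> h"
    using div_le_mono[OF assms, of "2 * 10 ^ 13"] by (simp add: h_def)
  then have "10000000000000000 \<le> h" by simp
  ultimately have "2 * N < 10000000000000000 * h" by linarith
  then have "2 * N < 10 ^ 16 * h" by simp
  also have "\<dots> \<le> h * h" using h by (rule mult_le_mono1)
  finally show ?thesis using 1 by linarith
qed

lemma card_edges_at:
  assumes "finite V" "x \<in> V"
  shows "card {y\<in>V. y \<noteq> x \<and> R {x, y}} \<le> card {e\<in>complete_edges V. x \<in> e \<and> R e}"
proof (rule card_inj_on_le[of "\<lambda>y. {x, y}"])
  show "inj_on (\<lambda>y. {x, y}) {y\<in>V. y \<noteq> x \<and> R {x, y}}"
    by (auto simp: inj_on_def doubleton_eq_iff)
  show "(\<lambda>y. {x, y}) ` {y\<in>V. y \<noteq> x \<and> R {x, y}} \<subseteq> {e\<in>complete_edges V. x \<in> e \<and> R e}"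
  proof clarify
    fix y assume "y \<in> V" "y \<noteq> x" "R {x, y}"
    then show "{x, y} \<in> complete_edges V \<and> x \<in> {x, y} \<and> R {x, y}"
      using assms(2) unfolding complete_edges_iff by blast
  qed
  show "finite {e\<in>complete_edges V. x \<in> e \<and> R e}" using finite_complete_edges[OF assms(1)] by simp
qed

text \<open>The given data are bounded by N / 10 ^ 30, so \<open>w\<close> may be taken as N / 10 ^
  29. The tail bound asks for \<open>k\<close> at least \<open>24 * w\<close> and exponentially
  large compared with \<open>N\<close>; \<open>k\<close> about N / 10 ^ 13 satisfies both and keeps
  the interference \<open>2 * k\<close> below \<open>\<epsilon>\<close>.\<close>

lemma coloring_large:
  fixes n m :: nat and V :: "nat set"
  assumes n: "n \<ge> 1" and m: "m = (if even n then 2 * n - 1 else 2 * n)" and V: "V = {1..2 * n}"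
    and pre: "edge_precoloring (complete_edges V) m \<phi>"
    and dense: "dense_coloring V m (1 / 10 ^ 30) \<phi>"
    and lists: "list_assignment (complete_edges V) m L"
    and sparse: "sparse_lists V m (1 / 10 ^ 30) L"
    and \<phi>L: "\<forall>e\<in>complete_edges V. \<forall>c. \<phi> e = Some c \<longrightarrow> c \<notin> L e"
    and large: "m \<ge> 10 ^ 30"
  shows "\<exists>f. proper_edge_coloring (complete_edges V) m f \<and>
          (\<forall>e\<in>complete_edges V. \<forall>c. \<phi> e = Some c \<longrightarrow> f e = c) \<and>
          (\<forall>e\<in>complete_edges V. f e \<notin> L e)"
proof -
  define C where "C = {1..m}"
  define N where "N = 2 * n"
  have finV: "finite V" and cV: "card V = N" and cC: "card C = m" and finC: "finite C"
    by (auto simp: V C_def N_def)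
  have mN: "m \<le> N" "N \<le> m + 1" using m n by (auto simp: N_def)
  have N30: "N \<ge> 10 ^ 30" using large mN by linarith
  have m_le: "1 / 10 ^ 30 * real m \<le> real N / 10 ^ 30" using mN by simp
  note fE = finite_complete_edges[OF finV]
  have dom\<phi>: "dom \<phi> \<subseteq> complete_edges V" and proper: "proper_edge_coloring (dom \<phi>) m (\<lambda>e. the (\<phi> e))"
    using pre by (auto simp: edge_precoloring_def)
  have \<phi>C: "c \<in> C" if "\<phi> e = Some c" for e c
    using proper that unfolding proper_edge_coloring_def C_def by (metis domI option.sel)
  have \<phi>prop: "e = e'" if "\<phi> e = Some c" "\<phi> e' = Some c" "x \<in> e" "x \<in> e'" for e e' c x
  proof (rule ccontr)
    assume "e \<noteq> e'"
    then have "adjacent_edges e e'" using that by (auto simp: adjacent_edges_def)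
    then show False using proper that unfolding proper_edge_coloring_def by (metis domI option.sel)
  qed
  have Ledge: "real (card {k\<in>C. k \<in> L {x, y}}) \<le> real N / 10 ^ 30" if "x \<in> V" "y \<in> V" "x \<noteq> y" for x y
  proof -
    have e: "{x, y} \<in> complete_edges V" using that unfolding complete_edges_iff by blast
    have "L {x, y} \<subseteq> {1..m}" using lists e by (auto simp: list_assignment_def)
    then have "{k\<in>C. k \<in> L {x, y}} = L {x, y}" by (auto simp: C_def)
    moreover have "real (card (L {x, y})) \<le> 1 / 10 ^ 30 * real m"
      using sparse e unfolding sparse_lists_def by blast
    ultimately show ?thesis using m_le by simp
  qed
  have Lvert: "real (card {y\<in>V. y \<noteq> x \<and> k \<in> L {x, y}}) \<le> real N / 10 ^ 30" if "x \<in> V" "k \<in> C" for x k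
  proof -
    have "real (card {e\<in>complete_edges V. x \<in> e \<and> k \<in> L e}) \<le> 1 / 10 ^ 30 * real m"
      using sparse that unfolding sparse_lists_def C_def by blast
    then show ?thesis using card_edges_at[OF finV that(1), of "\<lambda>e. k \<in> L e"] m_le by linarith
  qed
  have dv: "real (card {e\<in>complete_edges V. x \<in> e \<and> \<phi> e \<noteq> None}) \<le> real N / 10 ^ 30" if "x \<in> V" for x
  proof -
    have "real (card {e\<in>complete_edges V. x \<in> e \<and> \<phi> e \<noteq> None}) \<le> 1 / 10 ^ 30 * real m"
      using dense that unfolding dense_coloring_def by blast
    then show ?thesis using m_le by linarith
  qed
  have \<phi>vert: "real (card {e\<in>dom \<phi>. x \<in> e}) \<le> real N / 10 ^ 30" if "x \<in> V" for x
  proof -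
    have "{e\<in>dom \<phi>. x \<in> e} = {e\<in>complete_edges V. x \<in> e \<and> \<phi> e \<noteq> None}" using dom\<phi> by auto
    then show ?thesis using dv[OF that] by simp
  qed
  have Dvert: "real (card {y\<in>V. y \<noteq> x \<and> {x, y} \<in> dom \<phi>}) \<le> real N / 10 ^ 30" if "x \<in> V" for x
    using card_edges_at[OF finV that, of "\<lambda>e. \<phi> e \<noteq> None"] dv[OF that] by (simp add: dom_def)
  have \<phi>col: "real (card {e\<in>dom \<phi>. \<phi> e = Some k}) \<le> real N / 10 ^ 30" if "k \<in> C" for k
  proof -
    have "{e\<in>dom \<phi>. \<phi> e = Some k} = {e\<in>complete_edges V. \<phi> e = Some k}" using dom\<phi> by auto
    moreover have "real (card {e\<in>complete_edges V. \<phi> e = Some k}) \<le> 1 / 10 ^ 30 * real m"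
      using dense that unfolding dense_coloring_def C_def by blast
    ultimately show ?thesis using m_le by simp
  qed
  define pd where "pd = (\<lambda>x k. \<exists>e\<in>dom \<phi>. x \<in> e \<and> \<phi> e = Some k)"
  have pdcol: "real (card {x\<in>V. pd x k}) \<le> 2 * (real N / 10 ^ 30)" if "k \<in> C" for k
  proof -
    let ?E = "{e\<in>dom \<phi>. \<phi> e = Some k}"
    have fe: "finite ?E" using finite_subset[OF dom\<phi> fE] by simp
    have "{x\<in>V. pd x k} \<subseteq> (\<Union>e\<in>?E. e \<inter> V)" by (auto simp: pd_def)
    then have "card {x\<in>V. pd x k} \<le> card (\<Union>e\<in>?E. e \<inter> V)" using fe finV by (intro card_mono) auto
    also have "\<dots> \<le> (\<Sum>e\<in>?E. card (e \<inter> V))" by (rule card_UN_le[OF fe])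
    also have "\<dots> \<le> (\<Sum>e\<in>?E. 2)"
    proof (rule sum_mono)
      fix e assume "e \<in> ?E"
      then have "e \<in> complete_edges V" using dom\<phi> by blast
      then obtain x y where "e = {x, y}" unfolding complete_edges_iff by blast
      then have "card (e \<inter> V) \<le> card {x, y}" by (intro card_mono) auto
      then show "card (e \<inter> V) \<le> 2" by (rule order_trans) (simp add: card_insert_if)
    qed
    finally have "card {x\<in>V. pd x k} \<le> 2 * card ?E" by simp
    then show ?thesis using \<phi>col[OF that] by linarith
  qed
  obtain nb Q cl X where base: "sbase V C nb Q cl X"
    using sbase_exists[OF n m] unfolding V C_def by blast
  interpret B: sbase V C nb Q cl X by (rule base)
  define w where "w = N div 10 ^ 29"
  define k where "k = N div 10 ^ 13"
  have w: "2 * (real N / 10 ^ 30) \<le> real w" "w \<ge> 1" "24 * w \<le> k"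
  proof -
    \<comment> \<open>The tenfold gap between N / 10 ^ 30 and N / 10 ^ 29 covers the factor 2 for
      the ends of an edge and the rounding.\<close>
    have Nw: "N < 10 ^ 29 + w * 10 ^ 29"
      unfolding w_def by (rule dividend_less_div_times) simp
    have w10: "10 \<le> w" using div_le_mono[OF N30, of "10 ^ 29"] by (simp add: w_def)
    have "2 * N \<le> 2 * (10 ^ 29 + w * 10 ^ 29)" using Nw by simp
    also have "\<dots> = (2 * (w + 1)) * 10 ^ 29" by (simp add: algebra_simps)
    also have "\<dots> \<le> (10 * w) * 10 ^ 29" using w10 by (intro mult_le_mono1) simp
    also have "\<dots> = w * 10 ^ 30" by simp
    finally have "real (2 * N) \<le> real (w * 10 ^ 30)" by (rule of_nat_mono)
    then show "2 * (real N / 10 ^ 30) \<le> real w" by simp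
    show "w \<ge> 1" using w10 by simp
    have "24 * w * 10 ^ 13 \<le> w * 10 ^ 29" by simp
    also have "\<dots> \<le> N" unfolding w_def by (rule div_times_less_eq_dividend)
    finally show "24 * w \<le> k" unfolding k_def by (simp add: less_eq_div_iff_mult_less_eq)
  qed
  have w': "real N / 10 ^ 30 \<le> real w" using w(1) by linarith
  interpret R: placement V C nb L "dom \<phi>" pd w k
  proof unfold_locales
    show "card {y \<in> V. y \<noteq> x \<and> c \<in> L {x, y}} \<le> w" if "x \<in> V" "c \<in> C" for x c
      using Lvert[OF that] w' by linarith
    show "card {y \<in> V. y \<noteq> x \<and> {x, y} \<in> dom \<phi>} \<le> w" if "x \<in> V" for x
      using Dvert[OF that] w' by linarith
    show "card {x \<in> V. pd x c} \<le> w" if "c \<in> C" for c using pdcol[OF that] w(1) by linarith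
    show "2 * card V < 2 ^ k" unfolding cV k_def by (rule less_two_power[OF N30])
  qed (use finV finC B.cardC B.cs0 w in auto)
  obtain \<pi> where \<pi>: "\<pi> permutes V" "\<And>x. x \<in> V \<Longrightarrow> \<not> R.bad_vertex x \<pi>" "\<And>c. c \<in> C \<Longrightarrow> \<not> R.bad_color c \<pi>"
    using R.exists_placement by blast
  have bij: "bij_betw \<pi> V V" using \<pi>(1) by (rule permutes_imp_bij)
  \<comment> \<open>Lists and precoloring stay in place; the base coloring is moved, so that
    \<open>\<pi> x\<close> takes over the role of \<open>x\<close>.\<close>
  define nb0 where "nb0 = relabel \<pi> (inv_into V \<pi>) (inv_into C id) nb"
  have base0: "sbase V C nb0 (Q \<circ> inv_into V \<pi>) (cl \<circ> inv_into C id)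
      {(x, k). (inv_into V \<pi> x, inv_into C id k) \<in> X}"
    unfolding nb0_def by (rule sbase_relabel[OF base bij bij_betw_id])
  have nb0: "nb0 c (\<pi> x) = \<pi> (nb c x)" if "x \<in> V" "c \<in> C" for x c
    using bij_betw_inv_into_left[OF bij that(1)] inv_into_f_f[of id C c] that(2)
    by (simp add: nb0_def relabel_def)
  define \<epsilon> where "\<epsilon> = real N / 10 ^ 12"
  have k2: "real (2 * k) \<le> \<epsilon>"
  proof -
    have "k * 10 ^ 13 \<le> N" by (simp add: k_def)
    then have "real (k * 10 ^ 13) \<le> real N" by (rule of_nat_mono)
    then show ?thesis by (simp add: \<epsilon>_def)
  qed
  have N\<epsilon>: "real N / 10 ^ 30 \<le> \<epsilon>" by (simp add: \<epsilon>_def field_simps)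
  have vertex: "card {c\<in>C. c \<in> L {y, nb0 c y} \<or> pd (nb0 c y) c} \<le> 2 * k" if y: "y \<in> V" for y
  proof -
    obtain x where x: "x \<in> V" "y = \<pi> x" using bij y by (auto simp: bij_betw_def)
    have "{c\<in>C. c \<in> L {y, nb0 c y} \<or> pd (nb0 c y) c} = {c\<in>C. c \<in> L {\<pi> x, \<pi> (nb c x)} \<or> pd (\<pi> (nb c x)) c}"
      using nb0[OF x(1)] x(2) by auto
    then show ?thesis using \<pi>(2)[OF x(1)] by (simp add: R.bad_vertex_def)
  qed
  have color_class: "card {x\<in>V. c \<in> L {x, nb0 c x} \<or> {x, nb0 c x} \<in> dom \<phi>} \<le> 2 * k" if c: "c \<in> C" for c
  proof -
    have "{x\<in>V. c \<in> L {\<pi> x, nb0 c (\<pi> x)} \<or> {\<pi> x, nb0 c (\<pi> x)} \<in> dom \<phi>}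
      = {x\<in>V. c \<in> L {\<pi> x, \<pi> (nb c x)} \<or> {\<pi> x, \<pi> (nb c x)} \<in> dom \<phi>}"
      using nb0[OF _ c] by auto
    then show ?thesis
      using card_permuted[OF \<pi>(1), of "\<lambda>x. c \<in> L {x, nb0 c x} \<or> {x, nb0 c x} \<in> dom \<phi>"] \<pi>(3)[OF c]
      by (simp add: R.bad_color_def)
  qed
  have sub\<epsilon>: "real (card A) \<le> \<epsilon>" if "A \<subseteq> B" "finite B" "card B \<le> 2 * k" for A B :: "nat set"
    using card_mono[OF that(2,1)] that(3) k2 by linarith
  interpret G: placed V C nb0 "Q \<circ> inv_into V \<pi>" "cl \<circ> inv_into C id"
    "{(x, k). (inv_into V \<pi> x, inv_into C id k) \<in> X}" L \<phi> \<epsilon> "100 * \<epsilon>"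
  proof (intro placed.intro base0, unfold_locales)
    show "card V \<le> card C + 1" using mN cV cC by simp
    show "real (card V) = 10 ^ 12 * \<epsilon>" by (simp add: \<epsilon>_def cV)
    have "real (10 ^ 30) \<le> real N" using N30 by (rule of_nat_mono)
    then show "1000 \<le> \<epsilon>" by (simp add: \<epsilon>_def field_simps)
    show "100 * \<epsilon> = 100 * \<epsilon>" ..
    show "\<exists>x\<in>V. \<exists>y\<in>V. x \<noteq> y \<and> e = {x, y}" if "e \<in> dom \<phi>" for e
      using subsetD[OF dom\<phi> that] unfolding complete_edges_iff .
    show "c \<in> C" if "\<phi> e = Some c" for e c by (rule \<phi>C[OF that])
    show "e = e'" if "\<phi> e = Some c" "\<phi> e' = Some c" "x \<in> e" "x \<in> e'" for e e' c x by (rule \<phi>prop[OF that])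
    show "c \<notin> L e" if "\<phi> e = Some c" for e c using \<phi>L dom\<phi> that by blast
    show "real (card {k \<in> C. k \<in> L {x, y}}) \<le> \<epsilon>" if "x \<in> V" "y \<in> V" "x \<noteq> y" for x y
      using Ledge[OF that] N\<epsilon> by linarith
    show "real (card {y \<in> V. y \<noteq> x \<and> k \<in> L {x, y}}) \<le> \<epsilon>" if "x \<in> V" "k \<in> C" for x k
      using Lvert[OF that] N\<epsilon> by linarith
    show "real (card {e \<in> dom \<phi>. x \<in> e}) \<le> \<epsilon>" if "x \<in> V" for x using \<phi>vert[OF that] N\<epsilon> by linarith
    show "real (card {e \<in> dom \<phi>. \<phi> e = Some k}) \<le> \<epsilon>" if "k \<in> C" for k using \<phi>col[OF that] N\<epsilon> by linarith
    show "real (card {k \<in> C. \<exists>e\<in>dom \<phi>. nb0 k y \<in> e \<and> \<phi> e = Some k}) \<le> \<epsilon>" if "y \<in> V" for y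
      by (rule sub\<epsilon>[OF _ _ vertex[OF that]]) (use finC in \<open>auto simp: pd_def\<close>)
    show "real (card {x \<in> V. {x, nb0 k x} \<in> dom \<phi>}) \<le> \<epsilon>" if "k \<in> C" for k
      by (rule sub\<epsilon>[OF _ _ color_class[OF that]]) (use finV in auto)
    show "real (card {k \<in> C. k \<in> L {x, nb0 k x}}) \<le> \<epsilon>" if "x \<in> V" for x
      by (rule sub\<epsilon>[OF _ _ vertex[OF that]]) (use finC in auto)
    show "real (card {x \<in> V. k \<in> L {x, nb0 k x}}) \<le> \<epsilon>" if "k \<in> C" for k
      by (rule sub\<epsilon>[OF _ _ color_class[OF that]]) (use finV in auto)
  qed
  obtain P nb' where P: "\<phi> \<subseteq>\<^sub>m P" "csys V C nb'" and PC: "\<And>e c. P e = Some c \<Longrightarrow> c \<in> C \<and> c \<notin> L e"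
    and Pnb: "\<And>x y. x \<in> V \<Longrightarrow> y \<in> V \<Longrightarrow> {x, y} \<in> dom P \<Longrightarrow> nb' (the (P {x, y})) x = y"
    and PL: "\<And>x k. x \<in> V \<Longrightarrow> k \<in> C \<Longrightarrow> {x, nb' k x} \<notin> dom P \<Longrightarrow> k \<notin> L {x, nb' k x}"
    using G.completion by blast
  obtain f where f: "proper_edge_coloring (complete_edges V) m f" "\<And>e c. P e = Some c \<Longrightarrow> f e = c"
    "\<And>x y. x \<in> V \<Longrightarrow> y \<in> V \<Longrightarrow> x \<noteq> y \<Longrightarrow> f {x, y} \<in> {1..m} \<and> nb' (f {x, y}) x = y"
    using coloring_from_csys[OF P(2)[unfolded C_def], of P] PC Pnb unfolding C_def by blast
  have "f e = c" if "\<phi> e = Some c" for e c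
    using f(2) P(1) that by (metis domI map_le_def)
  moreover have "f e \<notin> L e" if e: "e \<in> complete_edges V" for e
  proof (cases "P e")
    case (Some c)
    then show ?thesis using f(2)[OF Some] PC[OF Some] by simp
  next
    case None
    obtain x y where xy: "x \<in> V" "y \<in> V" "x \<noteq> y" "e = {x, y}" using e unfolding complete_edges_iff by blast
    have "f e \<in> C" "nb' (f e) x = y" using f(3)[OF xy(1-3)] xy(4) by (auto simp: C_def)
    then show ?thesis using PL[OF xy(1), of "f e"] None xy(4) by auto
  qed
  ultimately show ?thesis using f(1) by blast
qed

theorem theorem1p1:
  shows "\<exists>\<alpha>::real. \<exists>\<beta>::real. \<alpha> > 0 \<and> \<beta> > 0 \<and>
    (\<forall>n::nat. \<forall>m::nat. \<forall>V::nat set. \<forall>\<phi>::nat set \<rightharpoonup> nat. \<forall>L::nat set \<Rightarrow> nat set.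
       n \<ge> 1 \<longrightarrow>
       m = (if even n then 2 * n - 1 else 2 * n) \<longrightarrow>
       V = {1..2 * n} \<longrightarrow>
       edge_precoloring (complete_edges V) m \<phi> \<longrightarrow>
       dense_coloring V m \<alpha> \<phi> \<longrightarrow>
       list_assignment (complete_edges V) m L \<longrightarrow>
       sparse_lists V m \<beta> L \<longrightarrow>
       (\<forall>e\<in>complete_edges V. \<forall>c. \<phi> e = Some c \<longrightarrow> c \<notin> L e) \<longrightarrow>
       (\<exists>f::nat set \<Rightarrow> nat.
          proper_edge_coloring (complete_edges V) m f \<and>
          (\<forall>e\<in>complete_edges V. \<forall>c. \<phi> e = Some c \<longrightarrow> f e = c) \<and>
          (\<forall>e\<in>complete_edges V. f e \<notin> L e)))"
proof (rule exI[of _ "1 / 10 ^ 30"], rule exI[of _ "1 / 10 ^ 30"], intro conjI allI impI)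
  show "(0::real) < 1 / 10 ^ 30" "(0::real) < 1 / 10 ^ 30" by simp_all
  fix n m :: nat and V :: "nat set" and \<phi> :: "nat set \<rightharpoonup> nat" and L :: "nat set \<Rightarrow> nat set"
  assume n: "n \<ge> 1" and m: "m = (if even n then 2 * n - 1 else 2 * n)" and V: "V = {1..2 * n}"
    and pre: "edge_precoloring (complete_edges V) m \<phi>"
    and dense: "dense_coloring V m (1 / 10 ^ 30) \<phi>"
    and lists: "list_assignment (complete_edges V) m L"
    and sparse: "sparse_lists V m (1 / 10 ^ 30) L"
    and \<phi>L: "\<forall>e\<in>complete_edges V. \<forall>c. \<phi> e = Some c \<longrightarrow> c \<notin> L e"
  show "\<exists>f. proper_edge_coloring (complete_edges V) m f \<and>
          (\<forall>e\<in>complete_edges V. \<forall>c. \<phi> e = Some c \<longrightarrow> f e = c) \<and>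
          (\<forall>e\<in>complete_edges V. f e \<notin> L e)"
  \<comment> \<open>For smaller \<open>m\<close> the density and sparseness bounds are below 1, so
    no edge is precolored and every list is empty; the base coloring already answers the
    question.\<close>
  proof (cases "m \<ge> 10 ^ 30")
    case True
    then show ?thesis by (rule coloring_large[OF n m V pre dense lists sparse \<phi>L])
  next
    case False
    then have "real m < real (10 ^ 30)" by (simp only: of_nat_less_iff not_le)
    then have small: "1 / 10 ^ 30 * real m < 1" by simp
    have zero: "card A = 0" if "real (card A) \<le> 1 / 10 ^ 30 * real m" for A :: "'a set"
    proof -
      have "real (card A) < real 1" using that small by linarith
      then show ?thesis by (simp only: of_nat_less_iff less_one)
    qed
    have fE: "finite (complete_edges V)" by (rule finite_complete_edges) (simp add: V)
    have no\<phi>: "\<phi> e \<noteq> Some c" if e: "e \<in> complete_edges V" for e c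
    proof
      assume s: "\<phi> e = Some c"
      obtain x where x: "x \<in> V" "x \<in> e" using e unfolding complete_edges_iff by blast
      have "card {e\<in>complete_edges V. x \<in> e \<and> \<phi> e \<noteq> None} = 0"
        using dense x(1) unfolding dense_coloring_def by (intro zero) blast
      then have "{e\<in>complete_edges V. x \<in> e \<and> \<phi> e \<noteq> None} = {}" using fE by simp
      then show False using e x(2) s by blast
    qed
    have noL: "L e = {}" if e: "e \<in> complete_edges V" for e
    proof -
      have "card (L e) = 0" using sparse e unfolding sparse_lists_def by (intro zero) blast
      moreover have "finite (L e)" using lists e unfolding list_assignment_def by (meson finite_atLeastAtMost finite_subset)
      ultimately show ?thesis by simp
    qed
    obtain nb Q cl X where "sbase V {1..m} nb Q cl X" using sbase_exists[OF n m] unfolding V by blast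
    then have "csys V {1..m} nb" by (simp add: sbase_def)
    then obtain f where "proper_edge_coloring (complete_edges V) m f"
      using coloring_from_csys[of V m nb Map.empty] by (metis domIff option.distinct(1))
    then show ?thesis using no\<phi> noL by blast
  qed
qed

end
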